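(* Let $\lambda, \mu, \nu \in X(T)^{++}$ be dominant regular characters such that $X^{ss}(\mathcal{L}) \neq \emptyset$, where $\mathcal{L} = \mathcal{L}(\lambda,\mu,\nu)$ on $X = G/B \times G/B \times G/B$. If $\mathcal{L}$ descends to $X//G$, then $\lambda + \mu + \nu \in Q$.
   Context: $G$ is a simple, connected, complex linear algebraic group (simple meaning that its Lie algebra $\mathfrak{g}$ is simple), $B \subset G$ a Borel subgroup, $T \subset B$ a maximal torus, $U$ the unipotent radical of $B$. $Q$ is the root lattice, $\Lambda$ the weight lattice of $\mathfrak{g}$, $X(T)$ the character group of $T$ (so $Q \subset X(T) \subset \Lambda$), and $X(T)^{++}$ is the set of characters that are dominant regular weights (strictly positive integer combinations of fundamental weights; positivity determined by $B$). A weight regarded as a character of $T$ is written $e^\lambda$; it extends to $B = TU$ by being trivial on $U$. $G$ acts diagonally by left multiplication on $X = G/B \times G/B \times G/B$. $\mathcal{L}(\lambda) = G \times_B \mathbb{C}_{-\lambda}$ is the $G$-equivariant line bundle on $G/B$ whose elements are classes $[g,z]$ with $[g,z] = [gb^{-1}, e^{-\lambda}(b) z]$ for $b \in B$, and $\mathcal{L}(\lambda,\mu,\nu) = \mathcal{L}(\lambda) \boxtimes \mathcal{L}(\mu) \boxtimes \mathcal{L}(\nu)$ with the diagonal $G$-action. The semistable locus is $X^{ss} = X^{ss}(\mathcal{L}) = \{x \in X : \exists\, N>0,\ \exists\, \sigma \in H^0(X, \mathcal{L}^{\otimes N})^G \text{ with } \sigma(x) \neq 0\}$, and $\pi : X^{ss}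 \to X//G$ is the GIT (good) quotient determined by $\mathcal{L}$. $\mathcal{L}$ descends to $X//G$ if there is a line bundle $\hat{\mathcal{L}}$ on $X//G$ with a $G$-equivariant isomorphism $\pi^*\hat{\mathcal{L}} \cong \mathcal{L}|_{X^{ss}}$. *)

theory Defs
  imports "HOL-Analysis.Analysis" "HOL-Algebra.Generated_Groups" "HOL-Algebra.Solvable_Groups"
begin

section \<open>Spaces with functions\<close>

text \<open>
  Varieties over the complex numbers are treated classically, as topological spaces carrying a
  sheaf of complex-valued functions (as in Springer's book on linear algebraic groups).
  \<open>rg X U\<close> is the algebra of regular functions on the open set \<open>U\<close>; members are total functions of
  which only the values on \<open>U\<close> matter.
\<close>

record 'a fspace =
  tp :: "'a topology"
  rg :: "'a set \<Rightarrow> ('a \<Rightarrow> complex) set"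

definition pts :: "'a fspace \<Rightarrow> 'a set" where
  "pts X = topspace (tp X)"

definition space_with_functions :: "'a fspace \<Rightarrow> bool" where
  "space_with_functions X \<longleftrightarrow>
     (\<forall>U f g. openin (tp X) U \<and> f \<in> rg X U \<and> (\<forall>x\<in>U. f x = g x) \<longrightarrow> g \<in> rg X U) \<and>
     (\<forall>U c. openin (tp X) U \<longrightarrow> (\<lambda>_. c) \<in> rg X U) \<and>
     (\<forall>U f g. openin (tp X) U \<and> f \<in> rg X U \<and> g \<in> rg X U \<longrightarrow>
        (\<lambda>x. f x + g x) \<in> rg X U \<and> (\<lambda>x. f x * g x) \<in> rg X U) \<and>
     (\<forall>U V f. openin (tp X) U \<and> openin (tp X) V \<and> V \<subseteq> U \<and> f \<in> rg X U \<longrightarrow> f \<in> rg X V) \<and>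
     (\<forall>U f. openin (tp X) U \<and> (\<forall>x\<in>U. \<exists>V. openin (tp X) V \<and> x \<in> V \<and> V \<subseteq> U \<and> f \<in> rg X V)
        \<longrightarrow> f \<in> rg X U)"

definition regular_map :: "'a fspace \<Rightarrow> 'b fspace \<Rightarrow> ('a \<Rightarrow> 'b) \<Rightarrow> bool" where
  "regular_map X Y f \<longleftrightarrow> continuous_map (tp X) (tp Y) f \<and>
     (\<forall>V h. openin (tp Y) V \<and> h \<in> rg Y V \<longrightarrow> h \<circ> f \<in> rg X {x \<in> pts X. f x \<in> V})"

definition isomorphism :: "'a fspace \<Rightarrow> 'b fspace \<Rightarrow> ('a \<Rightarrow> 'b) \<Rightarrow> bool" where
  "isomorphism X Y f \<longleftrightarrow> regular_map X Y f \<and>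
     (\<exists>g. regular_map Y X g \<and> (\<forall>x\<in>pts X. g (f x) = x) \<and> (\<forall>y\<in>pts Y. f (g y) = y))"

text \<open>The algebra of functions generated by the constants and a set of functions.\<close>

inductive_set fun_algebra :: "('a \<Rightarrow> complex) set \<Rightarrow> ('a \<Rightarrow> complex) set"
  for C where
  gen: "f \<in> C \<Longrightarrow> f \<in> fun_algebra C"
| const: "(\<lambda>_. c) \<in> fun_algebra C"
| add: "f \<in> fun_algebra C \<Longrightarrow> g \<in> fun_algebra C \<Longrightarrow> (\<lambda>x. f x + g x) \<in> fun_algebra C"
| mult: "f \<in> fun_algebra C \<Longrightarrow> g \<in> fun_algebra C \<Longrightarrow> (\<lambda>x. f x * g x) \<in> fun_algebra C"

text \<open>
  Given pairs \<open>(D, A)\<close> of a set and an algebra of functions on it: the sets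
  \<open>{x \<in> D. p x \<noteq> 0}\<close> with \<open>p \<in> A\<close> generate the topology, and the
  regular functions are those which locally are fractions \<open>p / q\<close> with \<open>p, q \<in> A\<close>.
\<close>

definition fraction_space :: "('a set \<times> ('a \<Rightarrow> complex) set) set \<Rightarrow> 'a fspace" where
  "fraction_space \<A> = (let t = topology_generated_by {{x \<in> D. p x \<noteq> 0} | D A p. (D, A) \<in> \<A> \<and> p \<in> A} in
     \<lparr> tp = t,
       rg = (\<lambda>U. {f. \<forall>x\<in>U. \<exists>V D A p q. openin t V \<and> x \<in> V \<and> V \<subseteq> U \<and> (D, A) \<in> \<A> \<and> V \<subseteq> D \<and>
               p \<in> A \<and> q \<in> A \<and> (\<forall>y\<in>V. q y \<noteq> 0 \<and> f y = p y / q y)}) \<rparr>)"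

text \<open>A subset \<open>S\<close> of an affine space whose coordinate functions are \<open>C\<close>.\<close>

definition zariski :: "'a set \<Rightarrow> ('a \<Rightarrow> complex) set \<Rightarrow> 'a fspace" where
  "zariski S C = fraction_space {(S, fun_algebra C)}"

text \<open>
  The product of varieties: on \<open>U \<times> V\<close> the functions \<open>\<Sum>\<^sub>i f\<^sub>i(x) g\<^sub>i(y)\<close> with \<open>f\<^sub>i\<close>, \<open>g\<^sub>i\<close> regular are
  declared regular.  The topology is the Zariski topology of the product, not the product topology.
\<close>

definition prod_fs :: "'a fspace \<Rightarrow> 'b fspace \<Rightarrow> ('a \<times> 'b) fspace" where
  "prod_fs X Y = fraction_space
     {(U \<times> V, fun_algebra ({f \<circ> fst | f. f \<in> rg X U} \<union> {g \<circ> snd | g. g \<in> rg Y V})) | U V.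
        openin (tp X) U \<and> openin (tp Y) V}"

definition sub_fs :: "'a fspace \<Rightarrow> 'a set \<Rightarrow> 'a fspace" where
  "sub_fs X Z = \<lparr> tp = subtopology (tp X) Z,
     rg = (\<lambda>U. {f. \<forall>x\<in>U. \<exists>V g. openin (tp X) V \<and> x \<in> V \<and> Z \<inter> V \<subseteq> U \<and> g \<in> rg X V \<and>
                     (\<forall>y\<in>Z \<inter> V. f y = g y)}) \<rparr>"

definition quot_fs :: "'a fspace \<Rightarrow> ('a \<Rightarrow> 'b) \<Rightarrow> 'b fspace" where
  "quot_fs X q = \<lparr> tp = topology_generated_by {V. V \<subseteq> q ` pts X \<and> openin (tp X) {x \<in> pts X. q x \<in> V}},
     rg = (\<lambda>V. {f. f \<circ> q \<in> rg X {x \<in> pts X. q x \<in> V}}) \<rparr>"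

lemma openin_quot_fs:
  "openin (tp (quot_fs X q)) V \<longleftrightarrow> V \<subseteq> q ` pts X \<and> openin (tp X) {x \<in> pts X. q x \<in> V}"
    (is "_ \<longleftrightarrow> ?P V")
proof
  assume "openin (tp (quot_fs X q)) V"
  then have "generate_topology_on {V. ?P V} V"
    unfolding quot_fs_def by (simp add: openin_topology_generated_by)
  then show "?P V"
  proof induction
    case Empty
    show ?case by simp
  next
    case (Int a b)
    have "{x \<in> pts X. q x \<in> a \<inter> b} = {x \<in> pts X. q x \<in> a} \<inter> {x \<in> pts X. q x \<in> b}" by auto
    with Int show ?case by auto
  next
    case (UN K)
    have "{x \<in> pts X. q x \<in> \<Union>K} = (\<Union>k\<in>K. {x \<in> pts X. q x \<in> k})" by auto
    moreover have "openin (tp X) (\<Union>k\<in>K. {x \<in> pts X. q x \<in> k})"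
      using UN by blast
    moreover have "\<Union>K \<subseteq> q ` pts X"
      using UN by blast
    ultimately show ?case by simp
  next
    case (Basis s)
    then show ?case by simp
  qed
next
  assume "?P V"
  then show "openin (tp (quot_fs X q)) V"
    unfolding quot_fs_def by (simp add: topology_generated_by_Basis)
qed

text \<open>
  A map \<open>f\<close> that is constant on the equivalence class \<open>C\<close>, evaluated at \<open>C\<close>.
\<close>

definition on_class :: "('a \<Rightarrow> 'b) \<Rightarrow> 'a set \<Rightarrow> 'b" where
  "on_class f C = the_elem (f ` C)"

definition aff_line :: "complex fspace" where
  "aff_line = zariski UNIV {\<lambda>z. z}"

text \<open>Affine \<open>m\<close>-space, with points padded by zeros.\<close>

definition affine_space :: "nat \<Rightarrow> (nat \<Rightarrow> complex) fspace" where
  "affine_space m = zariski {x. \<forall>i\<ge>m. x i = 0} {\<lambda>x. x i | i. i < m}"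

definition affine_variety :: "'a fspace \<Rightarrow> bool" where
  "affine_variety X \<longleftrightarrow> space_with_functions X \<and>
     (\<exists>m Z f. closedin (tp (affine_space m)) Z \<and> isomorphism X (sub_fs (affine_space m) Z) f)"

definition variety :: "'a fspace \<Rightarrow> bool" where
  "variety X \<longleftrightarrow> space_with_functions X \<and>
     (\<exists>\<U>. finite \<U> \<and> \<Union>\<U> = pts X \<and>
        (\<forall>U\<in>\<U>. openin (tp X) U \<and> affine_variety (sub_fs X U))) \<and>
     closedin (tp (prod_fs X X)) {(x, x) | x. x \<in> pts X}"

text \<open>The \<open>n\<close>-fold product, with points written as lists of length \<open>n\<close>.\<close>

primrec list_fs :: "'a fspace \<Rightarrow> nat \<Rightarrow> 'a list fspace" where
  "list_fs X 0 = zariski {[]} {}"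
| "list_fs X (Suc n) = quot_fs (prod_fs X (list_fs X n)) (\<lambda>(x, xs). x # xs)"


section \<open>Linear algebraic groups\<close>

definition GLn :: "(complex^'n^'n) monoid" where
  "GLn = \<lparr> carrier = {A. invertible A}, mult = (**), one = mat 1 \<rparr>"

definition mat_coords :: "(complex^'n^'n \<Rightarrow> complex) set" where
  "mat_coords = {\<lambda>A. A $ i $ j | i j. True}"

definition alg :: "(complex^'n^'n) set \<Rightarrow> (complex^'n^'n) fspace" where
  "alg S = zariski S mat_coords"

definition linear_algebraic_group :: "(complex^'n^'n) set \<Rightarrow> bool" where
  "linear_algebraic_group G \<longleftrightarrow> subgroup G GLn \<and> closedin (tp (alg (carrier GLn))) G"

definition connected_group :: "(complex^'n^'n) set \<Rightarrow> bool" where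
  "connected_group G \<longleftrightarrow> linear_algebraic_group G \<and> connected_space (tp (alg G))"

definition msc :: "complex \<Rightarrow> complex^'n^'n \<Rightarrow> complex^'n^'n" where
  "msc c A = (\<chi> i j. c * A $ i $ j)"

text \<open>The Lie algebra, as the Zariski tangent space at the identity.\<close>

definition Lie :: "(complex^'n^'n) set \<Rightarrow> (complex^'n^'n) set" where
  "Lie G = {A. \<forall>p \<in> fun_algebra mat_coords. (\<forall>g\<in>G. p g = 0) \<longrightarrow>
                  deriv (\<lambda>s. p (mat 1 + msc s A)) 0 = 0}"

definition lie_br :: "complex^'n^'n \<Rightarrow> complex^'n^'n \<Rightarrow> complex^'n^'n" where
  "lie_br A B = A ** B - B ** A"

definition msubspace :: "(complex^'n^'n) set \<Rightarrow> bool" where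
  "msubspace S \<longleftrightarrow> 0 \<in> S \<and> (\<forall>A\<in>S. \<forall>B\<in>S. A + B \<in> S) \<and> (\<forall>c. \<forall>A\<in>S. msc c A \<in> S)"

definition simple_lie_algebra :: "(complex^'n^'n) set \<Rightarrow> bool" where
  "simple_lie_algebra \<gg> \<longleftrightarrow>
     (\<exists>A\<in>\<gg>. \<exists>B\<in>\<gg>. lie_br A B \<noteq> 0) \<and>
     (\<forall>I. msubspace I \<and> I \<subseteq> \<gg> \<and> (\<forall>A\<in>\<gg>. \<forall>B\<in>I. lie_br A B \<in> I) \<longrightarrow> I = {0} \<or> I = \<gg>)"

definition simple_group :: "(complex^'n^'n) set \<Rightarrow> bool" where
  "simple_group G \<longleftrightarrow> connected_group G \<and> simple_lie_algebra (Lie G)"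

definition connected_solvable :: "(complex^'n^'n) set \<Rightarrow> bool" where
  "connected_solvable B \<longleftrightarrow> connected_group B \<and> solvable (GLn\<lparr>carrier := B\<rparr>)"

definition borel_subgroup :: "(complex^'n^'n) set \<Rightarrow> (complex^'n^'n) set \<Rightarrow> bool" where
  "borel_subgroup G B \<longleftrightarrow> B \<subseteq> G \<and> connected_solvable B \<and>
     (\<forall>B'. B' \<subseteq> G \<and> connected_solvable B' \<and> B \<subseteq> B' \<longrightarrow> B' = B)"

text \<open>The torus of rank \<open>k\<close>, with points padded by ones so that the product is pointwise.\<close>

definition std_torus :: "nat \<Rightarrow> (nat \<Rightarrow> complex) fspace" where
  "std_torus k = zariski {x. (\<forall>i. x i \<noteq> 0) \<and> (\<forall>i\<ge>k. x i = 1)} {\<lambda>x. x i | i. i < k}"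

definition torus :: "(complex^'n^'n) set \<Rightarrow> bool" where
  "torus T \<longleftrightarrow> linear_algebraic_group T \<and>
     (\<exists>k f. isomorphism (alg T) (std_torus k) f \<and>
        (\<forall>s\<in>T. \<forall>t\<in>T. f (s ** t) = (\<lambda>i. f s i * f t i)))"

definition maximal_torus :: "(complex^'n^'n) set \<Rightarrow> (complex^'n^'n) set \<Rightarrow> bool" where
  "maximal_torus G T \<longleftrightarrow> T \<subseteq> G \<and> torus T \<and>
     (\<forall>T'. T' \<subseteq> G \<and> torus T' \<and> T \<subseteq> T' \<longrightarrow> T' = T)"

text \<open>
  The operation \<open>^\<close> on matrices is componentwise, hence the iteration of \<open>**\<close>.
\<close>

definition unipotent :: "complex^'n^'n \<Rightarrow> bool" where
  "unipotent A \<longleftrightarrow> (\<exists>k. (((**) (A - mat 1)) ^^ k) (mat 1) = 0)"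

definition connected_normal_unipotent :: "(complex^'n^'n) set \<Rightarrow> (complex^'n^'n) set \<Rightarrow> bool" where
  "connected_normal_unipotent B U \<longleftrightarrow> connected_group U \<and> U \<lhd> (GLn\<lparr>carrier := B\<rparr>) \<and>
     (\<forall>u\<in>U. unipotent u)"

definition unipotent_radical :: "(complex^'n^'n) set \<Rightarrow> (complex^'n^'n) set \<Rightarrow> bool" where
  "unipotent_radical B U \<longleftrightarrow> connected_normal_unipotent B U \<and>
     (\<forall>U'. connected_normal_unipotent B U' \<longrightarrow> U' \<subseteq> U)"


section \<open>Characters, roots and weights\<close>

text \<open>
  The group of characters is written multiplicatively: the weight \<open>\<lambda> + \<mu>\<close> is the pointwise product
  of \<open>e\<^sup>\<lambda>\<close> and \<open>e\<^sup>\<mu>\<close>.  Characters are extensional functions, so that equality of characters is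
  equality of functions.
\<close>

definition characters :: "(complex^'n^'n) set \<Rightarrow> (complex^'n^'n \<Rightarrow> complex) set" where
  "characters T = {\<theta> \<in> extensional T. \<theta> \<in> rg (alg T) T \<and>
     (\<forall>t\<in>T. \<theta> t \<noteq> 0) \<and> (\<forall>s\<in>T. \<forall>t\<in>T. \<theta> (s ** t) = \<theta> s * \<theta> t)}"

definition char_group :: "(complex^'n^'n) set \<Rightarrow> (complex^'n^'n \<Rightarrow> complex) monoid" where
  "char_group T = \<lparr> carrier = characters T,
     mult = (\<lambda>\<theta> \<psi>. restrict (\<lambda>t. \<theta> t * \<psi> t) T),
     one = restrict (\<lambda>_. 1) T \<rparr>"

definition weight_space :: "(complex^'n^'n) set \<Rightarrow> (complex^'n^'n) set \<Rightarrow> (complex^'n^'n \<Rightarrow> complex)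
    \<Rightarrow> (complex^'n^'n) set" where
  "weight_space H T \<theta> = {A \<in> Lie H. \<forall>t\<in>T. t ** A ** matrix_inv t = msc (\<theta> t) A}"

definition roots :: "(complex^'n^'n) set \<Rightarrow> (complex^'n^'n) set \<Rightarrow> (complex^'n^'n \<Rightarrow> complex) set" where
  "roots H T = {\<alpha> \<in> characters T. \<alpha> \<noteq> \<one>\<^bsub>char_group T\<^esub> \<and> (\<exists>A\<in>weight_space H T \<alpha>. A \<noteq> 0)}"

definition root_lattice :: "(complex^'n^'n) set \<Rightarrow> (complex^'n^'n) set \<Rightarrow> (complex^'n^'n \<Rightarrow> complex) set"
  where "root_lattice G T = generate (char_group T) (roots G T)"

text \<open>The positive roots are the roots of the Borel subgroup \<open>B\<close>.\<close>

definition simple_roots :: "(complex^'n^'n) set \<Rightarrow> (complex^'n^'n) set \<Rightarrow> (complex^'n^'n \<Rightarrow> complex) set"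
  where "simple_roots B T = {\<alpha> \<in> roots B T.
           \<not> (\<exists>\<beta>\<in>roots B T. \<exists>\<gamma>\<in>roots B T. \<alpha> = \<beta> \<otimes>\<^bsub>char_group T\<^esub> \<gamma>)}"

text \<open>
  The differential at the identity of a regular function on \<open>T\<close>, as a functional on \<open>Lie T\<close>,
  computed from any expression \<open>p / q\<close> of the function near the identity.
\<close>

definition differential :: "(complex^'n^'n) set \<Rightarrow> (complex^'n^'n \<Rightarrow> complex) \<Rightarrow> complex^'n^'n \<Rightarrow> complex"
  where "differential T f A = (THE c. \<exists>V. \<exists>p \<in> fun_algebra mat_coords. \<exists>q \<in> fun_algebra mat_coords.
           openin (tp (alg T)) V \<and> mat 1 \<in> V \<and> (\<forall>t\<in>V. q t \<noteq> 0 \<and> f t = p t / q t) \<and>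
           c = deriv (\<lambda>s. p (mat 1 + msc s A) / q (mat 1 + msc s A)) 0)"

text \<open>The coroot as the element \<open>H\<close> of \<open>[\<gg>\<^sub>\<alpha>, \<gg>\<^sub>-\<^sub>\<alpha>]\<close> with \<open>\<alpha>(H) = 2\<close>.\<close>

definition coroot :: "(complex^'n^'n) set \<Rightarrow> (complex^'n^'n) set \<Rightarrow> (complex^'n^'n \<Rightarrow> complex)
    \<Rightarrow> complex^'n^'n" where
  "coroot G T \<alpha> = (THE H. \<exists>E \<in> weight_space G T \<alpha>.
     \<exists>F \<in> weight_space G T (inv\<^bsub>char_group T\<^esub> \<alpha>). H = lie_br E F \<and> differential T \<alpha> H = 2)"

text \<open>The fundamental weights, as functionals on \<open>Lie T\<close> indexed by the simple roots.\<close>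

definition fundamental_weights :: "(complex^'n^'n) set \<Rightarrow> (complex^'n^'n) set \<Rightarrow> (complex^'n^'n) set
    \<Rightarrow> ((complex^'n^'n \<Rightarrow> complex) \<Rightarrow> complex^'n^'n \<Rightarrow> complex) \<Rightarrow> bool" where
  "fundamental_weights G B T \<omega> \<longleftrightarrow> (\<forall>\<alpha>\<in>simple_roots B T.
     (\<forall>H\<in>Lie T. \<forall>H'\<in>Lie T. \<omega> \<alpha> (H + H') = \<omega> \<alpha> H + \<omega> \<alpha> H') \<and>
     (\<forall>c. \<forall>H\<in>Lie T. \<omega> \<alpha> (msc c H) = c * \<omega> \<alpha> H) \<and>
     (\<forall>\<beta>\<in>simple_roots B T. \<omega> \<alpha> (coroot G T \<beta>) = (if \<alpha> = \<beta> then 1 else 0)))"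

definition dominant_regular_characters :: "(complex^'n^'n) set \<Rightarrow> (complex^'n^'n) set
    \<Rightarrow> (complex^'n^'n) set \<Rightarrow> (complex^'n^'n \<Rightarrow> complex) set" where
  "dominant_regular_characters G B T = {\<theta> \<in> characters T.
     \<exists>\<omega> (m :: (complex^'n^'n \<Rightarrow> complex) \<Rightarrow> int).
       fundamental_weights G B T \<omega> \<and> (\<forall>\<alpha>\<in>simple_roots B T. m \<alpha> > 0) \<and>
       (\<forall>H\<in>Lie T. differential T \<theta> H = (\<Sum>\<alpha>\<in>simple_roots B T. of_int (m \<alpha>) * \<omega> \<alpha> H))}"

text \<open>The extension of a character of \<open>T\<close> to \<open>B = TU\<close> that is trivial on \<open>U\<close>.\<close>

definition extend_char :: "(complex^'n^'n) set \<Rightarrow> (complex^'n^'n) set \<Rightarrow> (complex^'n^'n \<Rightarrow> complex)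
    \<Rightarrow> complex^'n^'n \<Rightarrow> complex" where
  "extend_char T U \<theta> b = (THE c. \<exists>t\<in>T. \<exists>u\<in>U. b = t ** u \<and> c = \<theta> t)"


section \<open>Line bundles\<close>

text \<open>
  Geometric line bundles: total space, projection, and fibrewise scalar multiplication.
  As the fibres are lines, their addition is determined by the scalar multiplication, and a map
  between lines is linear as soon as it commutes with scalars.
\<close>

record ('e, 'x) lbundle =
  tot :: "'e fspace"
  prj :: "'e \<Rightarrow> 'x"
  scl :: "complex \<Rightarrow> 'e \<Rightarrow> 'e"

definition line_bundle :: "'x fspace \<Rightarrow> ('e, 'x) lbundle \<Rightarrow> bool" where
  "line_bundle X L \<longleftrightarrow> space_with_functions (tot L) \<and> regular_map (tot L) X (prj L) \<and>
     (\<forall>c. \<forall>v\<in>pts (tot L). scl L c v \<in> pts (tot L) \<and> prj L (scl L c v) = prj L v) \<and>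
     (\<forall>x\<in>pts X. \<exists>U \<phi>. openin (tp X) U \<and> x \<in> U \<and>
        isomorphism (sub_fs (tot L) {v \<in> pts (tot L). prj L v \<in> U}) (prod_fs (sub_fs X U) aff_line) \<phi> \<and>
        (\<forall>v\<in>pts (tot L). prj L v \<in> U \<longrightarrow> fst (\<phi> v) = prj L v \<and>
           (\<forall>c. \<phi> (scl L c v) = (prj L v, c * snd (\<phi> v)))))"

definition restrict_lb :: "('e, 'x) lbundle \<Rightarrow> 'x set \<Rightarrow> ('e, 'x) lbundle" where
  "restrict_lb L Z = L\<lparr>tot := sub_fs (tot L) {v \<in> pts (tot L). prj L v \<in> Z}\<rparr>"

definition pullback_lb :: "'x fspace \<Rightarrow> ('x \<Rightarrow> 'y) \<Rightarrow> ('e, 'y) lbundle \<Rightarrow> ('x \<times> 'e, 'x) lbundle" where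
  "pullback_lb X f L = \<lparr>
     tot = sub_fs (prod_fs X (tot L)) {(x, v). x \<in> pts X \<and> v \<in> pts (tot L) \<and> f x = prj L v},
     prj = fst,
     scl = (\<lambda>c (x, v). (x, scl L c v)) \<rparr>"

text \<open>
  The external tensor product: a point of the total space is the set of all pairs \<open>(v', w')\<close> with
  \<open>v' \<otimes> w' = v \<otimes> w\<close>.  Every tensor of two lines is pure, and \<open>v \<otimes> w = v' \<otimes> w'\<close> holds iff
  \<open>v = a e\<close>, \<open>w = b f\<close>, \<open>v' = a' e\<close>, \<open>w' = b' f\<close> with \<open>a b = a' b'\<close>.
\<close>

definition box_class :: "('e, 'x) lbundle \<Rightarrow> ('f, 'y) lbundle \<Rightarrow> 'e \<times> 'f \<Rightarrow> ('e \<times> 'f) set" where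
  "box_class L M = (\<lambda>(v, w). {(v', w'). \<exists>e\<in>pts (tot L). \<exists>f\<in>pts (tot M). \<exists>a b a' b'.
     v = scl L a e \<and> w = scl M b f \<and> v' = scl L a' e \<and> w' = scl M b' f \<and> a * b = a' * b'})"

definition box :: "('e, 'x) lbundle \<Rightarrow> ('f, 'y) lbundle \<Rightarrow> (('e \<times> 'f) set, 'x \<times> 'y) lbundle" where
  "box L M = \<lparr>
     tot = quot_fs (prod_fs (tot L) (tot M)) (box_class L M),
     prj = on_class (\<lambda>(v, w). (prj L v, prj M w)),
     scl = (\<lambda>c. on_class (\<lambda>(v, w). box_class L M (scl L c v, w))) \<rparr>"

definition box_act :: "('e, 'x) lbundle \<Rightarrow> ('f, 'y) lbundle \<Rightarrow> ('g \<Rightarrow> 'e \<Rightarrow> 'e) \<Rightarrow> ('g \<Rightarrow> 'f \<Rightarrow> 'f)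
    \<Rightarrow> 'g \<Rightarrow> ('e \<times> 'f) set \<Rightarrow> ('e \<times> 'f) set" where
  "box_act L M a b g = on_class (\<lambda>(v, w). box_class L M (a g v, b g w))"

text \<open>Tensor powers, for positive exponents, in the same way.\<close>

definition tpow_class :: "('e, 'x) lbundle \<Rightarrow> 'e list \<Rightarrow> 'e list set" where
  "tpow_class L vs = {ws. \<exists>e\<in>pts (tot L). \<exists>as bs.
     vs = map (\<lambda>a. scl L a e) as \<and> ws = map (\<lambda>b. scl L b e) bs \<and>
     length as = length bs \<and> prod_list as = prod_list bs}"

definition tpow :: "('e, 'x) lbundle \<Rightarrow> nat \<Rightarrow> ('e list set, 'x) lbundle" where
  "tpow L n = \<lparr>
     tot = quot_fs (sub_fs (list_fs (tot L) n)
             {vs \<in> pts (list_fs (tot L) n). \<forall>v\<in>set vs. \<forall>w\<in>set vs. prj L v = prj L w}) (tpow_class L),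
     prj = on_class (\<lambda>vs. prj L (hd vs)),
     scl = (\<lambda>c. on_class (\<lambda>vs. tpow_class L (scl L c (hd vs) # tl vs))) \<rparr>"

definition tpow_act :: "('e, 'x) lbundle \<Rightarrow> ('g \<Rightarrow> 'e \<Rightarrow> 'e) \<Rightarrow> 'g \<Rightarrow> 'e list set \<Rightarrow> 'e list set" where
  "tpow_act L a g = on_class (\<lambda>vs. tpow_class L (map (a g) vs))"

definition global_sections :: "'x fspace \<Rightarrow> ('e, 'x) lbundle \<Rightarrow> ('x \<Rightarrow> 'e) set" where
  "global_sections X L = {\<sigma>. regular_map X (tot L) \<sigma> \<and> (\<forall>x\<in>pts X. prj L (\<sigma> x) = x)}"

definition invariant_sections :: "'g set \<Rightarrow> 'x fspace \<Rightarrow> ('g \<Rightarrow> 'x \<Rightarrow> 'x) \<Rightarrow> ('e, 'x) lbundle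
    \<Rightarrow> ('g \<Rightarrow> 'e \<Rightarrow> 'e) \<Rightarrow> ('x \<Rightarrow> 'e) set" where
  "invariant_sections G X act L act' =
     {\<sigma> \<in> global_sections X L. \<forall>g\<in>G. \<forall>x\<in>pts X. \<sigma> (act g x) = act' g (\<sigma> x)}"

text \<open>The condition \<open>scl (tpow L N) 0 v \<noteq> v\<close> says that \<open>v\<close> is not a zero vector.\<close>

definition semistable_locus :: "'g set \<Rightarrow> 'x fspace \<Rightarrow> ('g \<Rightarrow> 'x \<Rightarrow> 'x) \<Rightarrow> ('e, 'x) lbundle
    \<Rightarrow> ('g \<Rightarrow> 'e \<Rightarrow> 'e) \<Rightarrow> 'x set" where
  "semistable_locus G X act L act' = {x \<in> pts X. \<exists>N>0.
     \<exists>\<sigma> \<in> invariant_sections G X act (tpow L N) (tpow_act L act').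
       scl (tpow L N) 0 (\<sigma> x) \<noteq> \<sigma> x}"


section \<open>Quotients and descent\<close>

definition invariant_set :: "'g set \<Rightarrow> ('g \<Rightarrow> 'x \<Rightarrow> 'x) \<Rightarrow> 'x set \<Rightarrow> bool" where
  "invariant_set G act W \<longleftrightarrow> (\<forall>g\<in>G. \<forall>x\<in>W. act g x \<in> W)"

definition affine_map :: "'x fspace \<Rightarrow> 'y fspace \<Rightarrow> ('x \<Rightarrow> 'y) \<Rightarrow> bool" where
  "affine_map X Y f \<longleftrightarrow> regular_map X Y f \<and>
     (\<forall>V. openin (tp Y) V \<and> affine_variety (sub_fs Y V) \<longrightarrow>
        affine_variety (sub_fs X {x \<in> pts X. f x \<in> V}))"

text \<open>Good quotients in the sense of Seshadri; they are unique up to unique isomorphism.\<close>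

definition good_quotient :: "'g set \<Rightarrow> 'x fspace \<Rightarrow> ('g \<Rightarrow> 'x \<Rightarrow> 'x) \<Rightarrow> 'y fspace \<Rightarrow> ('x \<Rightarrow> 'y) \<Rightarrow> bool" where
  "good_quotient G X act Y \<pi> \<longleftrightarrow> variety Y \<and> affine_map X Y \<pi> \<and> \<pi> ` pts X = pts Y \<and>
     (\<forall>g\<in>G. \<forall>x\<in>pts X. \<pi> (act g x) = \<pi> x) \<and>
     (\<forall>V h. openin (tp Y) V \<and> h \<in> rg X {x \<in> pts X. \<pi> x \<in> V} \<and>
        (\<forall>g\<in>G. \<forall>x\<in>pts X. \<pi> x \<in> V \<longrightarrow> h (act g x) = h x)
        \<longrightarrow> (\<exists>f \<in> rg Y V. \<forall>x\<in>pts X. \<pi> x \<in> V \<longrightarrow> h x = f (\<pi> x))) \<and>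
     (\<forall>W. closedin (tp X) W \<and> invariant_set G act W \<longrightarrow> closedin (tp Y) (\<pi> ` W)) \<and>
     (\<forall>W W'. closedin (tp X) W \<and> invariant_set G act W \<and> closedin (tp X) W' \<and> invariant_set G act W' \<and>
        W \<inter> W' = {} \<longrightarrow> \<pi> ` W \<inter> \<pi> ` W' = {})"

definition equivariant_lb_iso :: "'g set \<Rightarrow> ('e, 'x) lbundle \<Rightarrow> ('g \<Rightarrow> 'e \<Rightarrow> 'e)
    \<Rightarrow> ('f, 'x) lbundle \<Rightarrow> ('g \<Rightarrow> 'f \<Rightarrow> 'f) \<Rightarrow> ('e \<Rightarrow> 'f) \<Rightarrow> bool" where
  "equivariant_lb_iso G L a M b \<Phi> \<longleftrightarrow> isomorphism (tot L) (tot M) \<Phi> \<and>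
     (\<forall>v\<in>pts (tot L). prj M (\<Phi> v) = prj L v \<and>
        (\<forall>c. \<Phi> (scl L c v) = scl M c (\<Phi> v)) \<and> (\<forall>g\<in>G. \<Phi> (a g v) = b g (\<Phi> v)))"

text \<open>
  \<open>L\<close>, an equivariant line bundle over \<open>X\<close> with action \<open>act'\<close>, descends along \<open>\<pi> : X \<rightarrow> Y\<close> to \<open>M\<close>;
  the pullback of \<open>M\<close> carries the action coming from the one on \<open>X\<close>.
\<close>

definition descends_to :: "'g set \<Rightarrow> 'x fspace \<Rightarrow> ('g \<Rightarrow> 'x \<Rightarrow> 'x) \<Rightarrow> ('e, 'x) lbundle \<Rightarrow> ('g \<Rightarrow> 'e \<Rightarrow> 'e)
    \<Rightarrow> 'y fspace \<Rightarrow> ('x \<Rightarrow> 'y) \<Rightarrow> ('f, 'y) lbundle \<Rightarrow> bool" where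
  "descends_to G X act L act' Y \<pi> M \<longleftrightarrow> line_bundle Y M \<and>
     (\<exists>\<Phi>. equivariant_lb_iso G (pullback_lb X \<pi> M) (\<lambda>g (x, v). (act g x, v)) L act' \<Phi>)"


section \<open>Flag varieties and their homogeneous line bundles\<close>

definition flag_variety :: "(complex^'n^'n) set \<Rightarrow> (complex^'n^'n) set \<Rightarrow> (complex^'n^'n) set fspace" where
  "flag_variety G B = quot_fs (alg G) (\<lambda>g. g <#\<^bsub>GLn\<^esub> B)"

definition flag_act :: "complex^'n^'n \<Rightarrow> (complex^'n^'n) set \<Rightarrow> (complex^'n^'n) set" where
  "flag_act g C = g <#\<^bsub>GLn\<^esub> C"

definition hlb_class :: "(complex^'n^'n) set \<Rightarrow> (complex^'n^'n) set \<Rightarrow> (complex^'n^'n) set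
    \<Rightarrow> (complex^'n^'n \<Rightarrow> complex) \<Rightarrow> (complex^'n^'n) \<times> complex \<Rightarrow> ((complex^'n^'n) \<times> complex) set" where
  "hlb_class B T U \<theta> = (\<lambda>(g, z). {(g ** matrix_inv b, inverse (extend_char T U \<theta> b) * z) | b. b \<in> B})"

definition hlb :: "(complex^'n^'n) set \<Rightarrow> (complex^'n^'n) set \<Rightarrow> (complex^'n^'n) set \<Rightarrow> (complex^'n^'n) set
    \<Rightarrow> (complex^'n^'n \<Rightarrow> complex) \<Rightarrow> (((complex^'n^'n) \<times> complex) set, (complex^'n^'n) set) lbundle" where
  "hlb G B T U \<theta> = \<lparr>
     tot = quot_fs (prod_fs (alg G) aff_line) (hlb_class B T U \<theta>),
     prj = on_class (\<lambda>(g, z). g <#\<^bsub>GLn\<^esub> B),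
     scl = (\<lambda>c. on_class (\<lambda>(g, z). hlb_class B T U \<theta> (g, c * z))) \<rparr>"

definition hlb_act :: "(complex^'n^'n) set \<Rightarrow> (complex^'n^'n) set \<Rightarrow> (complex^'n^'n) set
    \<Rightarrow> (complex^'n^'n \<Rightarrow> complex) \<Rightarrow> complex^'n^'n
    \<Rightarrow> ((complex^'n^'n) \<times> complex) set \<Rightarrow> ((complex^'n^'n) \<times> complex) set" where
  "hlb_act B T U \<theta> h = on_class (\<lambda>(g, z). hlb_class B T U \<theta> (h ** g, z))"

definition flag3 where
  "flag3 G B = prod_fs (flag_variety G B) (prod_fs (flag_variety G B) (flag_variety G B))"

definition flag3_act where
  "flag3_act g = map_prod (flag_act g) (map_prod (flag_act g) (flag_act g))"

definition hlb3 where
  "hlb3 G B T U l1 l2 l3 = box (hlb G B T U l1) (box (hlb G B T U l2) (hlb G B T U l3))"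

definition hlb3_act where
  "hlb3_act G B T U l1 l2 l3 =
     box_act (hlb G B T U l1) (box (hlb G B T U l2) (hlb G B T U l3))
       (hlb_act B T U l1)
       (box_act (hlb G B T U l2) (hlb G B T U l3) (hlb_act B T U l2) (hlb_act B T U l3))"

definition flag3_ss where
  "flag3_ss G B T U l1 l2 l3 =
     semistable_locus G (flag3 G B) flag3_act (hlb3 G B T U l1 l2 l3) (hlb3_act G B T U l1 l2 l3)"

end

theory Submission
  imports Defs "HOL-Computational_Algebra.Polynomial"
begin

text \<open>
  The proof looks at the common kernel \<open>Z\<close> of the roots in \<open>T\<close> and computes its action on a fibre of
  the line bundle over a semistable point in two ways.

  An element \<open>z\<close> of \<open>Z\<close> commutes with every root space and with the centralizer of \<open>T\<close> in the Lie
  algebra (\<open>Lie_entry_weight\<close>), hence is central in the connected group \<open>G\<close>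
  (\<open>central_if_Lie_entries\<close>).  Lying in \<open>B\<close> as well, it fixes every point of the triple flag variety, and
  \<open>z [g, w] = [z g, w] = [g z, w] = [g, e\<^sup>-\<^sup>\<lambda>(z) w]\<close> shows that it multiplies the fibres of
  \<open>\<L>(\<lambda>, \<mu>, \<nu>)\<close> by the inverse of \<open>(\<lambda> + \<mu> + \<nu>)(z)\<close> (\<open>hlb_act_central\<close>, \<open>box_act_scalar\<close>).
  In a pulled back bundle, on the other hand, the stabilizer of a point acts trivially on the fibre
  over it (\<open>descent_trivial_on_stabilizer\<close>).  As there is a semistable point,
  \<open>\<lambda> + \<mu> + \<nu>\<close> is trivial on \<open>Z\<close>.  Finally a subgroup of the character group of a torus
  consists of all characters that are trivial on its common kernel, because homomorphisms into the
  divisible group of nonzero complex numbers extend and hence separate points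
  (\<open>character_in_generated_lattice\<close>).  For the subgroup generated by the roots this is the claim.

  Three points need an argument of their own.  A torus is simultaneously diagonalizable since its
  elements of finite order are dense (\<open>torus_diagonalizable\<close>), which makes weight decompositions
  available.  That an element acting trivially on the Lie algebra is central is deduced without
  dimension theory: conjugation by \<open>z\<close> fixes the cotangent space at the identity, and an argument as
  in Nakayama's lemma, with an explicit determinant, extends this to a Zariski neighbourhood of the
  identity.  And the extension of a character from \<open>T\<close> to \<open>B\<close> is multiplicative: otherwise scalars
  could not act freely on the nonzero classes \<open>[g, z]\<close>, whereas over a semistable point they do, by
  comparison with the pulled back bundle (\<open>degenerate_hlb\<close>, \<open>degenerate_box_left\<close>,
  \<open>degenerate_box_right\<close>).
\<close>

section \<open>Regular functions and the underlying points of constructed spaces\<close>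

lemma fun_algebra_sum:
  assumes "\<And>i. i \<in> I \<Longrightarrow> f i \<in> fun_algebra C"
  shows "(\<lambda>x. \<Sum>i\<in>I. f i x) \<in> fun_algebra C"
  using assms
proof (induction I rule: infinite_finite_induct)
  case (insert i I)
  then show ?case using fun_algebra.add[of "f i" C "\<lambda>x. \<Sum>i\<in>I. f i x"] by simp
qed (simp_all add: fun_algebra.const)

lemma fun_algebra_prod:
  assumes "\<And>i. i \<in> I \<Longrightarrow> f i \<in> fun_algebra C"
  shows "(\<lambda>x. \<Prod>i\<in>I. f i x) \<in> fun_algebra C"
  using assms
proof (induction I rule: infinite_finite_induct)
  case (insert i I)
  then show ?case using fun_algebra.mult[of "f i" C "\<lambda>x. \<Prod>i\<in>I. f i x"] by simp
qed (simp_all add: fun_algebra.const)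

lemma fun_algebra_cmult: "f \<in> fun_algebra C \<Longrightarrow> (\<lambda>x. c * f x) \<in> fun_algebra C"
  by (intro fun_algebra.mult fun_algebra.const)

lemma fun_algebra_diff:
  assumes "f \<in> fun_algebra C" "g \<in> fun_algebra C"
  shows "(\<lambda>x. f x - g x) \<in> fun_algebra C"
  using fun_algebra.add[OF assms(1) fun_algebra_cmult[OF assms(2), of "-1"]] by simp

lemma fun_algebra_subst:
  assumes "p \<in> fun_algebra C" "\<And>c. c \<in> C \<Longrightarrow> (\<lambda>x. c (h x)) \<in> fun_algebra C'"
  shows "(\<lambda>x. p (h x)) \<in> fun_algebra C'"
  using assms by induction (auto intro: fun_algebra.intros)

lemma fun_algebra_det:
  fixes E :: "'a \<Rightarrow> complex^'m^'m"
  assumes "\<And>i j. (\<lambda>x. E x $ i $ j) \<in> fun_algebra C"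
  shows "(\<lambda>x. det (E x)) \<in> fun_algebra C"
  unfolding det_def
  by (intro fun_algebra_sum fun_algebra.mult fun_algebra.const fun_algebra_prod assms)

lemma fun_algebra_entry: "(\<lambda>A. A $ i $ j) \<in> fun_algebra mat_coords"
  by (rule fun_algebra.gen) (auto simp: mat_coords_def)

lemma fun_algebra_sandwich: "(\<lambda>A. (L ** A ** R) $ i $ j) \<in> fun_algebra mat_coords"
  unfolding matrix_matrix_mult_def
  by (auto intro!: fun_algebra_sum fun_algebra.mult fun_algebra.const fun_algebra_entry)

lemma fun_algebra_translate:
  fixes p :: "complex^'n^'n \<Rightarrow> complex"
  assumes "p \<in> fun_algebra mat_coords"
  shows "(\<lambda>A. p (L ** A ** R)) \<in> fun_algebra mat_coords"
proof (rule fun_algebra_subst[OF assms])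
  fix c :: "complex^'n^'n \<Rightarrow> complex" assume "c \<in> mat_coords"
  then obtain i j where "c = (\<lambda>A. A $ i $ j)" by (auto simp: mat_coords_def)
  then show "(\<lambda>A. c (L ** A ** R)) \<in> fun_algebra mat_coords"
    using fun_algebra_sandwich[of L R i j] by simp
qed

lemma topspace_fraction_space:
  "topspace (tp (fraction_space \<A>)) = (\<Union>(D, A)\<in>\<A>. \<Union>p\<in>A. {x \<in> D. p x \<noteq> 0})"
  unfolding fraction_space_def Let_def by (auto simp: topology_generated_by_topspace)

lemma pts_zariski [simp]: "pts (zariski S C) = S"
proof -
  have "\<exists>p\<in>fun_algebra C. p x \<noteq> 0" for x
    by (rule bexI[OF _ fun_algebra.const[of 1]]) simp
  then show ?thesis
    unfolding pts_def zariski_def topspace_fraction_space by auto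
qed

lemma pts_alg [simp]: "pts (alg S) = S"
  by (simp add: alg_def)

text \<open>
  The constant function \<open>1\<close> is regular, so the product of the two total spaces is itself one of
  the basic open sets.
\<close>

lemma pts_prod_fs [simp]: "pts (prod_fs X Y) = pts X \<times> pts Y"
proof
  show "pts (prod_fs X Y) \<subseteq> pts X \<times> pts Y"
    unfolding pts_def prod_fs_def topspace_fraction_space
    by (auto dest!: openin_subset)
  show "pts X \<times> pts Y \<subseteq> pts (prod_fs X Y)"
  proof
    fix z assume z: "z \<in> pts X \<times> pts Y"
    let ?A = "fun_algebra ({f \<circ> fst |f. f \<in> rg X (pts X)} \<union> {g \<circ> snd |g. g \<in> rg Y (pts Y)})"
    let ?\<A> = "{(U \<times> V, fun_algebra ({f \<circ> fst | f. f \<in> rg X U} \<union> {g \<circ> snd | g. g \<in> rg Y V})) | U V.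
        openin (tp X) U \<and> openin (tp Y) V}"
    have A: "(pts X \<times> pts Y, ?A) \<in> ?\<A>"
      unfolding mem_Collect_eq
      by (rule exI[of _ "pts X"], rule exI[of _ "pts Y"]) (simp add: pts_def)
    have "z \<in> (\<Union>(D, A)\<in>?\<A>. \<Union>p\<in>A. {x \<in> D. p x \<noteq> 0})"
      by (rule UN_I[OF A]) (unfold prod.case, rule UN_I[OF fun_algebra.const[of 1]], use z in simp)
    then show "z \<in> pts (prod_fs X Y)"
      unfolding pts_def[of "prod_fs X Y"] unfolding prod_fs_def topspace_fraction_space .
  qed
qed

lemma pts_sub_fs [simp]: "pts (sub_fs X Z) = pts X \<inter> Z"
  by (simp add: pts_def sub_fs_def)

text \<open>
  The image of \<open>q\<close> is open in the quotient space, its preimage being the whole of \<open>X\<close>.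
\<close>

lemma pts_quot_fs [simp]: "pts (quot_fs X q) = q ` pts X"
proof -
  have "openin (tp (quot_fs X q)) (q ` pts X)"
  proof -
    have "{x \<in> pts X. q x \<in> q ` pts X} = pts X" by auto
    then show ?thesis by (simp add: openin_quot_fs) (simp add: pts_def)
  qed
  moreover have "pts (quot_fs X q) \<subseteq> q ` pts X"
    using openin_topspace[of "tp (quot_fs X q)"] unfolding openin_quot_fs pts_def by blast
  ultimately show ?thesis
    unfolding pts_def by (simp add: openin_subset subset_antisym)
qed

lemma openin_zariski_basic:
  assumes "p \<in> fun_algebra C"
  shows "openin (tp (zariski S C)) {x \<in> S. p x \<noteq> 0}"
  unfolding zariski_def fraction_space_def Let_def
  using assms by (auto intro!: topology_generated_by_Basis)

text \<open>
  The sets \<open>{y \<in> S. p y \<noteq> 0}\<close> generate the topology and are closed under intersection, which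
  corresponds to multiplication of functions; hence they form a basis.
\<close>

lemma openin_zariskiE:
  assumes "openin (tp (zariski S C)) U" "x \<in> U"
  obtains p where "p \<in> fun_algebra C" "p x \<noteq> 0" "{y \<in> S. p y \<noteq> 0} \<subseteq> U"
proof -
  have "generate_topology_on {{x \<in> D. p x \<noteq> 0} |D A p. (D, A) \<in> {(S, fun_algebra C)} \<and> p \<in> A} U"
    using assms(1) unfolding zariski_def fraction_space_def Let_def
    by (simp add: openin_topology_generated_by_iff)
  then have "\<forall>x\<in>U. \<exists>p\<in>fun_algebra C. p x \<noteq> 0 \<and> {y \<in> S. p y \<noteq> 0} \<subseteq> U"
  proof induction
    case (Int a b)
    show ?case
    proof
      fix x assume "x \<in> a \<inter> b"
      with Int obtain p q where "p \<in> fun_algebra C" "p x \<noteq> 0" "{y \<in> S. p y \<noteq> 0} \<subseteq> a"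
        "q \<in> fun_algebra C" "q x \<noteq> 0" "{y \<in> S. q y \<noteq> 0} \<subseteq> b" by blast
      then show "\<exists>p\<in>fun_algebra C. p x \<noteq> 0 \<and> {y \<in> S. p y \<noteq> 0} \<subseteq> a \<inter> b"
        by (intro bexI[of _ "\<lambda>y. p y * q y"]) (auto intro: fun_algebra.mult)
    qed
  next
    case (UN K)
    then show ?case by (meson UnionE Union_upper subset_trans)
  qed auto
  with that assms(2) show thesis by blast
qed

lemma rg_zariski:
  "rg (zariski S C) U = {f. \<forall>x\<in>U. \<exists>V p q. p \<in> fun_algebra C \<and> q \<in> fun_algebra C \<and>
     openin (tp (zariski S C)) V \<and> x \<in> V \<and> V \<subseteq> U \<and> V \<subseteq> S \<and> (\<forall>y\<in>V. q y \<noteq> 0 \<and> f y = p y / q y)}"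
proof -
  have "rg (zariski S C) U = {f. \<forall>x\<in>U. \<exists>V D A p q. openin (tp (zariski S C)) V \<and> x \<in> V \<and> V \<subseteq> U \<and>
      (D, A) \<in> {(S, fun_algebra C)} \<and> V \<subseteq> D \<and> p \<in> A \<and> q \<in> A \<and> (\<forall>y\<in>V. q y \<noteq> 0 \<and> f y = p y / q y)}"
    unfolding zariski_def fraction_space_def Let_def fspace.simps ..
  also have "\<dots> = {f. \<forall>x\<in>U. \<exists>V p q. p \<in> fun_algebra C \<and> q \<in> fun_algebra C \<and>
     openin (tp (zariski S C)) V \<and> x \<in> V \<and> V \<subseteq> U \<and> V \<subseteq> S \<and> (\<forall>y\<in>V. q y \<noteq> 0 \<and> f y = p y / q y)}"
    by (intro Collect_cong ball_cong refl iff_exI) auto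
  finally show ?thesis .
qed

lemma regular_map_pts: "regular_map X Y f \<Longrightarrow> x \<in> pts X \<Longrightarrow> f x \<in> pts Y"
  unfolding regular_map_def pts_def continuous_map_def by blast

lemma isomorphism_bij:
  assumes "isomorphism X Y f" shows "bij_betw f (pts X) (pts Y)"
proof -
  obtain g where g: "regular_map X Y f" "regular_map Y X g"
    "\<forall>x\<in>pts X. g (f x) = x" "\<forall>y\<in>pts Y. f (g y) = y"
    using assms unfolding isomorphism_def by blast
  show ?thesis
    using g(3,4) regular_map_pts[OF g(1)] regular_map_pts[OF g(2)]
    by (intro bij_betw_byWitness[of _ g] image_subsetI) auto
qed

section \<open>Matrices and subgroups of the general linear group\<close>

lemma matrix_inv:
  fixes A :: "complex^'n^'n"
  assumes "invertible A"
  shows "matrix_inv A ** A = mat 1" "A ** matrix_inv A = mat 1"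
  using someI_ex[of "\<lambda>A'. A ** A' = mat 1 \<and> A' ** A = mat 1"] assms
  unfolding matrix_inv_def invertible_def by blast+

lemma invertible_matrix_inv: "invertible (A :: complex^'n^'n) \<Longrightarrow> invertible (matrix_inv A)"
  using matrix_inv[of A] unfolding invertible_def by blast

lemma group_GLn: "group (GLn :: (complex^'n^'n) monoid)"
proof (rule groupI)
  fix x :: "complex^'n^'n" assume "x \<in> carrier GLn"
  then show "\<exists>y\<in>carrier GLn. y \<otimes>\<^bsub>GLn\<^esub> x = \<one>\<^bsub>GLn\<^esub>"
    by (auto simp: GLn_def intro!: bexI[of _ "matrix_inv x"] matrix_inv(1) invertible_matrix_inv)
next
  have "invertible (mat 1 :: complex^'n^'n)" unfolding invertible_def by (intro exI[of _ "mat 1"]) simp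
  then show "\<one>\<^bsub>GLn\<^esub> \<in> carrier (GLn :: (complex^'n^'n) monoid)" by (simp add: GLn_def)
qed (auto simp: GLn_def invertible_mult matrix_mul_assoc)

lemma inv_GLn:
  fixes b :: "complex^'n^'n"
  assumes "invertible b" shows "inv\<^bsub>GLn\<^esub> b = matrix_inv b"
  by (rule group.inv_equality[OF group_GLn])
    (use assms in \<open>auto simp: GLn_def matrix_inv invertible_matrix_inv\<close>)

lemma subgroup_GLnD:
  assumes "subgroup H (GLn :: (complex^'n^'n) monoid)"
  shows "mat 1 \<in> H" "\<And>a b. a \<in> H \<Longrightarrow> b \<in> H \<Longrightarrow> a ** b \<in> H" "\<And>a. a \<in> H \<Longrightarrow> invertible a"
    "\<And>a. a \<in> H \<Longrightarrow> matrix_inv a \<in> H"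
proof -
  show "mat 1 \<in> H" using subgroup.one_closed[OF assms] by (simp add: GLn_def)
  show "a ** b \<in> H" if "a \<in> H" "b \<in> H" for a b
    using subgroup.m_closed[OF assms that] by (simp add: GLn_def)
  show inv: "invertible a" if "a \<in> H" for a
    using subgroup.mem_carrier[OF assms that] by (simp add: GLn_def)
  show "matrix_inv a \<in> H" if "a \<in> H" for a
    using subgroup.m_inv_closed[OF assms that] inv_GLn[OF inv[OF that]] by simp
qed

lemma matrix_inv_unique:
  fixes A :: "complex^'n^'n"
  assumes "A ** B = mat 1" shows "matrix_inv A = B"
proof -
  have "invertible A" using assms matrix_left_right_inverse by (auto simp: invertible_def)
  then have "matrix_inv A = matrix_inv A ** (A ** B)" using assms by simp
  also have "\<dots> = B" using \<open>invertible A\<close> by (simp add: matrix_mul_assoc matrix_inv)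
  finally show ?thesis .
qed

lemma matrix_inv_mult:
  fixes a b :: "complex^'n^'n"
  assumes "invertible a" "invertible b"
  shows "matrix_inv (a ** b) = matrix_inv b ** matrix_inv a"
proof (rule matrix_inv_unique)
  have "(a ** b) ** (matrix_inv b ** matrix_inv a) = a ** (b ** matrix_inv b) ** matrix_inv a"
    by (simp only: matrix_mul_assoc)
  then show "(a ** b) ** (matrix_inv b ** matrix_inv a) = mat 1"
    using assms by (simp add: matrix_inv)
qed

lemma matrix_inv_inv:
  fixes a :: "complex^'n^'n"
  assumes "invertible a" shows "matrix_inv (matrix_inv a) = a"
  by (rule matrix_inv_unique) (use assms in \<open>simp add: matrix_inv\<close>)

lemma matrix_mul_left_cancel:
  fixes a :: "complex^'n^'n"
  assumes "invertible a" "a ** x = a ** y" shows "x = y"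
  using assms by (metis matrix_inv(1) matrix_mul_assoc matrix_mul_lid)

lemma matrix_mult_entry:
  fixes A B :: "complex^'n^'n"
  shows "(A ** B) $ i $ j = (\<Sum>k\<in>UNIV. A $ i $ k * B $ k $ j)"
  by (simp add: matrix_matrix_mult_def)

lemma matrix_mult_add:
  fixes A B C :: "complex^'n^'n"
  shows "A ** (B + C) = A ** B + A ** C" "(A + B) ** C = A ** C + B ** C"
  by (simp_all add: vec_eq_iff matrix_mult_entry algebra_simps sum.distrib)

lemma entry_in_conjugated_coordinates:
  fixes M P Q :: "complex^'n^'n"
  assumes "P ** Q = mat 1"
  shows "M $ i $ j = (\<Sum>x\<in>UNIV. (P $ i $ fst x * Q $ snd x $ j) * (Q ** M ** P) $ fst x $ snd x)"
proof -
  have "M = (P ** Q) ** M ** (P ** Q)" by (simp add: assms)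
  also have "\<dots> = (P ** (Q ** M ** P)) ** Q" by (simp only: matrix_mul_assoc)
  finally have "M $ i $ j = ((P ** (Q ** M ** P)) ** Q) $ i $ j" by simp
  also have "\<dots> = (\<Sum>l\<in>UNIV. \<Sum>k\<in>UNIV. P $ i $ k * (Q ** M ** P) $ k $ l * Q $ l $ j)"
    by (simp only: matrix_mult_entry[of "P ** (Q ** M ** P)" Q] matrix_mult_entry[of P "Q ** M ** P"] sum_distrib_right)
  also have "\<dots> = (\<Sum>k\<in>UNIV. \<Sum>l\<in>UNIV. P $ i $ k * (Q ** M ** P) $ k $ l * Q $ l $ j)"
    by (rule sum.swap)
  also have "\<dots> = (\<Sum>x\<in>UNIV. (P $ i $ fst x * Q $ snd x $ j) * (Q ** M ** P) $ fst x $ snd x)"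
    unfolding sum.cartesian_product by (simp add: case_prod_beta mult_ac)
  finally show ?thesis .
qed

lemma msc_simps [simp]: "msc 0 A = 0" "msc s A $ i $ j = s * A $ i $ j"
  by (simp_all add: msc_def vec_eq_iff)

lemma matrix_mult_msc:
  fixes A B :: "complex^'n^'n"
  shows "A ** msc s B = msc s (A ** B)" "msc s A ** B = msc s (A ** B)"
  by (simp_all add: vec_eq_iff matrix_matrix_mult_def sum_distrib_left mult_ac)

lemma diagonal_mult_entry:
  fixes D M :: "complex^'n^'n"
  assumes "\<And>i j. i \<noteq> j \<Longrightarrow> D $ i $ j = 0"
  shows "(D ** M) $ i $ j = D $ i $ i * M $ i $ j" "(M ** D) $ i $ j = M $ i $ j * D $ j $ j"
proof -
  have "(D ** M) $ i $ j = (\<Sum>k\<in>UNIV. if k = i then D $ i $ i * M $ i $ j else 0)"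
    unfolding matrix_mult_entry by (rule sum.cong[OF refl]) (use assms[of i] in auto)
  then show "(D ** M) $ i $ j = D $ i $ i * M $ i $ j" by simp
  have "(M ** D) $ i $ j = (\<Sum>k\<in>UNIV. if k = j then M $ i $ j * D $ j $ j else 0)"
    unfolding matrix_mult_entry by (rule sum.cong[OF refl]) (use assms[of _ j] in auto)
  then show "(M ** D) $ i $ j = M $ i $ j * D $ j $ j" by simp
qed

section \<open>Tori are diagonalizable\<close>

text \<open>
  \<open>Q\<close> is the inverse of \<open>P\<close>; both are named so that \<open>M \<mapsto> Q M P\<close> is a polynomial change of
  coordinates on matrices.
\<close>

definition diagonalizes :: "complex^'n^'n \<Rightarrow> complex^'n^'n \<Rightarrow> (complex^'n^'n) set \<Rightarrow> bool" where
  "diagonalizes P Q T \<longleftrightarrow> P ** Q = mat 1 \<and> Q ** P = mat 1 \<and>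
     (\<forall>t\<in>T. \<forall>i j. i \<noteq> j \<longrightarrow> (Q ** t ** P) $ i $ j = 0)"

lemma diagonalizes_mult:
  assumes D: "diagonalizes P Q T" and s: "s \<in> T" 
  shows "(Q ** (s ** M) ** P) $ i $ j = (Q ** s ** P) $ i $ i * (Q ** M ** P) $ i $ j"
    "(Q ** (M ** s) ** P) $ i $ j = (Q ** M ** P) $ i $ j * (Q ** s ** P) $ j $ j"
proof -
  have PQ: "P ** Q = mat 1" and diag: "\<And>i j. i \<noteq> j \<Longrightarrow> (Q ** s ** P) $ i $ j = 0"
    using D s unfolding diagonalizes_def by auto
  have *: "Q ** (M ** N) ** P = (Q ** M ** P) ** (Q ** N ** P)" for M N
  proof -
    have "(Q ** M ** P) ** (Q ** N ** P) = Q ** M ** (P ** Q) ** N ** P" by (simp only: matrix_mul_assoc)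
    then show ?thesis by (simp add: PQ matrix_mul_assoc)
  qed
  show "(Q ** (s ** M) ** P) $ i $ j = (Q ** s ** P) $ i $ i * (Q ** M ** P) $ i $ j"
    "(Q ** (M ** s) ** P) $ i $ j = (Q ** M ** P) $ i $ j * (Q ** s ** P) $ j $ j"
    unfolding * using diagonal_mult_entry[OF diag] by auto
qed

lemma diagonalizes_inverse:
  assumes D: "diagonalizes P Q T" and T: "subgroup T GLn" and t: "t \<in> T"
  shows "(Q ** t ** P) $ i $ i * (Q ** matrix_inv t ** P) $ i $ i = 1" "(Q ** t ** P) $ i $ i \<noteq> 0"
proof -
  have "(Q ** (t ** matrix_inv t) ** P) $ i $ i = 1"
  proof -
    have "Q ** (t ** matrix_inv t) ** P = mat 1"
      using matrix_inv(2)[OF subgroup_GLnD(3)[OF T t]] D unfolding diagonalizes_def by simp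
    then show ?thesis by (simp add: mat_def)
  qed
  then show *: "(Q ** t ** P) $ i $ i * (Q ** matrix_inv t ** P) $ i $ i = 1"
    using diagonalizes_mult(1)[OF D t] by simp
  then show "(Q ** t ** P) $ i $ i \<noteq> 0" by auto
qed

lemma diagonalizes_conjugate:
  assumes D: "diagonalizes P Q T" and T: "subgroup T GLn" and t: "t \<in> T"
  shows "(Q ** (t ** M ** matrix_inv t) ** P) $ i $ j
    = (Q ** t ** P) $ i $ i / (Q ** t ** P) $ j $ j * (Q ** M ** P) $ i $ j"
  using diagonalizes_mult[OF D] diagonalizes_inverse[OF D T t, of j] t subgroup_GLnD(4)[OF T t]
  by (simp add: field_simps)

lemma conjugated_eqI:
  fixes P Q A B :: "complex^'n^'n"
  assumes "P ** Q = mat 1" and "\<And>i j. (Q ** A ** P) $ i $ j = (Q ** B ** P) $ i $ j"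
  shows "A = B"
  using entry_in_conjugated_coordinates[OF assms(1), of A] entry_in_conjugated_coordinates[OF assms(1), of B] assms(2)
  by (simp add: vec_eq_iff)

lemma mat_diag: "mat (c::complex) $ i $ i = c"
  by (simp add: mat_def)

lemma mat_offdiag: "i \<noteq> j \<Longrightarrow> mat (c::complex) $ i $ j = 0"
  by (simp add: mat_def)

lemma unipotent_diagonalizable_trivial:
  assumes D: "diagonalizes P Q T" and u: "u \<in> T" and uni: "unipotent u"
  shows "u = mat 1"
proof -
  have PQ: "P ** Q = mat 1" "Q ** P = mat 1" using D unfolding diagonalizes_def by auto
  let ?n = "u - mat 1"
  have "Q ** u ** P = Q ** (?n + mat 1) ** P" by simp
  also have "\<dots> = Q ** ?n ** P + mat 1" by (simp only: matrix_mult_add matrix_mul_rid PQ)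
  finally have split: "(Q ** u ** P) $ i $ j = (Q ** ?n ** P) $ i $ j + mat 1 $ i $ j" for i j by simp
  have "(Q ** ?n ** P) $ i $ j = 0" if "i \<noteq> j" for i j
    using split[of i j] D u that mat_offdiag[OF that] unfolding diagonalizes_def by simp
  then have D': "diagonalizes P Q {?n}"
    using PQ unfolding diagonalizes_def by simp
  obtain k where k: "((**) ?n ^^ k) (mat 1) = 0" using uni unfolding unipotent_def by blast
  have "(Q ** (((**) ?n ^^ m) (mat 1)) ** P) $ i $ i = (Q ** ?n ** P) $ i $ i ^ m" for i m
  proof (induction m)
    case 0
    then show ?case by (simp add: PQ mat_diag)
  next
    case (Suc m)
    then show ?case using diagonalizes_mult(1)[OF D', of ?n "((**) ?n ^^ m) (mat 1)" i i] by simp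
  qed
  from this[of k] have diag: "(Q ** ?n ** P) $ i $ i = 0" for i unfolding k by simp
  have "?n = 0"
  proof (rule conjugated_eqI[OF PQ(1)])
    show "(Q ** ?n ** P) $ i $ j = (Q ** 0 ** P) $ i $ j" for i j
      using D' diag[of i] by (cases "i = j") (simp_all add: diagonalizes_def)
  qed
  then show ?thesis by simp
qed

lemma matrix_vector_mult_axis:
  fixes A :: "complex^'n^'m"
  shows "A *v axis j 1 = column j A"
  by (simp add: vec_eq_iff matrix_vector_mult_def column_def axis_def if_distrib cong: if_cong)

lemma funpow_matrix_vector:
  fixes s :: "complex^'n^'n"
  shows "((*v) s ^^ m) u = ((**) s ^^ m) (mat 1) *v u"
  by (induction m) (simp_all add: matrix_vector_mul_assoc)

text \<open>
  The discrete Fourier transform along the powers of \<open>s\<close> writes \<open>u\<close> as a sum of eigenvectors inside any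
  stable subspace.  The subspace is kept general so that it can be a joint eigenspace of matrices
  commuting with \<open>s\<close>.
\<close>

lemma finite_order_eigenvector_decomposition:
  fixes s :: "complex^'n^'n"
  assumes m: "m > 0" and id: "\<And>u. ((*v) s ^^ m) u = u"
    and stable: "\<And>v. v \<in> W \<Longrightarrow> s *v v \<in> W" and sub: "vec.subspace W" and u: "u \<in> W"
  shows "u \<in> vec.span {v \<in> W. \<exists>c. s *v v = c *s v}"
proof -
  define \<eta> where "\<eta> = cis (2 * pi / m)"
  have \<eta>m: "\<eta> ^ m = 1" using m unfolding \<eta>_def Complex.DeMoivre by simp
  have \<eta>k: "\<eta> ^ k \<noteq> 1" if "0 < k" "k < m" for k
  proof
    assume "\<eta> ^ k = 1"
    then have "cis (2 * pi * k / m) = cis (2 * pi * 0 / m)" unfolding \<eta>_def Complex.DeMoivre by (simp add: mult.commute)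
    moreover have "inj_on (\<lambda>k. cis (2 * pi * real k / real m)) {..<m}"
      using Complex.bij_betw_roots_unity[OF m] by (simp add: bij_betw_def)
    ultimately show False using that m by (auto dest!: inj_onD[of _ _ k 0])
  qed
  have \<eta>0: "\<eta> \<noteq> 0" by (simp add: \<eta>_def)
  define v where "v j = (\<Sum>k<m. \<eta> ^ (j * k) *s ((*v) s ^^ k) u)" for j
  have W: "((*v) s ^^ k) u \<in> W" for k by (induction k) (simp_all add: u stable)
  have vW: "v j \<in> W" for j
    unfolding v_def by (intro vec.subspace_sum[OF sub] vec.subspace_scale[OF sub] W)
  have eig: "s *v v j = inverse (\<eta> ^ j) *s v j" for j
  proof -
    let ?f = "\<lambda>k. \<eta> ^ (j * k) *s ((*v) s ^^ k) u"
    have "\<eta> ^ j *s (s *v v j) = (\<Sum>k<m. ?f (Suc k))"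
      unfolding v_def by (simp add: vec.sum vec.scale vec.scale_sum_right power_add)
    also have "\<dots> = (\<Sum>k<Suc m. ?f k) - ?f 0"
      by (simp only: sum.lessThan_Suc_shift) simp
    also have "\<dots> = v j"
    proof -
      have "\<eta> ^ (j * m) = 1" using \<eta>m by (metis mult.commute power_mult power_one)
      then show ?thesis using id[of u] by (simp add: v_def)
    qed
    finally have "inverse (\<eta> ^ j) *s (\<eta> ^ j *s (s *v v j)) = inverse (\<eta> ^ j) *s v j" by simp
    then show ?thesis using \<eta>0 by simp
  qed
  \<comment> \<open>Orthogonality of the characters of the cyclic group of order \<open>m\<close>.\<close>
  have geo: "(\<Sum>j<m. \<eta> ^ (j * k)) = (if k = 0 then of_nat m else 0)" if "k < m" for k
  proof (cases "k = 0")
    case False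
    have "(\<Sum>j<m. \<eta> ^ (j * k)) = (\<Sum>j<m. (\<eta> ^ k) ^ j)" by (simp add: power_mult[symmetric] mult.commute)
    also have "\<dots> = ((\<eta> ^ k) ^ m - 1) / (\<eta> ^ k - 1)"
      using \<eta>k[of k] that False by (intro geometric_sum) auto
    also have "(\<eta> ^ k) ^ m = 1" using \<eta>m by (metis power_mult mult.commute power_one)
    finally show ?thesis using False by simp
  qed simp
  have "(\<Sum>j<m. v j) = (\<Sum>k<m. (\<Sum>j<m. \<eta> ^ (j * k)) *s ((*v) s ^^ k) u)"
    unfolding v_def by (subst sum.swap) (simp add: vec.scale_sum_left)
  also have "\<dots> = (\<Sum>k<m. if k = 0 then of_nat m *s u else 0)"
    by (rule sum.cong) (auto simp: geo)
  also have "\<dots> = of_nat m *s u" using m by (simp add: sum.delta')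
  finally have eq: "u = inverse (of_nat m) *s (\<Sum>j<m. v j)" using m by simp
  have span: "v j \<in> vec.span {v \<in> W. \<exists>c. s *v v = c *s v}" for j
    using vW eig by (intro vec.span_base) blast
  show ?thesis by (subst eq) (intro vec.span_scale vec.span_sum span)
qed

lemma common_eigenvectors_span:
  fixes S :: "(complex^'n^'n) set"
  assumes "finite S" and "\<And>s t. s \<in> S \<Longrightarrow> t \<in> S \<Longrightarrow> s ** t = t ** s"
    and "\<And>s. s \<in> S \<Longrightarrow> \<exists>m>0. \<forall>u. ((*v) s ^^ m) u = u"
  shows "vec.span {u. \<forall>s\<in>S. \<exists>c. s *v u = c *s u} = UNIV"
  using assms
proof (induction S)
  case (insert s S)
  let ?E = "{u. \<forall>t\<in>insert s S. \<exists>c. t *v u = c *s u}"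
  have "u \<in> vec.span ?E" if u: "\<forall>t\<in>S. \<exists>c. t *v u = c *s u" for u
  proof -
    obtain c where c: "\<And>t. t \<in> S \<Longrightarrow> t *v u = c t *s u" using u by metis
    let ?W = "{v. \<forall>t\<in>S. t *v v = c t *s v}"
    obtain m where "m > 0" "\<And>u. ((*v) s ^^ m) u = u" using insert.prems(2)[of s] by auto
    moreover have "s *v v \<in> ?W" if "v \<in> ?W" for v
    proof
      show "\<forall>t\<in>S. t *v (s *v v) = c t *s (s *v v)"
      proof
        fix t assume t: "t \<in> S"
        have "t *v (s *v v) = s *v (t *v v)"
          using insert.prems(1)[of s t] t by (simp add: matrix_vector_mul_assoc)
        then show "t *v (s *v v) = c t *s (s *v v)" using that t by (simp add: vec.scale)
      qed
    qed
    moreover have "vec.subspace ?W"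
      by (rule vec.subspaceI) (auto simp: vec.add vec.scale vec.scale_right_distrib mult.commute)
    ultimately have "u \<in> vec.span {v \<in> ?W. \<exists>c. s *v v = c *s v}"
      using c by (intro finite_order_eigenvector_decomposition) auto
    moreover have "{v \<in> ?W. \<exists>c. s *v v = c *s v} \<subseteq> ?E" by auto
    ultimately show ?thesis using vec.span_mono by blast
  qed
  then have "{u. \<forall>s\<in>S. \<exists>c. s *v u = c *s u} \<subseteq> vec.span ?E" by blast
  then have "vec.span {u. \<forall>s\<in>S. \<exists>c. s *v u = c *s u} \<subseteq> vec.span ?E"
    by (simp add: vec.span_minimal)
  then show ?case using insert by auto
qed simp

text \<open>
  Joint eigenvectors of finitely many of the matrices that span all others linearly are joint
  eigenvectors of the whole family, so the finite case suffices; a basis of joint eigenvectors provides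
  the columns of \<open>P\<close>.
\<close>

lemma commuting_finite_order_diagonalizable:
  fixes S :: "(complex^'n^'n) set"
  assumes comm: "\<And>s t. s \<in> S \<Longrightarrow> t \<in> S \<Longrightarrow> s ** t = t ** s"
    and ord: "\<And>s. s \<in> S \<Longrightarrow> \<exists>m>0. \<forall>u. ((*v) s ^^ m) u = u"
  shows "\<exists>P Q. diagonalizes P Q S"
proof -
  obtain S0 where S0: "S0 \<subseteq> S" "independent S0" "S \<subseteq> span S0"
    using maximal_independent_subset by blast
  let ?E = "{u. \<forall>s\<in>S0. \<exists>c. s *v u = c *s u}"
  have span: "vec.span ?E = UNIV"
  proof (rule common_eigenvectors_span)
    show "finite S0" using S0(2) by (rule independent_imp_finite)
  qed (use S0(1) comm ord in blast)+
  have eig: "\<exists>c. s *v u = c *s u" if u: "u \<in> ?E" and s: "s \<in> S" for s u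
  proof -
    have "subspace {M :: complex^'n^'n. \<exists>c. M *v u = c *s u}"
    proof (rule subspaceI)
      show "0 \<in> {M :: complex^'n^'n. \<exists>c. M *v u = c *s u}" by (auto intro!: exI[of _ 0])
    next
      fix M N :: "complex^'n^'n" 
      assume "M \<in> {M. \<exists>c. M *v u = c *s u}" "N \<in> {M. \<exists>c. M *v u = c *s u}"
      then obtain c d where "M *v u = c *s u" "N *v u = d *s u" by blast
      then have "(M + N) *v u = (c + d) *s u"
        by (simp add: matrix_vector_mult_add_rdistrib vec.scale_left_distrib)
      then show "M + N \<in> {M. \<exists>c. M *v u = c *s u}" by blast
    next
      fix r and M :: "complex^'n^'n" assume "M \<in> {M. \<exists>c. M *v u = c *s u}"
      then obtain c where "M *v u = c *s u" by blast
      then have "(r *\<^sub>R M) *v u = (of_real r * c) *s u"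
        by (simp add: vec_eq_iff matrix_vector_mult_def scaleR_conv_of_real[where 'a=complex]
            sum_distrib_left[symmetric] mult.assoc)
      then show "r *\<^sub>R M \<in> {M. \<exists>c. M *v u = c *s u}" by blast
    qed
    moreover have "S0 \<subseteq> {M. \<exists>c. M *v u = c *s u}" using u by blast
    ultimately have "span S0 \<subseteq> {M. \<exists>c. M *v u = c *s u}" by (metis span_minimal)
    with S0(3) s show ?thesis by blast
  qed
  obtain B where B: "B \<subseteq> ?E" "vec.independent B" "?E \<subseteq> vec.span B"
    using vec.maximal_independent_subset by blast
  have spanB: "vec.span B = UNIV"
    using vec.span_minimal[OF B(3)] span by auto
  have finB: "finite B" using B(2) by (rule vec.finiteI_independent)
  have "card B = CARD('n)"
    using vec.basis_card_eq_dim[of B UNIV] B(2) spanB by (simp add: card_cart_basis)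
  then obtain h :: "'n \<Rightarrow> complex^'n" where h: "bij_betw h UNIV B"
    using finB by (metis bij_betw_iff_card finite)
  define P :: "complex^'n^'n" where "P = (\<chi> i j. h j $ i)"
  have col: "column j P = h j" for j by (simp add: P_def column_def vec_eq_iff)
  then have "columns P = B"
    using h by (auto simp: columns_def bij_betw_def)
  then obtain Q where PQ: "P ** Q = mat 1"
    using matrix_right_invertible_span_columns[of P] spanB by auto
  then have QP: "Q ** P = mat 1" using matrix_left_right_inverse by blast
  have "(Q ** s ** P) $ i $ j = 0" if s: "s \<in> S" and ij: "i \<noteq> j" for s i j
  proof -
    have P_axis: "P *v axis j 1 = h j" using col by (simp add: matrix_vector_mult_axis)
    have "h j \<in> ?E" using h B(1) by (auto simp: bij_betw_def)
    then obtain c where c: "s *v h j = c *s h j" using eig s by blast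
    have "Q *v h j = axis j 1"
      using QP P_axis matrix_vector_mul_assoc[of Q P "axis j 1"] by simp
    then have "(Q ** s ** P) *v axis j 1 = c *s axis j 1"
      using c P_axis by (simp add: matrix_vector_mul_assoc[symmetric] vec.scale)
    then have "column j (Q ** s ** P) = c *s axis j 1" by (simp add: matrix_vector_mult_axis)
    then have "column j (Q ** s ** P) $ i = 0" using ij by (simp add: axis_def)
    then show "(Q ** s ** P) $ i $ j = 0" by (simp add: column_def)
  qed
  with PQ QP show ?thesis unfolding diagonalizes_def by blast
qed

lemma infinite_roots_of_unity: "infinite {w :: complex. \<exists>m>0. w ^ m = 1}"
proof
  assume fin: "finite {w :: complex. \<exists>m>0. w ^ m = 1}"
  let ?N = "Suc (card {w :: complex. \<exists>m>0. w ^ m = 1})"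
  have "card {w :: complex. w ^ ?N = 1} \<le> card {w :: complex. \<exists>m>0. w ^ m = 1}"
    by (rule card_mono[OF fin]) blast
  then show False by (subst (asm) Complex.card_roots_unity_eq) auto
qed

definition torus_points :: "nat \<Rightarrow> (nat \<Rightarrow> complex) set" where
  "torus_points k = {x. (\<forall>i. x i \<noteq> 0) \<and> (\<forall>i\<ge>k. x i = 1)}"

lemma std_torus_eq: "std_torus k = zariski (torus_points k) {\<lambda>x. x i | i. i < k}"
  by (simp add: std_torus_def torus_points_def)

text \<open>
  Regular functions on affine space become polynomials in one variable when all coordinates but one
  are frozen; this reduces statements about the torus to univariate ones.
\<close>

lemma fun_algebra_coordinate_poly:
  assumes "p \<in> fun_algebra {\<lambda>x. x i | i. i < k}"
  shows "\<exists>q. \<forall>w. p (x(j := w)) = poly q w"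
  using assms
proof induction
  case (gen f)
  then obtain i where f: "f = (\<lambda>x. x i)" by blast
  show ?case
  proof (cases "i = j")
    case True
    then show ?thesis using f by (intro exI[of _ "[:0, 1:]"]) simp
  next
    case False
    then show ?thesis using f by (intro exI[of _ "[:x i:]"]) simp
  qed
next
  case (const c)
  show ?case by (intro exI[of _ "[:c:]"]) simp
next
  case (add f g)
  then show ?case by (metis poly_add)
next
  case (mult f g)
  then show ?case by (metis poly_mult)
qed

text \<open>
  The coordinates are replaced by roots of unity one after the other: a univariate polynomial that is
  not zero at the old coordinate misses all but finitely many roots of unity.
\<close>

lemma torsion_dense:
  assumes p: "p \<in> fun_algebra {\<lambda>x. x i | i. i < k}" and x: "x \<in> torus_points k" "p x \<noteq> 0"
  obtains y m where "y \<in> torus_points k" "p y \<noteq> 0" "m > 0" "\<And>i. y i ^ m = 1"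
proof -
  have "\<exists>y\<in>torus_points k. p y \<noteq> 0 \<and> (\<forall>i<j. \<exists>m>0. y i ^ m = 1)" for j
  proof (induction j)
    case 0
    then show ?case using x by auto
  next
    case (Suc j)
    then obtain y where y: "y \<in> torus_points k" "p y \<noteq> 0" "\<forall>i<j. \<exists>m>0. y i ^ m = 1" by blast
    show ?case
    proof (cases "j < k")
      case True
      obtain q where q: "\<And>w. p (y(j := w)) = poly q w" using fun_algebra_coordinate_poly[OF p, of y j] by blast
      have "poly q (y j) \<noteq> 0" using q[of "y j"] y(2) by simp
      then have "finite {w. poly q w = 0}" by (intro poly_roots_finite) auto
      then have "\<exists>w\<in>{w :: complex. \<exists>m>0. w ^ m = 1}. w \<notin> {w. poly q w = 0}"
        using infinite_roots_of_unity by (meson finite_subset subsetI)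
      then obtain w m where w: "m > 0" "w ^ m = 1" "poly q w \<noteq> 0" by blast
      have "w \<noteq> 0" using w by (auto simp: power_0_left)
      then have "y(j := w) \<in> torus_points k" using y(1) True by (auto simp: torus_points_def)
      moreover have "p (y(j := w)) \<noteq> 0" using q w by simp
      moreover have "\<forall>i<Suc j. \<exists>m>0. (y(j := w)) i ^ m = 1" using y(3) w by (auto simp: less_Suc_eq)
      ultimately show ?thesis by blast
    next
      case False
      then have "y j = 1" using y(1) by (simp add: torus_points_def)
      then have "\<exists>m>0. y j ^ m = 1" by (intro exI[of _ 1]) simp
      then show ?thesis using y less_Suc_eq by (intro bexI[of _ y]) auto
    qed
  qed
  from this[of k] obtain y where y: "y \<in> torus_points k" "p y \<noteq> 0" "\<forall>i<k. \<exists>m>0. y i ^ m = 1" by blast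
  then obtain m where m: "\<And>i. i < k \<Longrightarrow> m i > 0" "\<And>i. i < k \<Longrightarrow> y i ^ m i = 1" by metis
  show thesis
  proof
    show "y \<in> torus_points k" "p y \<noteq> 0" by fact+
    show "(\<Prod>i<k. m i) > 0" using m(1) by (simp add: prod_pos)
    show "y i ^ (\<Prod>i<k. m i) = 1" for i
    proof (cases "i < k")
      case True
      then have "m i dvd (\<Prod>i<k. m i)" by (intro dvd_prodI) auto
      then obtain l where "(\<Prod>i<k. m i) = m i * l" by (elim dvdE)
      then show ?thesis using m(2)[OF True] by (simp add: power_mult)
    next
      case False
      then show ?thesis using y(1) by (simp add: torus_points_def)
    qed
  qed
qed

lemma torusE:
  fixes T :: "(complex^'n^'n) set"
  assumes "torus T"
  obtains k f g where "subgroup T GLn" "regular_map (alg T) (std_torus k) f" "regular_map (std_torus k) (alg T) g"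
    "\<And>t. t \<in> T \<Longrightarrow> f t \<in> torus_points k" "\<And>x. x \<in> torus_points k \<Longrightarrow> g x \<in> T"
    "\<And>t. t \<in> T \<Longrightarrow> g (f t) = t" "\<And>x. x \<in> torus_points k \<Longrightarrow> f (g x) = x"
    "\<And>s t. s \<in> T \<Longrightarrow> t \<in> T \<Longrightarrow> f (s ** t) = (\<lambda>i. f s i * f t i)"
proof -
  from assms obtain k f g where *: "subgroup T GLn" "regular_map (alg T) (std_torus k) f"
    "regular_map (std_torus k) (alg T) g" "\<forall>t\<in>pts (alg T). g (f t) = t"
    "\<forall>x\<in>pts (std_torus k). f (g x) = x" "\<forall>s\<in>T. \<forall>t\<in>T. f (s ** t) = (\<lambda>i. f s i * f t i)"
    unfolding torus_def linear_algebraic_group_def isomorphism_def by blast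
  then show thesis
    using that[of k f g] regular_map_pts[OF *(2)] regular_map_pts[OF *(3)] by (simp add: std_torus_eq)
qed

text \<open>
  The elements of finite order commute, so they are jointly diagonalizable.  Vanishing of the
  off-diagonal entries is a closed condition, and it spreads to the torus by density.
\<close>

lemma torus_diagonalizable:
  fixes T :: "(complex^'n^'n) set"
  assumes "torus T"
  obtains P Q where "diagonalizes P Q T"
proof -
  obtain k f g where T: "subgroup T GLn" and f: "regular_map (alg T) (std_torus k) f"
    and g: "regular_map (std_torus k) (alg T) g"
    and fT: "\<And>t. t \<in> T \<Longrightarrow> f t \<in> torus_points k" and gT: "\<And>x. x \<in> torus_points k \<Longrightarrow> g x \<in> T"
    and gf: "\<And>t. t \<in> T \<Longrightarrow> g (f t) = t" and fg: "\<And>x. x \<in> torus_points k \<Longrightarrow> f (g x) = x"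
    and hom: "\<And>s t. s \<in> T \<Longrightarrow> t \<in> T \<Longrightarrow> f (s ** t) = (\<lambda>i. f s i * f t i)"
    using assms by (rule torusE) blast
  have f1: "f (mat 1) i = 1" for i
  proof -
    have "f (mat 1) i * f (mat 1) i = f (mat 1) i"
      using hom[OF subgroup_GLnD(1)[OF T] subgroup_GLnD(1)[OF T]] by (metis matrix_mul_lid)
    moreover have "f (mat 1) i \<noteq> 0" using fT[OF subgroup_GLnD(1)[OF T]] by (simp add: torus_points_def)
    ultimately show ?thesis by simp
  qed
  let ?S = "{t \<in> T. \<exists>m>0. \<forall>i. f t i ^ m = 1}"
  have pow: "((**) t ^^ m) (mat 1) \<in> T \<and> f (((**) t ^^ m) (mat 1)) = (\<lambda>i. f t i ^ m)" if "t \<in> T" for t m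
    by (induction m) (use that f1 hom subgroup_GLnD(1,2)[OF T] in auto)
  have ord: "\<exists>m>0. \<forall>u. ((*v) t ^^ m) u = u" if "t \<in> ?S" for t
  proof -
    obtain m where m: "m > 0" "\<forall>i. f t i ^ m = 1" and t: "t \<in> T" using \<open>t \<in> ?S\<close> by blast
    have "f (((**) t ^^ m) (mat 1)) = f (mat 1)" using pow[OF t, of m] m f1 by auto
    then have "((**) t ^^ m) (mat 1) = mat 1" using gf pow[OF t, of m] subgroup_GLnD(1)[OF T] by metis
    then show ?thesis using m(1) by (intro exI[of _ m]) (simp add: funpow_matrix_vector)
  qed
  have comm: "s ** t = t ** s" if "s \<in> ?S" "t \<in> ?S" for s t
  proof -
    have "f (s ** t) = f (t ** s)" using that hom by (auto simp: mult.commute)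
    then show ?thesis using gf subgroup_GLnD(2)[OF T] that by (metis (mono_tags, lifting) mem_Collect_eq)
  qed
  obtain P Q where PQ: "diagonalizes P Q ?S"
    using commuting_finite_order_diagonalizable[of ?S, OF comm ord] by blast
  have "(Q ** t ** P) $ i $ j = 0" if t: "t \<in> T" and "i \<noteq> j" for t i j
  proof (rule ccontr)
    assume nz: "(Q ** t ** P) $ i $ j \<noteq> 0"
    let ?V = "{A \<in> T. (Q ** A ** P) $ i $ j \<noteq> 0}"
    have "openin (tp (alg T)) ?V"
      unfolding alg_def by (rule openin_zariski_basic[OF fun_algebra_sandwich])
    then have "openin (tp (std_torus k)) {x \<in> topspace (tp (std_torus k)). g x \<in> ?V}"
      using g unfolding regular_map_def continuous_map_def by blast
    then have "openin (tp (std_torus k)) {x \<in> torus_points k. g x \<in> ?V}"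
      using pts_zariski[of "torus_points k"] by (simp add: pts_def std_torus_eq)
    moreover have "f t \<in> {x \<in> torus_points k. g x \<in> ?V}" using t nz fT gf by simp
    ultimately obtain p where p: "p \<in> fun_algebra {\<lambda>x. x i | i. i < k}" "p (f t) \<noteq> 0"
      "{y \<in> torus_points k. p y \<noteq> 0} \<subseteq> {x \<in> torus_points k. g x \<in> ?V}"
      unfolding std_torus_eq by (elim openin_zariskiE)
    obtain y m where y: "y \<in> torus_points k" "p y \<noteq> 0" "m > 0" "\<And>i. y i ^ m = 1"
      using torsion_dense[OF p(1) fT[OF t] p(2)] by blast
    have "g y \<in> ?S" using gT fg y by auto
    moreover have "g y \<in> ?V" using p(3) y by blast
    ultimately show False using PQ \<open>i \<noteq> j\<close> unfolding diagonalizes_def by blast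
  qed
  then show thesis using PQ that[of P Q] unfolding diagonalizes_def by blast
qed

section \<open>Characters of a torus and lattice duality\<close>

lemma int_subgroup_generator:
  fixes J :: "int set"
  assumes "0 \<in> J" "\<And>a b. a \<in> J \<Longrightarrow> b \<in> J \<Longrightarrow> a - b \<in> J"
  obtains d where "d \<ge> 0" "J = {n. d dvd n}"
proof (cases "J \<subseteq> {0}")
  case True
  then show thesis using assms(1) by (intro that[of 0]) auto
next
  case False
  then obtain a where a: "a \<in> J" "a \<noteq> 0" by blast
  have neg: "- b \<in> J" if "b \<in> J" for b using assms(2)[OF assms(1) that] by simp
  have add: "b + c \<in> J" if "b \<in> J" "c \<in> J" for b c using assms(2)[OF that(1) neg[OF that(2)]] by simp
  have "\<exists>n>0. int n \<in> J" using a neg[OF a(1)] by (intro exI[of _ "nat \<bar>a\<bar>"]) (auto simp: abs_if)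
  then obtain d where d: "d > 0" "int d \<in> J" and least: "\<And>n. n > 0 \<Longrightarrow> int n \<in> J \<Longrightarrow> d \<le> n"
    using exists_least_iff[of "\<lambda>n. n > 0 \<and> int n \<in> J"] by (meson not_less)
  have mult: "int d * int n \<in> J" for n
    by (induction n) (auto simp: assms(1) algebra_simps intro: add d(2))
  have mult': "int d * c \<in> J" for c
    using mult[of "nat c"] neg[OF mult[of "nat (- c)"]] by (cases "c \<ge> 0") auto
  have "int d dvd b" if b: "b \<in> J" for b
  proof -
    have "b mod int d = b - int d * (b div int d)" by (simp add: minus_mult_div_eq_mod)
    then have "b mod int d \<in> J" using assms(2)[OF b mult'] by simp
    moreover have "0 \<le> b mod int d" "b mod int d < int d" using d(1) by auto
    ultimately have "b mod int d = 0" using least[of "nat (b mod int d)"] by force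
    then show ?thesis by blast
  qed
  moreover have "b \<in> J" if "int d dvd b" for b using that mult' by (auto elim: dvdE)
  ultimately show thesis by (intro that[of "int d"]) auto
qed

text \<open>
  Characters of a torus are recorded by their exponents.  Integer vectors are functions on the natural
  numbers, to be supported below the rank, so that the rank may vary inside statements.
\<close>

definition lattice_subgroup :: "(nat \<Rightarrow> int) set \<Rightarrow> bool" where
  "lattice_subgroup A \<longleftrightarrow> (\<lambda>_. 0) \<in> A \<and> (\<forall>a\<in>A. \<forall>b\<in>A. (\<lambda>i. a i - b i) \<in> A)"

definition lattice_hom :: "(nat \<Rightarrow> int) set \<Rightarrow> ((nat \<Rightarrow> int) \<Rightarrow> complex) \<Rightarrow> bool" where
  "lattice_hom A \<phi> \<longleftrightarrow> (\<forall>a\<in>A. \<phi> a \<noteq> 0) \<and> (\<forall>a\<in>A. \<forall>b\<in>A. \<phi> (\<lambda>i. a i + b i) = \<phi> a * \<phi> b)"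

lemma lattice_subgroupD:
  assumes "lattice_subgroup A"
  shows "(\<lambda>_. 0) \<in> A" "\<And>a b. a \<in> A \<Longrightarrow> b \<in> A \<Longrightarrow> (\<lambda>i. a i - b i) \<in> A"
    "\<And>a b. a \<in> A \<Longrightarrow> b \<in> A \<Longrightarrow> (\<lambda>i. a i + b i) \<in> A" "\<And>a n. a \<in> A \<Longrightarrow> (\<lambda>i. n * a i) \<in> A"
proof -
  show zero: "(\<lambda>_. 0) \<in> A" and diff: "\<And>a b. a \<in> A \<Longrightarrow> b \<in> A \<Longrightarrow> (\<lambda>i. a i - b i) \<in> A"
    using assms unfolding lattice_subgroup_def by auto
  have neg: "(\<lambda>i. - a i) \<in> A" if "a \<in> A" for a using diff[OF zero that] by simp
  show add: "(\<lambda>i. a i + b i) \<in> A" if "a \<in> A" "b \<in> A" for a b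
    using diff[OF that(1) neg[OF that(2)]] by simp
  have pos: "(\<lambda>i. int n * a i) \<in> A" if "a \<in> A" for a n
    using that by (induction n) (auto simp: zero algebra_simps intro: add)
  show "(\<lambda>i. n * a i) \<in> A" if "a \<in> A" for a n
  proof (cases "n \<ge> 0")
    case True
    then show ?thesis using pos[OF that, of "nat n"] by simp
  next
    case False
    then show ?thesis using neg[OF pos[OF that, of "nat (- n)"]] by simp
  qed
qed

lemma lattice_homD:
  assumes A: "lattice_subgroup A" and h: "lattice_hom A \<phi>"
  shows "\<phi> (\<lambda>_. 0) = 1" "\<And>a n. a \<in> A \<Longrightarrow> \<phi> (\<lambda>i. n * a i) = \<phi> a powi n"
proof -
  note D = lattice_subgroupD[OF A]
  have nz: "\<And>a. a \<in> A \<Longrightarrow> \<phi> a \<noteq> 0" and add: "\<And>a b. a \<in> A \<Longrightarrow> b \<in> A \<Longrightarrow> \<phi> (\<lambda>i. a i + b i) = \<phi> a * \<phi> b"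
    using h unfolding lattice_hom_def by auto
  show one: "\<phi> (\<lambda>_. 0) = 1" using add[OF D(1) D(1)] nz[OF D(1)] by simp
  have pos: "\<phi> (\<lambda>i. int n * a i) = \<phi> a ^ n" if "a \<in> A" for a n
  proof (induction n)
    case (Suc n)
    have "\<phi> (\<lambda>i. int (Suc n) * a i) = \<phi> (\<lambda>i. a i + int n * a i)" by (simp add: algebra_simps)
    then show ?case using add[OF that D(4)[OF that, of "int n"]] Suc by simp
  qed (simp add: one)
  show "\<phi> (\<lambda>i. n * a i) = \<phi> a powi n" if a: "a \<in> A" for a n
  proof (cases "n \<ge> 0")
    case True
    then show ?thesis using pos[OF a, of "nat n"] by (simp add: power_int_def)
  next
    case False
    have "\<phi> (\<lambda>i. n * a i) * \<phi> a ^ nat (- n) = \<phi> (\<lambda>i. n * a i + int (nat (- n)) * a i)"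
      using add[OF D(4)[OF a] D(4)[OF a]] pos[OF a] by metis
    also have "(\<lambda>i. n * a i + int (nat (- n)) * a i) = (\<lambda>_. 0)" using False by (auto simp: algebra_simps)
    finally show ?thesis using False nz[OF a] one by (simp add: power_int_def field_simps)
  qed
qed

text \<open>
  The value at \<open>a + n e\<close> has to be \<open>\<phi> a r\<^sup>n\<close>; the compatibility assumption makes it independent of how
  the element is written in this form.
\<close>

lemma lattice_hom_extend:
  assumes A: "lattice_subgroup A" and h: "lattice_hom A \<phi>" and r: "r \<noteq> 0"
    and compat: "\<And>n. (\<lambda>i. n * e i) \<in> A \<Longrightarrow> \<phi> (\<lambda>i. n * e i) = r powi n"
  obtains A' \<psi> where "lattice_subgroup A'" "lattice_hom A' \<psi>" "A \<subseteq> A'" "e \<in> A'"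
    "\<And>a. a \<in> A \<Longrightarrow> \<psi> a = \<phi> a" "\<psi> e = r"
proof -
  note D = lattice_subgroupD[OF A]
  have nz: "\<And>a. a \<in> A \<Longrightarrow> \<phi> a \<noteq> 0" and add: "\<And>a b. a \<in> A \<Longrightarrow> b \<in> A \<Longrightarrow> \<phi> (\<lambda>i. a i + b i) = \<phi> a * \<phi> b"
    using h unfolding lattice_hom_def by auto
  define A' where "A' = {\<lambda>i. a i + n * e i | a n. a \<in> A}"
  define \<psi> where "\<psi> x = (SOME c. \<exists>a n. a \<in> A \<and> x = (\<lambda>i. a i + n * e i) \<and> c = \<phi> a * r powi n)" for x
  have \<psi>: "\<psi> (\<lambda>i. a i + n * e i) = \<phi> a * r powi n" if a: "a \<in> A" for a n
  proof -
    have "\<exists>b l. b \<in> A \<and> (\<lambda>i. a i + n * e i) = (\<lambda>i. b i + l * e i) \<and> \<psi> (\<lambda>i. a i + n * e i) = \<phi> b * r powi l"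
      unfolding \<psi>_def by (rule someI_ex) (use a in blast)
    then obtain b l where b: "b \<in> A" and eq: "(\<lambda>i. a i + n * e i) = (\<lambda>i. b i + l * e i)"
      and val: "\<psi> (\<lambda>i. a i + n * e i) = \<phi> b * r powi l" by blast
    have eq': "(\<lambda>i. b i - a i) = (\<lambda>i. (n - l) * e i)"
    proof
      fix i show "b i - a i = (n - l) * e i" using fun_cong[OF eq, of i] by (simp add: algebra_simps)
    qed
    have "\<phi> b = \<phi> (\<lambda>i. a i + (b i - a i))" by simp
    also have "\<dots> = \<phi> a * \<phi> (\<lambda>i. b i - a i)" by (rule add[OF a D(2)[OF b a]])
    also have "\<phi> (\<lambda>i. b i - a i) = r powi (n - l)"
      using compat[of "n - l"] D(2)[OF b a] unfolding eq' by blast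
    finally show ?thesis using r by (simp add: val power_int_diff)
  qed
  have "lattice_subgroup A'"
    unfolding lattice_subgroup_def
  proof (intro conjI ballI)
    show "(\<lambda>_. 0) \<in> A'" unfolding A'_def using D(1) by (intro CollectI exI[of _ "\<lambda>_. 0"] exI[of _ 0]) simp
    fix x y assume "x \<in> A'" "y \<in> A'"
    then obtain a n b l where "a \<in> A" "b \<in> A" "x = (\<lambda>i. a i + n * e i)" "y = (\<lambda>i. b i + l * e i)"
      unfolding A'_def by blast
    then show "(\<lambda>i. x i - y i) \<in> A'" unfolding A'_def
      by (intro CollectI exI[of _ "\<lambda>i. a i - b i"] exI[of _ "n - l"]) (auto simp: algebra_simps intro: D(2))
  qed
  moreover have "lattice_hom A' \<psi>"
    unfolding lattice_hom_def
  proof (intro conjI ballI)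
    fix x assume "x \<in> A'"
    then show "\<psi> x \<noteq> 0" unfolding A'_def using \<psi> nz r by auto
    fix y assume "y \<in> A'"
    from \<open>x \<in> A'\<close> \<open>y \<in> A'\<close> obtain a n b l where ab: "a \<in> A" "b \<in> A"
      "x = (\<lambda>i. a i + n * e i)" "y = (\<lambda>i. b i + l * e i)"
      unfolding A'_def by blast
    have "(\<lambda>i. x i + y i) = (\<lambda>i. (a i + b i) + (n + l) * e i)" using ab by (auto simp: algebra_simps)
    then have "\<psi> (\<lambda>i. x i + y i) = \<phi> (\<lambda>i. a i + b i) * r powi (n + l)"
      using \<psi>[OF D(3)[OF ab(1,2)]] by simp
    then show "\<psi> (\<lambda>i. x i + y i) = \<psi> x * \<psi> y"
      using \<psi> ab add r by (simp add: power_int_add)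
  qed
  moreover have "a \<in> A' \<and> \<psi> a = \<phi> a" if "a \<in> A" for a
    using \<psi>[OF that, of 0] that unfolding A'_def by (auto intro!: exI[of _ a] exI[of _ 0])
  moreover have "e \<in> A'" unfolding A'_def
    using D(1) by (intro CollectI exI[of _ "\<lambda>_. 0"] exI[of _ 1]) simp
  moreover have "\<psi> e = r" using \<psi>[OF D(1), of 1] lattice_homD(1)[OF A h] by simp
  ultimately show thesis by (intro that[of A' \<psi>]) auto
qed

lemma multiples_in_subgroup:
  assumes "lattice_subgroup A"
  obtains d where "d \<ge> 0" "{n. (\<lambda>i. n * e i) \<in> A} = {n. d dvd n}"
proof (rule int_subgroup_generator[of "{n. (\<lambda>i. n * e i) \<in> A}"])
  note D = lattice_subgroupD[OF assms]
  show "0 \<in> {n. (\<lambda>i. n * e i) \<in> A}" using D(1) by simp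
  show "a - b \<in> {n. (\<lambda>i. n * e i) \<in> A}"
    if "a \<in> {n. (\<lambda>i. n * e i) \<in> A}" "b \<in> {n. (\<lambda>i. n * e i) \<in> A}" for a b
    using D(2)[of "\<lambda>i. a * e i" "\<lambda>i. b * e i"] that by (simp add: algebra_simps)
qed (rule that)

text \<open>
  If \<open>d e\<close> generates the multiples of \<open>e\<close> in \<open>A\<close>, any \<open>d\<close>-th root of the value at \<open>d e\<close> will do; this is
  where divisibility of the target enters.
\<close>

lemma divisible_extension_value:
  assumes A: "lattice_subgroup A" and h: "lattice_hom A \<phi>"
  obtains r where "r \<noteq> 0" "\<And>n. (\<lambda>i. n * e i) \<in> A \<Longrightarrow> \<phi> (\<lambda>i. n * e i) = r powi n"
proof -
  obtain d where d: "d \<ge> 0" "{n. (\<lambda>i. n * e i) \<in> A} = {n. d dvd n}"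
    using multiples_in_subgroup[OF A] .
  show thesis
  proof (cases "d = 0")
    case True
    show thesis
    proof (rule that[of 1])
      fix n assume "(\<lambda>i. n * e i) \<in> A"
      then have "n \<in> {n. (\<lambda>i. n * e i) \<in> A}" by simp
      then have "n = 0" unfolding d(2) using True by simp
      then show "\<phi> (\<lambda>i. n * e i) = 1 powi n" using lattice_homD(1)[OF A h] by simp
    qed simp
  next
    case False
    let ?a = "\<lambda>i. d * e i"
    have "d \<in> {n. (\<lambda>i. n * e i) \<in> A}" unfolding d(2) by simp
    then have a: "?a \<in> A" by simp
    then have a0: "\<phi> ?a \<noteq> 0" using h unfolding lattice_hom_def by blast
    define r where "r = exp (Ln (\<phi> ?a) / of_int d)"
    have "r ^ nat d = exp (of_nat (nat d) * (Ln (\<phi> ?a) / of_int d))"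
      unfolding r_def by (rule exp_of_nat_mult[symmetric])
    also have "of_nat (nat d) * (Ln (\<phi> ?a) / of_int d) = Ln (\<phi> ?a)" using d(1) False by simp
    finally have rd: "r powi d = \<phi> ?a" using d(1) a0 by (simp add: power_int_def)
    show thesis
    proof (rule that[of r])
      show "r \<noteq> 0" by (simp add: r_def)
      fix n assume "(\<lambda>i. n * e i) \<in> A"
      then have "n \<in> {n. (\<lambda>i. n * e i) \<in> A}" by simp
      then obtain l where n: "n = d * l" unfolding d(2) by (auto elim: dvdE)
      then have "\<phi> (\<lambda>i. n * e i) = \<phi> (\<lambda>i. l * ?a i)" by (simp add: ac_simps)
      also have "\<dots> = (r powi d) powi l" unfolding lattice_homD(2)[OF A h a] rd ..
      also have "\<dots> = r powi n" by (simp add: n power_int_mult)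
      finally show "\<phi> (\<lambda>i. n * e i) = r powi n" .
    qed
  qed
qed

text \<open>
  The class of \<open>m\<close> modulo \<open>A\<close> generates a nontrivial cyclic group, which has a nontrivial character.
\<close>

lemma separating_value:
  assumes A: "lattice_subgroup A" and m: "m \<notin> A"
  obtains r :: complex where "r \<noteq> 0" "r \<noteq> 1" "\<And>n. (\<lambda>i. n * m i) \<in> A \<Longrightarrow> r powi n = 1"
proof -
  obtain d where d: "d \<ge> 0" "{n. (\<lambda>i. n * m i) \<in> A} = {n. d dvd n}"
    using multiples_in_subgroup[OF A] .
  have "d \<noteq> 1"
  proof
    assume "d = 1"
    then have "1 \<in> {n. (\<lambda>i. n * m i) \<in> A}" unfolding d(2) by simp
    with m show False by simp
  qed
  show thesis
  proof (cases "d = 0")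
    case True
    show thesis
    proof (rule that[of 2])
      fix n assume "(\<lambda>i. n * m i) \<in> A"
      then have "n \<in> {n. (\<lambda>i. n * m i) \<in> A}" by simp
      then show "(2::complex) powi n = 1" unfolding d(2) using True by simp
    qed auto
  next
    case False
    with d(1) \<open>d \<noteq> 1\<close> have d2: "nat d > 1" by simp
    define r where "r = cis (2 * pi / nat d)"
    have rd: "r ^ nat d = 1" unfolding r_def Complex.DeMoivre using d2 by simp
    show thesis
    proof (rule that[of r])
      show "r \<noteq> 0" by (simp add: r_def)
      show "r \<noteq> 1"
      proof
        assume "r = 1"
        then have "cis (2 * pi * real 1 / real (nat d)) = cis (2 * pi * real 0 / real (nat d))" by (simp add: r_def)
        moreover have "inj_on (\<lambda>k. cis (2 * pi * real k / real (nat d))) {..<nat d}"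
          using Complex.bij_betw_roots_unity[of "nat d"] d2 by (simp add: bij_betw_def)
        ultimately show False using d2 by (auto dest!: inj_onD[of _ _ 1 0])
      qed
      fix n assume "(\<lambda>i. n * m i) \<in> A"
      then have "n \<in> {n. (\<lambda>i. n * m i) \<in> A}" by simp
      then obtain l where n: "n = d * l" unfolding d(2) by (auto elim: dvdE)
      have "r powi n = (r powi d) powi l" by (simp add: n power_int_mult)
      also have "r powi d = 1" using rd d(1) by (simp add: power_int_def)
      finally show "r powi n = 1" by simp
    qed
  qed
qed

text \<open>
  A character of \<open>A + \<int> m\<close> that is trivial on \<open>A\<close> but not at \<open>m\<close> extends to the whole lattice, one unit
  vector at a time; its values at the unit vectors are the coordinates of the point sought.
\<close>

lemma torus_points_separate_lattice:
  assumes A: "lattice_subgroup A" and m: "m \<notin> A" and supp: "\<And>a i. a \<in> insert m A \<Longrightarrow> i \<ge> k \<Longrightarrow> a i = 0"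
  obtains x where "x \<in> torus_points k" "\<And>a. a \<in> A \<Longrightarrow> (\<Prod>i<k. x i powi a i) = 1"
    "(\<Prod>i<k. x i powi m i) \<noteq> 1"
proof -
  obtain r :: complex where r: "r \<noteq> 0" "r \<noteq> 1" "\<And>n. (\<lambda>i. n * m i) \<in> A \<Longrightarrow> r powi n = 1"
    using separating_value[OF A m] by blast
  obtain A1 \<phi>1 where A1: "lattice_subgroup A1" "lattice_hom A1 \<phi>1" "A \<subseteq> A1" "m \<in> A1"
    "\<And>a. a \<in> A \<Longrightarrow> \<phi>1 a = 1" "\<phi>1 m = r"
    by (rule lattice_hom_extend[OF A, of "\<lambda>_. 1" r m]) (use r in \<open>auto simp: lattice_hom_def\<close>)
  define e :: "nat \<Rightarrow> nat \<Rightarrow> int" where "e j = (\<lambda>i. if i = j then 1 else 0)" for j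
  have "\<exists>A' \<phi>. lattice_subgroup A' \<and> lattice_hom A' \<phi> \<and> A1 \<subseteq> A' \<and> (\<forall>a\<in>A1. \<phi> a = \<phi>1 a) \<and> (\<forall>i<j. e i \<in> A')" for j
  proof (induction j)
    case 0
    then show ?case using A1 by blast
  next
    case (Suc j)
    then obtain A' \<phi> where A': "lattice_subgroup A'" "lattice_hom A' \<phi>" "A1 \<subseteq> A'" "\<forall>a\<in>A1. \<phi> a = \<phi>1 a"
      "\<forall>i<j. e i \<in> A'" by blast
    obtain s where s: "s \<noteq> 0" "\<And>n. (\<lambda>i. n * e j i) \<in> A' \<Longrightarrow> \<phi> (\<lambda>i. n * e j i) = s powi n"
      using divisible_extension_value[OF A'(1,2)] by blast
    obtain A'' \<psi> where A'': "lattice_subgroup A''" "lattice_hom A'' \<psi>" "A' \<subseteq> A''" "e j \<in> A''"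
      "\<And>a. a \<in> A' \<Longrightarrow> \<psi> a = \<phi> a"
      by (rule lattice_hom_extend[OF A'(1,2) s]) auto
    then show ?case using A' by (intro exI[of _ A''] exI[of _ \<psi>]) (auto simp: less_Suc_eq)
  qed
  from this[of k] obtain A' \<phi> where A': "lattice_subgroup A'" "lattice_hom A' \<phi>" "A1 \<subseteq> A'"
    "\<forall>a\<in>A1. \<phi> a = \<phi>1 a" "\<forall>i<k. e i \<in> A'" by blast
  define x where "x i = (if i < k then \<phi> (e i) else 1)" for i
  have prod: "(\<Prod>i<k. x i powi a i) = \<phi> a" if "\<And>i. i \<ge> k \<Longrightarrow> a i = 0" for a
  proof -
    have "j \<le> k \<Longrightarrow> (\<lambda>i. if i < j then a i else 0) \<in> A' \<and>
      \<phi> (\<lambda>i. if i < j then a i else 0) = (\<Prod>i<j. x i powi a i)" for j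
    proof (induction j)
      case 0
      then show ?case using lattice_homD(1)[OF A'(1,2)] lattice_subgroupD(1)[OF A'(1)] by simp
    next
      case (Suc j)
      then have IH: "(\<lambda>i. if i < j then a i else 0) \<in> A'"
        "\<phi> (\<lambda>i. if i < j then a i else 0) = (\<Prod>i<j. x i powi a i)" and j: "j < k" by auto
      have ej: "e j \<in> A'" using A'(5) j by blast
      have ej': "(\<lambda>i. a j * e j i) \<in> A'" using lattice_subgroupD(4)[OF A'(1) ej] .
      have eq: "(\<lambda>i. if i < Suc j then a i else 0) = (\<lambda>i. (if i < j then a i else 0) + a j * e j i)"
        by (auto simp: e_def less_Suc_eq)
      have "\<phi> (\<lambda>i. (if i < j then a i else 0) + a j * e j i) = (\<Prod>i<j. x i powi a i) * \<phi> (e j) powi a j"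
        using A'(2) IH ej' lattice_homD(2)[OF A'(1,2) ej] unfolding lattice_hom_def by metis
      then show ?case unfolding eq using lattice_subgroupD(3)[OF A'(1) IH(1) ej'] j by (simp add: x_def)
    qed
    moreover have "(\<lambda>i. if i < k then a i else 0) = a" using that by auto
    ultimately show ?thesis by (metis order_refl)
  qed
  show thesis
  proof (rule that[of x])
    show "x \<in> torus_points k"
      using A'(2,5) unfolding torus_points_def x_def lattice_hom_def by auto
    show "(\<Prod>i<k. x i powi a i) = 1" if "a \<in> A" for a
      using prod[of a] supp[of a] that A1(3,5) A'(4) by auto
    show "(\<Prod>i<k. x i powi m i) \<noteq> 1"
      using prod[of m] supp[of m] A1(4,6) A'(4) r(2) by auto
  qed
qed

text \<open>
  Dividing \<open>h\<close> by a suitable power of \<open>w\<close> gives \<open>h'\<close>, again multiplicative, with a finite nonzero limit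
  \<open>c\<close> at \<open>0\<close>.  Letting \<open>w\<close> tend to \<open>0\<close> in \<open>h' (u w) = h' u h' w\<close> gives \<open>c = h' u c\<close>, so \<open>h'\<close> is
  constantly \<open>1\<close>.
\<close>

lemma rational_multiplicative_is_power:
  fixes h :: "complex \<Rightarrow> complex" and p q r :: "complex poly"
  assumes nz: "\<And>w. w \<noteq> 0 \<Longrightarrow> h w \<noteq> 0" and hom: "\<And>v w. v \<noteq> 0 \<Longrightarrow> w \<noteq> 0 \<Longrightarrow> h (v * w) = h v * h w"
    and r: "poly r 1 \<noteq> 0"
    and frac: "\<And>w. w \<noteq> 0 \<Longrightarrow> poly r w \<noteq> 0 \<Longrightarrow> poly q w \<noteq> 0 \<and> h w = poly p w / poly q w"
  obtains n :: int where "\<And>w. w \<noteq> 0 \<Longrightarrow> h w = w powi n"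
proof -
  have "poly q 1 \<noteq> 0" "poly p 1 \<noteq> 0" using frac[of 1] r nz[of 1] by auto
  then have pq: "p \<noteq> 0" "q \<noteq> 0" "r \<noteq> 0" using r by auto
  obtain p0 where p0: "p = [:0, 1:] ^ Polynomial.order 0 p * p0" "poly p0 0 \<noteq> 0"
    using Polynomial.order_decomp[OF pq(1), of 0] by (auto simp: poly_eq_0_iff_dvd)
  obtain q0 where q0: "q = [:0, 1:] ^ Polynomial.order 0 q * q0" "poly q0 0 \<noteq> 0"
    using Polynomial.order_decomp[OF pq(2), of 0] by (auto simp: poly_eq_0_iff_dvd)
  define n where "n = int (Polynomial.order 0 p) - int (Polynomial.order 0 q)"
  define h' where "h' w = h w / w powi n" for w
  have h'_eq: "h' w = poly p0 w / poly q0 w" if "w \<noteq> 0" "poly r w \<noteq> 0" for w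
  proof -
    have "h w = (w ^ Polynomial.order 0 p * poly p0 w) / (w ^ Polynomial.order 0 q * poly q0 w)"
      using frac[OF that] by (subst (asm) p0(1), subst (asm) q0(1)) (simp add: poly_mult poly_power)
    also have "\<dots> = w powi n * (poly p0 w / poly q0 w)"
      using that(1) by (simp add: n_def power_int_diff)
    finally show ?thesis using that(1) by (simp add: h'_def)
  qed
  define c where "c = poly p0 0 / poly q0 0"
  have c0: "c \<noteq> 0" using p0 q0 by (simp add: c_def)
  have lim: "(h' \<longlongrightarrow> c) (at 0)"
  proof (rule Lim_transform_eventually)
    show "((\<lambda>w. poly p0 w / poly q0 w) \<longlongrightarrow> c) (at 0)"
      unfolding c_def using q0(2) by (intro tendsto_intros) auto
    have "open (- ({w. poly r w = 0} - {0}))"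
      using poly_roots_finite[OF pq(3)] by (intro open_Compl finite_imp_closed) auto
    then show "\<forall>\<^sub>F w in at 0. poly p0 w / poly q0 w = h' w"
      unfolding eventually_at_topological using h'_eq by (intro exI[of _ "- ({w. poly r w = 0} - {0})"]) auto
  qed
  have "h' u = 1" if u: "u \<noteq> 0" for u
  proof -
    have "filterlim (\<lambda>w. u * w) (at 0) (at 0)"
    proof (rule filterlim_atI)
      show "((\<lambda>w. u * w) \<longlongrightarrow> 0) (at 0)" by (rule tendsto_eq_intros refl)+ simp
      show "\<forall>\<^sub>F w in at 0. u * w \<noteq> 0" using u by (auto simp: eventually_at intro!: exI[of _ 1])
    qed
    then have "((\<lambda>w. h' (u * w)) \<longlongrightarrow> c) (at 0)" by (rule filterlim_compose[OF lim])
    moreover have "\<forall>\<^sub>F w in at 0. h' (u * w) = h' u * h' w"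
      using u hom by (auto simp: eventually_at h'_def power_int_mult_distrib intro!: exI[of _ 1])
    ultimately have "((\<lambda>w. h' u * h' w) \<longlongrightarrow> c) (at 0)" by (rule Lim_transform_eventually)
    moreover have "((\<lambda>w. h' u * h' w) \<longlongrightarrow> h' u * c) (at 0)" by (intro tendsto_intros lim)
    ultimately have "c = h' u * c" using LIM_unique by blast
    then show ?thesis using c0 by simp
  qed
  then show thesis by (intro that[of n]) (simp add: h'_def field_simps)
qed

text \<open>
  A regular character is a power on each coordinate line through the identity, and the torus is the
  product of these lines.
\<close>

lemma torus_character_monomial:
  assumes h: "h \<in> rg (std_torus k) (torus_points k)"
    and nz: "\<And>x. x \<in> torus_points k \<Longrightarrow> h x \<noteq> 0"
    and hom: "\<And>x y. x \<in> torus_points k \<Longrightarrow> y \<in> torus_points k \<Longrightarrow> h (\<lambda>i. x i * y i) = h x * h y"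
  obtains m :: "nat \<Rightarrow> int" where "\<And>i. i \<ge> k \<Longrightarrow> m i = 0"
    "\<And>x. x \<in> torus_points k \<Longrightarrow> h x = (\<Prod>i<k. x i powi m i)"
proof -
  let ?one = "\<lambda>_::nat. 1::complex"
  have one: "?one \<in> torus_points k" by (simp add: torus_points_def)
  have "\<exists>n::int. \<forall>w. w \<noteq> 0 \<longrightarrow> h (?one(i := w)) = w powi n" if i: "i < k" for i
  proof -
    have pt: "?one(i := w) \<in> torus_points k" if "w \<noteq> 0" for w using that i by (auto simp: torus_points_def)
    obtain V p q where p: "p \<in> fun_algebra {\<lambda>x. x i | i. i < k}" and q: "q \<in> fun_algebra {\<lambda>x. x i | i. i < k}"
      and V: "openin (tp (std_torus k)) V" "?one \<in> V"
      and frac: "\<forall>y\<in>V. q y \<noteq> 0 \<and> h y = p y / q y"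
      using h one unfolding std_torus_eq rg_zariski mem_Collect_eq by meson
    obtain r where r: "r \<in> fun_algebra {\<lambda>x. x i | i. i < k}" "r ?one \<noteq> 0" "{y \<in> torus_points k. r y \<noteq> 0} \<subseteq> V"
      using V unfolding std_torus_eq by (rule openin_zariskiE)
    obtain p' where p': "\<And>w. p (?one(i := w)) = poly p' w" using fun_algebra_coordinate_poly[OF p, of ?one i] by blast
    obtain q' where q': "\<And>w. q (?one(i := w)) = poly q' w" using fun_algebra_coordinate_poly[OF q, of ?one i] by blast
    obtain r' where r': "\<And>w. r (?one(i := w)) = poly r' w" using fun_algebra_coordinate_poly[OF r(1), of ?one i] by blast
    have "poly r' 1 \<noteq> 0" using r(2) r'[of 1] by (simp add: fun_upd_idem)
    moreover have "poly q' w \<noteq> 0 \<and> h (?one(i := w)) = poly p' w / poly q' w" if "w \<noteq> 0" "poly r' w \<noteq> 0" for w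
    proof -
      have "?one(i := w) \<in> V" using r(3) r' that pt[of w] by auto
      then show ?thesis using frac p' q' by metis
    qed
    moreover have "h (?one(i := v * w)) = h (?one(i := v)) * h (?one(i := w))" if "v \<noteq> 0" "w \<noteq> 0" for v w
    proof -
      have "(\<lambda>l. (?one(i := v)) l * (?one(i := w)) l) = ?one(i := v * w)" by auto
      then show ?thesis using hom[OF pt[OF that(1)] pt[OF that(2)]] by simp
    qed
    moreover have "h (?one(i := w)) \<noteq> 0" if "w \<noteq> 0" for w using nz pt that by blast
    ultimately obtain n :: int where "\<And>w. w \<noteq> 0 \<Longrightarrow> h (?one(i := w)) = w powi n"
      using rational_multiplicative_is_power[of "\<lambda>w. h (?one(i := w))" r' q' p'] by blast
    then show ?thesis by blast
  qed
  then obtain m0 :: "nat \<Rightarrow> int" where m0: "\<And>i w. i < k \<Longrightarrow> w \<noteq> 0 \<Longrightarrow> h (?one(i := w)) = w powi m0 i" by metis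
  define m where "m i = (if i < k then m0 i else 0)" for i
  show thesis
  proof (rule that[of m])
    fix x assume x: "x \<in> torus_points k"
    have "j \<le> k \<Longrightarrow> h (\<lambda>i. if i < j then x i else 1) = (\<Prod>i<j. x i powi m i)" for j
    proof (induction j)
      case 0
      have "h ?one * h ?one = h ?one" using hom[OF one one] by simp
      then show ?case using nz[OF one] by simp
    next
      case (Suc j)
      have eq: "(\<lambda>i. if i < Suc j then x i else 1) = (\<lambda>i. (if i < j then x i else 1) * (?one(j := x j)) i)"
        by (auto simp: less_Suc_eq)
      have IH: "h (\<lambda>i. if i < j then x i else 1) = (\<Prod>i<j. x i powi m i)" using Suc by simp
      have "(\<lambda>i. if i < j then x i else 1) \<in> torus_points k" "?one(j := x j) \<in> torus_points k"
        using x Suc.prems by (auto simp: torus_points_def)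
      then have "h (\<lambda>i. if i < Suc j then x i else 1) = (\<Prod>i<j. x i powi m i) * h (?one(j := x j))"
        unfolding eq IH[symmetric] by (rule hom)
      moreover have "x j \<noteq> 0" using x by (simp add: torus_points_def)
      ultimately show ?case using m0[of j "x j"] Suc.prems by (simp add: m_def)
    qed
    moreover have "(\<lambda>i. if i < k then x i else 1) = x" using x by (auto simp: torus_points_def)
    ultimately show "h x = (\<Prod>i<k. x i powi m i)" by (metis order_refl)
  qed (simp add: m_def)
qed

lemma char_group_simps [simp]:
  "carrier (char_group T) = characters T" "\<theta> \<otimes>\<^bsub>char_group T\<^esub> \<psi> = restrict (\<lambda>t. \<theta> t * \<psi> t) T"
  "\<one>\<^bsub>char_group T\<^esub> = restrict (\<lambda>_. 1) T"
  by (simp_all add: char_group_def)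

lemma charactersD:
  assumes "\<theta> \<in> characters T"
  shows "\<theta> \<in> extensional T" "\<theta> \<in> rg (alg T) T" "\<And>t. t \<in> T \<Longrightarrow> \<theta> t \<noteq> 0"
    "\<And>s t. s \<in> T \<Longrightarrow> t \<in> T \<Longrightarrow> \<theta> (s ** t) = \<theta> s * \<theta> t"
  using assms by (auto simp: characters_def)

text \<open>
  The open sets in the definition of regular functions may be taken to be basic, which makes products
  and inverses of characters computations with polynomials.
\<close>

lemma rg_alg_locally_fraction:
  "f \<in> rg (alg T) T \<longleftrightarrow> (\<forall>x\<in>T. \<exists>r p q. r \<in> fun_algebra mat_coords \<and> p \<in> fun_algebra mat_coords \<and>
     q \<in> fun_algebra mat_coords \<and> r x \<noteq> 0 \<and> (\<forall>y\<in>T. r y \<noteq> 0 \<longrightarrow> q y \<noteq> 0 \<and> f y = p y / q y))"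
proof
  assume f: "f \<in> rg (alg T) T"
  show "\<forall>x\<in>T. \<exists>r p q. r \<in> fun_algebra mat_coords \<and> p \<in> fun_algebra mat_coords \<and>
     q \<in> fun_algebra mat_coords \<and> r x \<noteq> 0 \<and> (\<forall>y\<in>T. r y \<noteq> 0 \<longrightarrow> q y \<noteq> 0 \<and> f y = p y / q y)"
  proof
    fix x assume "x \<in> T"
    then obtain V p q where p: "p \<in> fun_algebra mat_coords" "q \<in> fun_algebra mat_coords"
      and V: "openin (tp (zariski T mat_coords)) V" "x \<in> V" "\<forall>y\<in>V. q y \<noteq> 0 \<and> f y = p y / q y"
      using f unfolding alg_def rg_zariski mem_Collect_eq by meson
    obtain r where "r \<in> fun_algebra mat_coords" "r x \<noteq> 0" "{y \<in> T. r y \<noteq> 0} \<subseteq> V"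
      using V(1,2) by (rule openin_zariskiE)
    then show "\<exists>r p q. r \<in> fun_algebra mat_coords \<and> p \<in> fun_algebra mat_coords \<and>
     q \<in> fun_algebra mat_coords \<and> r x \<noteq> 0 \<and> (\<forall>y\<in>T. r y \<noteq> 0 \<longrightarrow> q y \<noteq> 0 \<and> f y = p y / q y)"
      using p V(3) by (intro exI[of _ r] exI[of _ p] exI[of _ q]) blast
  qed
next
  assume R: "\<forall>x\<in>T. \<exists>r p q. r \<in> fun_algebra mat_coords \<and> p \<in> fun_algebra mat_coords \<and>
     q \<in> fun_algebra mat_coords \<and> r x \<noteq> 0 \<and> (\<forall>y\<in>T. r y \<noteq> 0 \<longrightarrow> q y \<noteq> 0 \<and> f y = p y / q y)"
  show "f \<in> rg (alg T) T"
    unfolding alg_def rg_zariski mem_Collect_eq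
  proof
    fix x assume "x \<in> T"
    then obtain r p q where r: "r \<in> fun_algebra mat_coords" "p \<in> fun_algebra mat_coords"
      "q \<in> fun_algebra mat_coords" "r x \<noteq> 0" "\<forall>y\<in>T. r y \<noteq> 0 \<longrightarrow> q y \<noteq> 0 \<and> f y = p y / q y"
      using R by blast
    then show "\<exists>V p q. p \<in> fun_algebra mat_coords \<and> q \<in> fun_algebra mat_coords \<and>
     openin (tp (zariski T mat_coords)) V \<and> x \<in> V \<and> V \<subseteq> T \<and> V \<subseteq> T \<and> (\<forall>y\<in>V. q y \<noteq> 0 \<and> f y = p y / q y)"
      using openin_zariski_basic[OF r(1), of T] \<open>x \<in> T\<close>
      by (intro exI[of _ "{y \<in> T. r y \<noteq> 0}"] exI[of _ p] exI[of _ q]) auto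
  qed
qed

lemma characters_mult:
  assumes T: "subgroup T GLn" and a: "\<theta> \<in> characters T" and b: "\<psi> \<in> characters T"
  shows "restrict (\<lambda>t. \<theta> t * \<psi> t) T \<in> characters T"
proof -
  have "restrict (\<lambda>t. \<theta> t * \<psi> t) T \<in> rg (alg T) T"
    unfolding rg_alg_locally_fraction
  proof
    fix x assume x: "x \<in> T"
    obtain r p q where 1: "r \<in> fun_algebra mat_coords" "p \<in> fun_algebra mat_coords"
      "q \<in> fun_algebra mat_coords" "r x \<noteq> 0" "\<forall>y\<in>T. r y \<noteq> 0 \<longrightarrow> q y \<noteq> 0 \<and> \<theta> y = p y / q y"
      using charactersD(2)[OF a] x unfolding rg_alg_locally_fraction by blast
    obtain r' p' q' where 2: "r' \<in> fun_algebra mat_coords" "p' \<in> fun_algebra mat_coords"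
      "q' \<in> fun_algebra mat_coords" "r' x \<noteq> 0" "\<forall>y\<in>T. r' y \<noteq> 0 \<longrightarrow> q' y \<noteq> 0 \<and> \<psi> y = p' y / q' y"
      using charactersD(2)[OF b] x unfolding rg_alg_locally_fraction by blast
    show "\<exists>r p q. r \<in> fun_algebra mat_coords \<and> p \<in> fun_algebra mat_coords \<and>
       q \<in> fun_algebra mat_coords \<and> r x \<noteq> 0 \<and>
       (\<forall>y\<in>T. r y \<noteq> 0 \<longrightarrow> q y \<noteq> 0 \<and> restrict (\<lambda>t. \<theta> t * \<psi> t) T y = p y / q y)"
      using 1 2 by (intro exI[of _ "\<lambda>y. r y * r' y"] exI[of _ "\<lambda>y. p y * p' y"] exI[of _ "\<lambda>y. q y * q' y"])
        (simp add: fun_algebra.mult)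
  qed
  then show ?thesis
    using charactersD(3,4)[OF a] charactersD(3,4)[OF b] subgroup_GLnD(2)[OF T]
    by (simp add: characters_def)
qed

lemma characters_inverse:
  assumes T: "subgroup T GLn" and a: "\<theta> \<in> characters T"
  shows "restrict (\<lambda>t. inverse (\<theta> t)) T \<in> characters T"
proof -
  have "restrict (\<lambda>t. inverse (\<theta> t)) T \<in> rg (alg T) T"
    unfolding rg_alg_locally_fraction
  proof
    fix x assume x: "x \<in> T"
    obtain r p q where 1: "r \<in> fun_algebra mat_coords" "p \<in> fun_algebra mat_coords"
      "q \<in> fun_algebra mat_coords" "r x \<noteq> 0" "\<forall>y\<in>T. r y \<noteq> 0 \<longrightarrow> q y \<noteq> 0 \<and> \<theta> y = p y / q y"
      using charactersD(2)[OF a] x unfolding rg_alg_locally_fraction by blast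
    have "\<forall>y\<in>T. r y \<noteq> 0 \<longrightarrow> p y \<noteq> 0 \<and> restrict (\<lambda>t. inverse (\<theta> t)) T y = q y / p y"
    proof (intro ballI impI)
      fix y assume "y \<in> T" "r y \<noteq> 0"
      with 1(5) charactersD(3)[OF a] have "\<theta> y = p y / q y" "\<theta> y \<noteq> 0" by auto
      then show "p y \<noteq> 0 \<and> restrict (\<lambda>t. inverse (\<theta> t)) T y = q y / p y"
        using \<open>y \<in> T\<close> by auto
    qed
    then show "\<exists>r p q. r \<in> fun_algebra mat_coords \<and> p \<in> fun_algebra mat_coords \<and>
       q \<in> fun_algebra mat_coords \<and> r x \<noteq> 0 \<and>
       (\<forall>y\<in>T. r y \<noteq> 0 \<longrightarrow> q y \<noteq> 0 \<and> restrict (\<lambda>t. inverse (\<theta> t)) T y = p y / q y)"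
      using 1 by blast
  qed
  then show ?thesis
    using charactersD(3,4)[OF a] subgroup_GLnD(2)[OF T] by (simp add: characters_def)
qed

lemma group_char_group:
  fixes T :: "(complex^'n^'n) set"
  assumes T: "subgroup T GLn"
  shows "group (char_group T)"
proof (rule groupI)
  have "restrict (\<lambda>_. 1) T \<in> rg (alg T) T"
    unfolding rg_alg_locally_fraction
    by (intro ballI exI[of _ "\<lambda>_. 1"]) (simp add: fun_algebra.const)
  then show "\<one>\<^bsub>char_group T\<^esub> \<in> carrier (char_group T)"
    using subgroup_GLnD(2)[OF T] by (simp add: characters_def)
  fix \<theta> assume \<theta>: "\<theta> \<in> carrier (char_group T)"
  then show "\<one>\<^bsub>char_group T\<^esub> \<otimes>\<^bsub>char_group T\<^esub> \<theta> = \<theta>"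
    using charactersD(1)[of \<theta> T] by (auto simp: extensional_def restrict_def)
  have "restrict (\<lambda>t. restrict (\<lambda>t. inverse (\<theta> t)) T t * \<theta> t) T = restrict (\<lambda>_. 1) T"
    using charactersD(3)[of \<theta> T] \<theta> by (auto simp: restrict_def)
  then show "\<exists>y\<in>carrier (char_group T). y \<otimes>\<^bsub>char_group T\<^esub> \<theta> = \<one>\<^bsub>char_group T\<^esub>"
    using characters_inverse[OF T] \<theta> by (intro bexI[of _ "restrict (\<lambda>t. inverse (\<theta> t)) T"]) auto
  fix \<psi> assume \<psi>: "\<psi> \<in> carrier (char_group T)"
  show "\<theta> \<otimes>\<^bsub>char_group T\<^esub> \<psi> \<in> carrier (char_group T)"
    using characters_mult[OF T] \<theta> \<psi> by simp
qed (auto simp: restrict_def mult.assoc)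

lemma inv_char_group:
  assumes T: "subgroup T GLn" and a: "\<theta> \<in> characters T"
  shows "inv\<^bsub>char_group T\<^esub> \<theta> = restrict (\<lambda>t. inverse (\<theta> t)) T"
proof (rule group.inv_equality[OF group_char_group[OF T]])
  show "restrict (\<lambda>t. inverse (\<theta> t)) T \<otimes>\<^bsub>char_group T\<^esub> \<theta> = \<one>\<^bsub>char_group T\<^esub>"
    using charactersD(3)[OF a] by (auto simp: restrict_def)
qed (use characters_inverse[OF T a] a in simp_all)

text \<open>
  Duality between subgroups of the character group and closed subgroups of the torus: if the exponent
  vector of \<open>\<xi>\<close> were not among those of the subgroup generated by \<open>R\<close>, some point of the torus would be
  killed by all of \<open>R\<close> but not by \<open>\<xi>\<close>.
\<close>

lemma character_in_generated_lattice:
  fixes T :: "(complex^'n^'n) set"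
  assumes torus: "torus T" and R: "R \<subseteq> characters T" and \<xi>: "\<xi> \<in> characters T"
    and triv: "\<And>t. t \<in> T \<Longrightarrow> (\<And>\<alpha>. \<alpha> \<in> R \<Longrightarrow> \<alpha> t = 1) \<Longrightarrow> \<xi> t = 1"
  shows "\<xi> \<in> generate (char_group T) R"
proof -
  obtain k f g where T: "subgroup T GLn" and f: "regular_map (alg T) (std_torus k) f"
    and g: "regular_map (std_torus k) (alg T) g"
    and fT: "\<And>t. t \<in> T \<Longrightarrow> f t \<in> torus_points k" and gT: "\<And>x. x \<in> torus_points k \<Longrightarrow> g x \<in> T"
    and gf: "\<And>t. t \<in> T \<Longrightarrow> g (f t) = t" and fg: "\<And>x. x \<in> torus_points k \<Longrightarrow> f (g x) = x"
    and hom: "\<And>s t. s \<in> T \<Longrightarrow> t \<in> T \<Longrightarrow> f (s ** t) = (\<lambda>i. f s i * f t i)"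
    using torus by (rule torusE) blast
  interpret X: group "char_group T" by (rule group_char_group[OF T])
  have g_hom: "g (\<lambda>i. x i * y i) = g x ** g y" if "x \<in> torus_points k" "y \<in> torus_points k" for x y
    using hom[OF gT[OF that(1)] gT[OF that(2)]] fg that gf[OF subgroup_GLnD(2)[OF T gT[OF that(1)] gT[OF that(2)]]]
    by simp
  have monomial: "\<exists>m. (\<forall>i\<ge>k. m i = 0) \<and> (\<forall>x\<in>torus_points k. \<theta> (g x) = (\<Prod>i<k. x i powi m i))"
    if \<theta>: "\<theta> \<in> characters T" for \<theta>
  proof -
    have "openin (tp (alg T)) T" by (metis openin_topspace pts_alg pts_def)
    then have "\<theta> \<circ> g \<in> rg (std_torus k) {x \<in> pts (std_torus k). g x \<in> T}"
      using g charactersD(2)[OF \<theta>] unfolding regular_map_def by blast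
    also have "{x \<in> pts (std_torus k). g x \<in> T} = torus_points k" using gT by (auto simp: std_torus_eq)
    finally obtain m :: "nat \<Rightarrow> int" where "\<And>i. i \<ge> k \<Longrightarrow> m i = 0"
      "\<And>x. x \<in> torus_points k \<Longrightarrow> (\<theta> \<circ> g) x = (\<Prod>i<k. x i powi m i)"
      by (rule torus_character_monomial) (use charactersD(3,4)[OF \<theta>] gT g_hom in auto)
    then show ?thesis by (intro exI[of _ m]) simp
  qed
  let ?Q = "generate (char_group T) R"
  have Q: "?Q \<subseteq> characters T" using X.generate_incl[of R] R by simp
  define A where "A = {m. (\<forall>i\<ge>k. m i = 0) \<and> (\<exists>\<gamma>\<in>?Q. \<forall>x\<in>torus_points k. \<gamma> (g x) = (\<Prod>i<k. x i powi m i))}"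
  have "lattice_subgroup A"
    unfolding lattice_subgroup_def
  proof (intro conjI ballI)
    show "(\<lambda>_. 0) \<in> A"
      unfolding A_def using generate.one[of "char_group T" R] gT
      by (intro CollectI conjI bexI[of _ "\<one>\<^bsub>char_group T\<^esub>"]) auto
    fix a b assume "a \<in> A" "b \<in> A"
    then obtain \<gamma> \<delta> where \<gamma>: "\<gamma> \<in> ?Q" "\<forall>x\<in>torus_points k. \<gamma> (g x) = (\<Prod>i<k. x i powi a i)" "\<forall>i\<ge>k. a i = 0"
      and \<delta>: "\<delta> \<in> ?Q" "\<forall>x\<in>torus_points k. \<delta> (g x) = (\<Prod>i<k. x i powi b i)" "\<forall>i\<ge>k. b i = 0"
      unfolding A_def by blast
    let ?\<epsilon> = "\<gamma> \<otimes>\<^bsub>char_group T\<^esub> inv\<^bsub>char_group T\<^esub> \<delta>"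
    have "inv\<^bsub>char_group T\<^esub> \<delta> \<in> ?Q" using X.generate_m_inv_closed[of R \<delta>] R \<delta>(1) by simp
    then have "?\<epsilon> \<in> ?Q" by (rule generate.eng[OF \<gamma>(1)])
    moreover have "?\<epsilon> (g x) = (\<Prod>i<k. x i powi (a i - b i))" if "x \<in> torus_points k" for x
    proof -
      have "x i \<noteq> 0" for i using that by (simp add: torus_points_def)
      have "\<delta> \<in> characters T" using Q \<delta>(1) by blast
      then have "?\<epsilon> (g x) = (\<Prod>i<k. x i powi a i) / (\<Prod>i<k. x i powi b i)"
        using that \<gamma>(2) \<delta>(2) gT inv_char_group[OF T] by (simp add: divide_inverse)
      also have "\<dots> = (\<Prod>i<k. x i powi (a i - b i))"
        using \<open>\<And>i. x i \<noteq> 0\<close> by (simp add: power_int_diff prod_dividef)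
      finally show ?thesis .
    qed
    ultimately have "\<exists>\<gamma>\<in>?Q. \<forall>x\<in>torus_points k. \<gamma> (g x) = (\<Prod>i<k. x i powi (a i - b i))" by blast
    then show "(\<lambda>i. a i - b i) \<in> A" unfolding A_def using \<gamma>(3) \<delta>(3) by simp
  qed
  moreover obtain m where m: "\<forall>i\<ge>k. m i = 0" "\<forall>x\<in>torus_points k. \<xi> (g x) = (\<Prod>i<k. x i powi m i)"
    using monomial[OF \<xi>] by blast
  ultimately show ?thesis
  proof (cases "m \<in> A")
    case True
    then obtain \<gamma> where \<gamma>: "\<gamma> \<in> ?Q" "\<forall>x\<in>torus_points k. \<gamma> (g x) = (\<Prod>i<k. x i powi m i)"
      unfolding A_def by blast
    have "\<xi> = \<gamma>"
    proof (rule extensionalityI)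
      show "\<xi> \<in> extensional T" "\<gamma> \<in> extensional T" using charactersD(1) \<xi> \<gamma>(1) Q by auto
      fix t assume "t \<in> T"
      then show "\<xi> t = \<gamma> t" using m(2) \<gamma>(2) fT gf by metis
    qed
    then show ?thesis using \<gamma>(1) by simp
  next
    case False
    assume "lattice_subgroup A"
    then obtain x where x: "x \<in> torus_points k" "\<And>a. a \<in> A \<Longrightarrow> (\<Prod>i<k. x i powi a i) = 1"
      "(\<Prod>i<k. x i powi m i) \<noteq> 1"
      by (rule torus_points_separate_lattice[OF _ False, of k]) (use m(1) in \<open>auto simp: A_def\<close>)
    have "\<alpha> (g x) = 1" if \<alpha>: "\<alpha> \<in> R" for \<alpha>
    proof -
      obtain a where a: "\<forall>i\<ge>k. a i = 0" "\<forall>x\<in>torus_points k. \<alpha> (g x) = (\<Prod>i<k. x i powi a i)"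
        using monomial R \<alpha> by blast
      then have "a \<in> A" unfolding A_def using generate.incl[OF \<alpha>] by blast
      then show ?thesis using a x by simp
    qed
    then have "\<xi> (g x) = 1" using triv gT x(1) by blast
    then show ?thesis using m(2) x by simp
  qed
qed

section \<open>The Lie algebra and its weights\<close>

text \<open>
  A Hadamard expansion: the change of \<open>p\<close> under conjugation by \<open>z\<close> is a combination of the changes of the
  coordinates \<open>Q g P\<close>, with polynomial coefficients whose values at the identity are the partial
  derivatives of \<open>p\<close>.  By the product rule these expansions are stable under multiplication.
\<close>

lemma conjugation_difference:
  fixes p :: "complex^'n^'n \<Rightarrow> complex" and P Q z z' :: "complex^'n^'n"
  assumes PQ: "P ** Q = mat 1" and z: "z ** z' = mat 1" and p: "p \<in> fun_algebra mat_coords"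
  shows "\<exists>e. (\<forall>x. e x \<in> fun_algebra mat_coords) \<and>
    (\<forall>g. p (z ** g ** z') - p g = (\<Sum>x\<in>UNIV. e x g * (Q ** (z ** g ** z' - g) ** P) $ fst x $ snd x)) \<and>
    (\<forall>A. ((\<lambda>s. p (mat 1 + msc s A)) has_field_derivative
       (\<Sum>x\<in>UNIV. e x (mat 1) * (Q ** A ** P) $ fst x $ snd x)) (at 0))"
  using p
proof induction
  case (gen f)
  then obtain i j where f: "f = (\<lambda>A. A $ i $ j)" by (auto simp: mat_coords_def)
  let ?e = "\<lambda>x (g :: complex^'n^'n). P $ i $ fst x * Q $ snd x $ j"
  have "f (z ** g ** z') - f g = (\<Sum>x\<in>UNIV. ?e x g * (Q ** (z ** g ** z' - g) ** P) $ fst x $ snd x)" for g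
    using entry_in_conjugated_coordinates[OF PQ, of "z ** g ** z' - g" i j] by (simp add: f)
  moreover have "((\<lambda>s. f (mat 1 + msc s A)) has_field_derivative
       (\<Sum>x\<in>UNIV. ?e x (mat 1) * (Q ** A ** P) $ fst x $ snd x)) (at 0)" for A
    unfolding entry_in_conjugated_coordinates[OF PQ, of A i j, symmetric] f
    by (auto intro!: derivative_eq_intros)
  ultimately show ?case
    by (intro exI[of _ ?e] conjI allI fun_algebra.const) 
next
  case (const c)
  show ?case
    by (intro exI[of _ "\<lambda>_ _. 0"] conjI allI fun_algebra.const) simp_all
next
  case (add f h)
  from add.IH(1) obtain e where e: "\<And>x. e x \<in> fun_algebra mat_coords"
    "\<And>g. f (z ** g ** z') - f g = (\<Sum>x\<in>UNIV. e x g * (Q ** (z ** g ** z' - g) ** P) $ fst x $ snd x)"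
    "\<And>A. ((\<lambda>s. f (mat 1 + msc s A)) has_field_derivative
       (\<Sum>x\<in>UNIV. e x (mat 1) * (Q ** A ** P) $ fst x $ snd x)) (at 0)" by blast
  from add.IH(2) obtain e' where e': "\<And>x. e' x \<in> fun_algebra mat_coords"
    "\<And>g. h (z ** g ** z') - h g = (\<Sum>x\<in>UNIV. e' x g * (Q ** (z ** g ** z' - g) ** P) $ fst x $ snd x)"
    "\<And>A. ((\<lambda>s. h (mat 1 + msc s A)) has_field_derivative
       (\<Sum>x\<in>UNIV. e' x (mat 1) * (Q ** A ** P) $ fst x $ snd x)) (at 0)" by blast
  show ?case
  proof (intro exI[of _ "\<lambda>x g. e x g + e' x g"] conjI allI)
    show "(\<lambda>g. e x g + e' x g) \<in> fun_algebra mat_coords" for x by (intro fun_algebra.add e e')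
    show "f (z ** g ** z') + h (z ** g ** z') - (f g + h g)
        = (\<Sum>x\<in>UNIV. (e x g + e' x g) * (Q ** (z ** g ** z' - g) ** P) $ fst x $ snd x)" for g
      using e(2)[of g] e'(2)[of g] by (simp add: algebra_simps sum.distrib)
    show "((\<lambda>s. f (mat 1 + msc s A) + h (mat 1 + msc s A)) has_field_derivative
       (\<Sum>x\<in>UNIV. (e x (mat 1) + e' x (mat 1)) * (Q ** A ** P) $ fst x $ snd x)) (at 0)" for A
      using DERIV_add[OF e(3)[of A] e'(3)[of A]] by (simp add: distrib_right sum.distrib)
  qed
next
  case (mult f h)
  from mult.IH(1) obtain e where e: "\<And>x. e x \<in> fun_algebra mat_coords"
    "\<And>g. f (z ** g ** z') - f g = (\<Sum>x\<in>UNIV. e x g * (Q ** (z ** g ** z' - g) ** P) $ fst x $ snd x)"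
    "\<And>A. ((\<lambda>s. f (mat 1 + msc s A)) has_field_derivative
       (\<Sum>x\<in>UNIV. e x (mat 1) * (Q ** A ** P) $ fst x $ snd x)) (at 0)" by blast
  from mult.IH(2) obtain e' where e': "\<And>x. e' x \<in> fun_algebra mat_coords"
    "\<And>g. h (z ** g ** z') - h g = (\<Sum>x\<in>UNIV. e' x g * (Q ** (z ** g ** z' - g) ** P) $ fst x $ snd x)"
    "\<And>A. ((\<lambda>s. h (mat 1 + msc s A)) has_field_derivative
       (\<Sum>x\<in>UNIV. e' x (mat 1) * (Q ** A ** P) $ fst x $ snd x)) (at 0)" by blast
  show ?case
  proof (intro exI[of _ "\<lambda>x g. e x g * h (z ** g ** z') + f g * e' x g"] conjI allI)
    show "(\<lambda>g. e x g * h (z ** g ** z') + f g * e' x g) \<in> fun_algebra mat_coords" for x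
      by (intro fun_algebra.add fun_algebra.mult e e' mult.hyps fun_algebra_translate)
    have "f (z ** g ** z') * h (z ** g ** z') - f g * h g
        = (f (z ** g ** z') - f g) * h (z ** g ** z') + f g * (h (z ** g ** z') - h g)" for g
      by (simp add: algebra_simps)
    then show "f (z ** g ** z') * h (z ** g ** z') - f g * h g
        = (\<Sum>x\<in>UNIV. (e x g * h (z ** g ** z') + f g * e' x g) * (Q ** (z ** g ** z' - g) ** P) $ fst x $ snd x)" for g
      unfolding e(2) e'(2)
      by (simp add: sum_distrib_left sum_distrib_right sum.distrib[symmetric] algebra_simps)
    show "((\<lambda>s. f (mat 1 + msc s A) * h (mat 1 + msc s A)) has_field_derivative
       (\<Sum>x\<in>UNIV. (e x (mat 1) * h (z ** mat 1 ** z') + f (mat 1) * e' x (mat 1)) * (Q ** A ** P) $ fst x $ snd x)) (at 0)" for A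
      using DERIV_mult[OF e(3)[of A] e'(3)[of A]] z
      by (simp add: sum_distrib_left sum_distrib_right sum.distrib[symmetric] algebra_simps)
  qed
qed

text \<open>
  Conjugation by the identity gives the linearity of the derivative in its direction.
\<close>

lemma has_differential:
  fixes p :: "complex^'n^'n \<Rightarrow> complex" and P Q :: "complex^'n^'n"
  assumes "P ** Q = mat 1" and "p \<in> fun_algebra mat_coords"
  obtains c :: "complex^('n \<times> 'n)" where "\<And>A. ((\<lambda>s. p (mat 1 + msc s A)) has_field_derivative
       (\<Sum>x\<in>UNIV. c $ x * (Q ** A ** P) $ fst x $ snd x)) (at 0)"
proof -
  obtain e :: "'n \<times> 'n \<Rightarrow> complex^'n^'n \<Rightarrow> complex" where "\<forall>A. ((\<lambda>s. p (mat 1 + msc s A)) has_field_derivative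
       (\<Sum>x\<in>UNIV. e x (mat 1) * (Q ** A ** P) $ fst x $ snd x)) (at 0)"
    using conjugation_difference[OF assms(1), of "mat 1" "mat 1" p] assms(2) by auto
  then show thesis by (intro that[of "\<chi> x. e x (mat 1)"]) simp
qed

lemma LieD:
  assumes "A \<in> Lie G" "p \<in> fun_algebra mat_coords" "\<forall>g\<in>G. p g = 0"
  shows "deriv (\<lambda>s. p (mat 1 + msc s A)) 0 = 0"
  using assms unfolding Lie_def by simp

lemma Lie_add:
  fixes A B :: "complex^'n^'n"
  assumes "A \<in> Lie G" "B \<in> Lie G" shows "A + B \<in> Lie G"
  unfolding Lie_def
proof (intro CollectI ballI impI)
  fix p :: "complex^'n^'n \<Rightarrow> complex" assume p: "p \<in> fun_algebra mat_coords" "\<forall>g\<in>G. p g = 0"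
  obtain c :: "complex^('n \<times> 'n)" where c: "\<And>A. ((\<lambda>s. p (mat 1 + msc s A)) has_field_derivative
       (\<Sum>x\<in>UNIV. c $ x * (mat 1 ** A ** mat 1) $ fst x $ snd x)) (at 0)"
    using has_differential[of "mat 1" "mat 1" p] p(1) by auto
  have "deriv (\<lambda>s. p (mat 1 + msc s A)) 0 = 0" "deriv (\<lambda>s. p (mat 1 + msc s B)) 0 = 0"
    using LieD assms p by blast+
  then show "deriv (\<lambda>s. p (mat 1 + msc s (A + B))) 0 = 0"
    unfolding DERIV_imp_deriv[OF c] by (simp add: distrib_left sum.distrib)
qed

lemma Lie_msc:
  fixes A :: "complex^'n^'n"
  assumes "A \<in> Lie G" shows "msc r A \<in> Lie G"
  unfolding Lie_def
proof (intro CollectI ballI impI)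
  fix p :: "complex^'n^'n \<Rightarrow> complex" assume p: "p \<in> fun_algebra mat_coords" "\<forall>g\<in>G. p g = 0"
  obtain c :: "complex^('n \<times> 'n)" where c: "\<And>A. ((\<lambda>s. p (mat 1 + msc s A)) has_field_derivative
       (\<Sum>x\<in>UNIV. c $ x * (mat 1 ** A ** mat 1) $ fst x $ snd x)) (at 0)"
    using has_differential[of "mat 1" "mat 1" p] p(1) by auto
  have "deriv (\<lambda>s. p (mat 1 + msc s A)) 0 = 0"
    using LieD assms p by blast
  then show "deriv (\<lambda>s. p (mat 1 + msc s (msc r A))) 0 = 0"
    unfolding DERIV_imp_deriv[OF c] by (simp add: mult.left_commute[of _ r] sum_distrib_left[symmetric])
qed

lemma Lie_conjugate:
  fixes A t :: "complex^'n^'n"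
  assumes G: "subgroup G GLn" and t: "t \<in> G" and A: "A \<in> Lie G"
  shows "t ** A ** matrix_inv t \<in> Lie G"
  unfolding Lie_def
proof (intro CollectI ballI impI)
  fix p :: "complex^'n^'n \<Rightarrow> complex" assume p: "p \<in> fun_algebra mat_coords" "\<forall>g\<in>G. p g = 0"
  let ?p = "\<lambda>A. p (t ** A ** matrix_inv t)"
  have p': "?p \<in> fun_algebra mat_coords" by (rule fun_algebra_translate[OF p(1)])
  have "\<forall>g\<in>G. ?p g = 0" using p(2) subgroup_GLnD(2,4)[OF G] t by blast
  then have "deriv (\<lambda>s. ?p (mat 1 + msc s A)) 0 = 0" by (rule LieD[OF A p'])
  moreover have "t ** (mat 1 + msc s A) ** matrix_inv t = mat 1 + msc s (t ** A ** matrix_inv t)" for s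
    using matrix_inv(2)[OF subgroup_GLnD(3)[OF G t]]
    by (simp add: matrix_mult_add matrix_mult_msc)
  ultimately show "deriv (\<lambda>s. p (mat 1 + msc s (t ** A ** matrix_inv t))) 0 = 0" by simp
qed

lemma weight_character:
  fixes T :: "(complex^'n^'n) set"
  assumes D: "diagonalizes P Q T" and T: "subgroup T GLn"
  shows "restrict (\<lambda>t. (Q ** t ** P) $ i $ i / (Q ** t ** P) $ j $ j) T \<in> characters T"
proof -
  have "restrict (\<lambda>t. (Q ** t ** P) $ i $ i / (Q ** t ** P) $ j $ j) T \<in> rg (alg T) T"
    unfolding rg_alg_locally_fraction
    by (intro ballI exI[of _ "\<lambda>_. 1"] exI[of _ "\<lambda>A. (Q ** A ** P) $ i $ i"] exI[of _ "\<lambda>A. (Q ** A ** P) $ j $ j"])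
      (simp add: fun_algebra.const fun_algebra_sandwich diagonalizes_inverse(2)[OF D T])
  then show ?thesis
    using diagonalizes_inverse(2)[OF D T] diagonalizes_mult(1)[OF D] subgroup_GLnD(2)[OF T]
    by (simp add: characters_def)
qed

text \<open>
  Among the elements of the Lie algebra whose entry at \<open>(i, j)\<close> is not zero, take one with as few nonzero
  entries as possible.  If two of its entries had different weights for some \<open>t\<close>, then
  \<open>t A t\<^sup>-\<^sup>1 - w(t) A\<close> would have fewer.  Hence it is a weight vector, and its weight is trivial or a root.
\<close>

lemma Lie_entry_weight:
  fixes G T :: "(complex^'n^'n) set"
  assumes G: "subgroup G GLn" and TG: "T \<subseteq> G" and T: "subgroup T GLn" and D: "diagonalizes P Q T"
    and z: "z \<in> T" and roots: "\<And>\<alpha>. \<alpha> \<in> roots G T \<Longrightarrow> \<alpha> z = 1"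
    and A: "A \<in> Lie G" "(Q ** A ** P) $ i $ j \<noteq> 0"
  shows "(Q ** z ** P) $ i $ i = (Q ** z ** P) $ j $ j"
proof (rule ccontr)
  assume neq: "(Q ** z ** P) $ i $ i \<noteq> (Q ** z ** P) $ j $ j"
  define w where "w k l t = (Q ** t ** P) $ k $ k / (Q ** t ** P) $ l $ l" for k l t
  have PQ: "P ** Q = mat 1" using D unfolding diagonalizes_def by auto
  have conj: "(Q ** (t ** M ** matrix_inv t) ** P) $ k $ l = w k l t * (Q ** M ** P) $ k $ l" if "t \<in> T" for t M k l
    using diagonalizes_conjugate[OF D T that] by (simp add: w_def)
  let ?S = "\<lambda>A. {x. (Q ** A ** P) $ fst x $ snd x \<noteq> 0}"
  let ?L = "\<lambda>A. A \<in> Lie G \<and> (Q ** A ** P) $ i $ j \<noteq> 0"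
  obtain A0 where A0: "?L A0" and least: "\<And>B. ?L B \<Longrightarrow> card (?S A0) \<le> card (?S B)"
    using ex_has_least_nat[of ?L A "\<lambda>B. card (?S B)"] A by blast
  have same: "w k l t = w i j t" if kl: "(Q ** A0 ** P) $ k $ l \<noteq> 0" and t: "t \<in> T" for k l t
  proof (rule ccontr)
    assume ne: "w k l t \<noteq> w i j t"
    define B where "B = t ** A0 ** matrix_inv t + msc (- w k l t) A0"
    have entry: "(Q ** B ** P) $ k' $ l' = (w k' l' t - w k l t) * (Q ** A0 ** P) $ k' $ l'" for k' l'
      by (simp add: B_def matrix_mult_add matrix_mult_msc conj[OF t] algebra_simps)
    have "B \<in> Lie G"
      unfolding B_def using A0 t TG by (intro Lie_add Lie_msc Lie_conjugate[OF G]) auto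
    then have "?L B" using entry ne A0 by simp
    moreover have "?S B \<subset> ?S A0"
    proof
      show "?S B \<subseteq> ?S A0" using entry by auto
      have "(k, l) \<in> ?S A0" "(k, l) \<notin> ?S B" using kl entry by auto
      then show "?S B \<noteq> ?S A0" by blast
    qed
    ultimately show False using least[of B] psubset_card_mono[of "?S A0" "?S B"] by simp
  qed
  let ?\<alpha> = "restrict (w i j) T"
  have "t ** A0 ** matrix_inv t = msc (?\<alpha> t) A0" if t: "t \<in> T" for t
  proof (rule conjugated_eqI[OF PQ])
    fix k l
    show "(Q ** (t ** A0 ** matrix_inv t) ** P) $ k $ l = (Q ** msc (?\<alpha> t) A0 ** P) $ k $ l"
      using same[of k l t] t by (cases "(Q ** A0 ** P) $ k $ l = 0") (simp_all add: conj matrix_mult_msc)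
  qed
  then have "A0 \<in> weight_space G T ?\<alpha>" using A0 unfolding weight_space_def by blast
  moreover have "A0 \<noteq> 0" using A0 by auto
  moreover have w1: "w i j z \<noteq> 1"
    using neq diagonalizes_inverse(2)[OF D T z] by (simp add: w_def)
  then have "?\<alpha> \<noteq> \<one>\<^bsub>char_group T\<^esub>" using z by (auto dest!: fun_cong[of _ _ z])
  moreover have "?\<alpha> \<in> characters T" using weight_character[OF D T, of i j] by (simp add: w_def[abs_def])
  ultimately have "?\<alpha> \<in> roots G T" unfolding roots_def by blast
  then show False using roots w1 z by fastforce
qed

section \<open>The common kernel of the roots is central\<close>

text \<open>
  Subspaces of a finite-dimensional space are their own double annihilators.
\<close>

lemma separating_functional:
  fixes D :: "(complex^'m) set"
  assumes D: "vec.subspace D" and v: "v \<notin> D"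
  obtains a :: "complex^'m" where "\<And>u. u \<in> D \<Longrightarrow> (\<Sum>i\<in>UNIV. u $ i * a $ i) = 0"
    "(\<Sum>i\<in>UNIV. v $ i * a $ i) \<noteq> 0"
proof -
  obtain B where B: "B \<subseteq> D" "vec.independent B" "D \<subseteq> vec.span B"
    using vec.maximal_independent_subset by blast
  have "vec.span B \<subseteq> D" using B(1) D by (rule vec.span_minimal)
  with v have v': "v \<notin> vec.span B" by blast
  then have "vec.independent (insert v B)" using B(2) by (rule vec.independent_insertI)
  then obtain f :: "complex^'m \<Rightarrow> complex^'m" where f: "Vector_Spaces.linear (*s) (*s) f"
    and fB: "\<forall>x\<in>insert v B. f x = (if x = v then 1 else 0)"
    using vec.linear_independent_extend[of "insert v B" "\<lambda>x. if x = v then 1 else 0"] by blast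
  interpret f: Vector_Spaces.linear "(*s)" "(*s)" f by (rule f)
  obtain i0 :: 'm where True by simp
  define a :: "complex^'m" where "a = (\<chi> i. f (axis i 1) $ i0)"
  have val: "f u $ i0 = (\<Sum>i\<in>UNIV. u $ i * a $ i)" for u
  proof -
    have "u = (\<Sum>i\<in>UNIV. u $ i *s axis i 1)"
      by (simp add: vec_eq_iff axis_def if_distrib cong: if_cong)
    then have "f u = (\<Sum>i\<in>UNIV. u $ i *s f (axis i 1))" by (metis (no_types, lifting) f.scale f.sum sum.cong)
    then show ?thesis by (simp add: a_def)
  qed
  have "f u = 0" if "u \<in> D" for u
  proof (rule vec.linear_eq_0_on_span[OF f])
    show "u \<in> vec.span B" using that B(3) by blast
    fix b assume "b \<in> B"
    then show "f b = 0" using fB v' vec.span_base by fastforce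
  qed
  then show thesis using val fB by (intro that[of a]) (metis zero_index, metis insertI1 one_index zero_neq_one)
qed

text \<open>
  The Lie algebra is the annihilator of the differentials of the functions vanishing on \<open>G\<close>.  By double
  annihilation every coordinate that vanishes on it is such a differential.
\<close>

lemma vanishing_differential:
  fixes G :: "(complex^'n^'n) set" and P Q :: "complex^'n^'n"
  assumes PQ: "P ** Q = mat 1" "Q ** P = mat 1"
    and L: "\<And>A. A \<in> Lie G \<Longrightarrow> (Q ** A ** P) $ i $ j = 0"
  obtains p where "p \<in> fun_algebra mat_coords" "\<And>g. g \<in> G \<Longrightarrow> p g = 0"
    "\<And>A. ((\<lambda>s. p (mat 1 + msc s A)) has_field_derivative (Q ** A ** P) $ i $ j) (at 0)"
proof -
  let ?d = "\<lambda>(c :: complex^('n \<times> 'n)) A. \<Sum>x\<in>UNIV. c $ x * (Q ** A ** P) $ fst x $ snd x"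
  define D where "D = {c. \<exists>p\<in>fun_algebra mat_coords. (\<forall>g\<in>G. p g = 0) \<and>
    (\<forall>A. ((\<lambda>s. p (mat 1 + msc s A)) has_field_derivative ?d c A) (at 0))}"
  have D: "vec.subspace D"
  proof (rule vec.subspaceI)
    show "0 \<in> D" unfolding D_def
      by (intro CollectI bexI[OF _ fun_algebra.const[of 0]]) simp
  next
    fix c c' assume "c \<in> D" "c' \<in> D"
    then obtain p q where p: "p \<in> fun_algebra mat_coords" "\<forall>g\<in>G. p g = 0"
        "\<And>A. ((\<lambda>s. p (mat 1 + msc s A)) has_field_derivative ?d c A) (at 0)"
      and q: "q \<in> fun_algebra mat_coords" "\<forall>g\<in>G. q g = 0"
        "\<And>A. ((\<lambda>s. q (mat 1 + msc s A)) has_field_derivative ?d c' A) (at 0)"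
      unfolding D_def by blast
    have "((\<lambda>s. p (mat 1 + msc s A) + q (mat 1 + msc s A)) has_field_derivative ?d (c + c') A) (at 0)" for A
      using DERIV_add[OF p(3)[of A] q(3)[of A]] by (simp add: distrib_right sum.distrib)
    then show "c + c' \<in> D" unfolding D_def
      using p(2) q(2) by (intro CollectI bexI[OF _ fun_algebra.add[OF p(1) q(1)]]) simp
  next
    fix r c assume "c \<in> D"
    then obtain p where p: "p \<in> fun_algebra mat_coords" "\<forall>g\<in>G. p g = 0"
        "\<And>A. ((\<lambda>s. p (mat 1 + msc s A)) has_field_derivative ?d c A) (at 0)"
      unfolding D_def by blast
    have "((\<lambda>s. r * p (mat 1 + msc s A)) has_field_derivative ?d (r *s c) A) (at 0)" for A
      using DERIV_cmult[OF p(3)[of A], of r] by (simp add: sum_distrib_left mult.assoc)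
    then show "r *s c \<in> D" unfolding D_def
      using p(2) by (intro CollectI bexI[OF _ fun_algebra_cmult[OF p(1), of r]]) simp
  qed
  have "axis (i, j) 1 \<in> D"
  proof (rule ccontr)
    assume "axis (i, j) 1 \<notin> D"
    then obtain a :: "complex^('n \<times> 'n)" where a: "\<And>u. u \<in> D \<Longrightarrow> (\<Sum>x\<in>UNIV. u $ x * a $ x) = 0"
      "(\<Sum>x\<in>UNIV. axis (i, j) 1 $ x * a $ x) \<noteq> 0"
      using separating_functional[OF D] by blast
    \<comment> \<open>The matrix with coordinates \<open>a\<close> is annihilated by all differentials, so it lies in the Lie algebra.\<close>
    define M :: "complex^'n^'n" where "M = (\<chi> k l. a $ (k, l))"
    define A where "A = P ** M ** Q"
    have "Q ** A ** P = (Q ** P) ** M ** (Q ** P)" by (simp only: A_def matrix_mul_assoc)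
    then have coord: "(Q ** A ** P) $ fst x $ snd x = a $ x" for x by (simp add: PQ M_def)
    have "A \<in> Lie G"
      unfolding Lie_def
    proof (intro CollectI ballI impI)
      fix p :: "complex^'n^'n \<Rightarrow> complex" assume p: "p \<in> fun_algebra mat_coords" "\<forall>g\<in>G. p g = 0"
      obtain c where c: "\<And>A. ((\<lambda>s. p (mat 1 + msc s A)) has_field_derivative ?d c A) (at 0)"
        using has_differential[OF PQ(1) p(1)] by blast
      then have "c \<in> D" unfolding D_def using p by blast
      then show "deriv (\<lambda>s. p (mat 1 + msc s A)) 0 = 0"
        using DERIV_imp_deriv[OF c[of A]] a(1) by (simp add: coord)
    qed
    then have "a $ (i, j) = 0" using L[of A] coord[of "(i, j)"] by simp
    moreover have "(\<Sum>x\<in>UNIV. axis (i, j) 1 $ x * a $ x) = a $ (i, j)"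
      by (simp add: axis_def if_distrib if_distribR cong: if_cong)
    ultimately show False using a(2) by simp
  qed
  then obtain p where p: "p \<in> fun_algebra mat_coords" "\<forall>g\<in>G. p g = 0"
    "\<And>A. ((\<lambda>s. p (mat 1 + msc s A)) has_field_derivative ?d (axis (i, j) 1) A) (at 0)"
    unfolding D_def by blast
  have "?d (axis (i, j) 1) A = (Q ** A ** P) $ i $ j" for A
    by (simp add: axis_def if_distrib if_distribR cong: if_cong)
  then show thesis using p by (intro that[of p]) auto
qed

text \<open>
  The centralizer of \<open>z\<close> is closed, and it is open since translates of a neighbourhood of the identity
  cover it.
\<close>

lemma connected_group_commute:
  fixes G :: "(complex^'n^'n) set"
  assumes conn: "connected_space (tp (alg G))" and G: "subgroup G GLn" 
    and h: "h \<in> fun_algebra mat_coords" "h (mat 1) \<noteq> 0"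
    and near: "\<And>g. g \<in> G \<Longrightarrow> h g \<noteq> 0 \<Longrightarrow> z ** g = g ** z"
    and g: "g \<in> G"
  shows "z ** g = g ** z"
proof -
  let ?S = "{g \<in> G. z ** g = g ** z}"
  have top: "topspace (tp (alg G)) = G" using pts_alg[of G] by (simp add: pts_def)
  have "openin (tp (alg G)) ?S"
  proof (subst openin_subopen, intro ballI)
    fix s assume s: "s \<in> ?S"
    let ?h = "\<lambda>A. h (matrix_inv s ** A)"
    have inv: "invertible s" using subgroup_GLnD(3)[OF G] s by blast
    have "(\<lambda>A. h (matrix_inv s ** A ** mat 1)) \<in> fun_algebra mat_coords" by (rule fun_algebra_translate[OF h(1)])
    then have "openin (tp (alg G)) {g \<in> G. ?h g \<noteq> 0}" unfolding alg_def by (intro openin_zariski_basic) simp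
    moreover have "s \<in> {g \<in> G. ?h g \<noteq> 0}" using s h(2) matrix_inv(1)[OF inv] by simp
    moreover have "{g \<in> G. ?h g \<noteq> 0} \<subseteq> ?S"
    proof
      fix g assume "g \<in> {g \<in> G. ?h g \<noteq> 0}"
      then have g: "g \<in> G" and hg: "?h g \<noteq> 0" by auto
      have "matrix_inv s ** g \<in> G" using subgroup_GLnD(2,4)[OF G] g s by blast
      then have c: "z ** (matrix_inv s ** g) = (matrix_inv s ** g) ** z" using near hg by blast
      have eq: "g = s ** (matrix_inv s ** g)" using matrix_inv(2)[OF inv] by (simp add: matrix_mul_assoc)
      have "z ** (s ** (matrix_inv s ** g)) = (z ** s) ** (matrix_inv s ** g)" by (simp only: matrix_mul_assoc)
      also have "\<dots> = s ** (z ** (matrix_inv s ** g))" using s by (simp add: matrix_mul_assoc)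
      also have "\<dots> = s ** (matrix_inv s ** g) ** z" unfolding c by (simp only: matrix_mul_assoc)
      finally have "z ** g = g ** z" using eq by simp
      then show "g \<in> ?S" using g by blast
    qed
    ultimately show "\<exists>T. openin (tp (alg G)) T \<and> s \<in> T \<and> T \<subseteq> ?S" by blast
  qed
  moreover have "closedin (tp (alg G)) ?S"
    unfolding closedin_def top
  proof
    have eq: "G - ?S = (\<Union>x. {g \<in> G. (z ** g - g ** z) $ fst x $ snd x \<noteq> 0})"
      by (auto simp: vec_eq_iff)
    have "openin (tp (alg G)) {g \<in> G. (z ** g - g ** z) $ i $ j \<noteq> 0}" for i j
      unfolding alg_def
      using fun_algebra_diff[OF fun_algebra_sandwich[of z "mat 1" i j] fun_algebra_sandwich[of "mat 1" z i j]]
      by (intro openin_zariski_basic) simp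
    then show "openin (tp (alg G)) (G - ?S)" unfolding eq by (intro openin_Union) blast
  qed blast
  moreover have "mat 1 \<in> ?S" using subgroup_GLnD(1)[OF G] by simp
  ultimately have "?S = G" using conn unfolding connected_space_clopen_in top by blast
  then show ?thesis using g by blast
qed

text \<open>
  Let \<open>Y g\<close> be the vector of coordinates of \<open>z g z\<^sup>-\<^sup>1 - g\<close>.  Coordinates on which \<open>z\<close> acts trivially
  contribute zero entries.  Every other coordinate vanishes on the Lie algebra and so is the
  differential of a function \<open>p\<close> vanishing on \<open>G\<close>; then \<open>0 = p (z g z\<^sup>-\<^sup>1) - p g\<close> is a linear relation
  among the entries of \<open>Y g\<close>.  Together these relations form a square system \<open>N g (Y g) = 0\<close> with
  \<open>N 1 = 1\<close>, so \<open>Y\<close> vanishes wherever the determinant of \<open>N\<close> does not.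
\<close>

lemma central_if_Lie_entries:
  fixes G :: "(complex^'n^'n) set"
  assumes conn: "connected_space (tp (alg G))" and G: "subgroup G GLn" and zG: "z \<in> G"
    and D: "diagonalizes P Q T" and z: "z \<in> T" and T: "subgroup T GLn"
    and L: "\<And>A i j. A \<in> Lie G \<Longrightarrow> (Q ** A ** P) $ i $ j \<noteq> 0 \<Longrightarrow> (Q ** z ** P) $ i $ i = (Q ** z ** P) $ j $ j"
    and g: "g \<in> G"
  shows "z ** g = g ** z"
proof -
  have PQ: "P ** Q = mat 1" "Q ** P = mat 1" using D unfolding diagonalizes_def by auto
  define d where "d i = (Q ** z ** P) $ i $ i" for i
  have d0: "d i \<noteq> 0" for i using diagonalizes_inverse(2)[OF D T z] by (simp add: d_def)
  let ?z = "matrix_inv z"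
  have zz: "z ** ?z = mat 1" using matrix_inv(2)[OF subgroup_GLnD(3)[OF T z]] .
  define Y :: "complex^'n^'n \<Rightarrow> complex^('n \<times> 'n)" where
    "Y g = (\<chi> x. (Q ** (z ** g ** ?z - g) ** P) $ fst x $ snd x)" for g
  have Y: "Y g $ (i, j) = (d i / d j - 1) * (Q ** g ** P) $ i $ j" for g i j
  proof -
    have "Q ** (z ** g ** ?z - g) ** P = Q ** (z ** g ** ?z) ** P - Q ** g ** P"
      using matrix_mult_add[of Q "z ** g ** ?z - g" g] matrix_mult_add(2)[of "Q ** (z ** g ** ?z - g)" "Q ** g" P]
      by (simp add: algebra_simps)
    then have "(Q ** (z ** g ** ?z - g) ** P) $ i $ j = (Q ** (z ** g ** ?z) ** P) $ i $ j - (Q ** g ** P) $ i $ j"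
      by simp
    then show ?thesis
      unfolding diagonalizes_conjugate[OF D T z, of g i j] by (simp add: Y_def d_def algebra_simps)
  qed
  have row: "\<exists>e. (\<forall>x. e x \<in> fun_algebra mat_coords) \<and> (\<forall>g\<in>G. (\<Sum>x\<in>UNIV. e x g * Y g $ x) = 0) \<and>
      (\<forall>x. e x (mat 1) = (if x = y then 1 else 0))" for y
  proof (cases "d (fst y) = d (snd y)")
    case True
    then have "Y g $ y = 0" for g using Y[of g "fst y" "snd y"] d0 by simp
    then show ?thesis
      by (intro exI[of _ "\<lambda>x g. if x = y then 1 else 0"])
        (auto simp: fun_algebra.const if_distrib if_distribR cong: if_cong)
  next
    case False
    then have "(Q ** A ** P) $ fst y $ snd y = 0" if "A \<in> Lie G" for A
      using L[OF that, of "fst y" "snd y"] by (auto simp: d_def)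
    then obtain p where p: "p \<in> fun_algebra mat_coords" "\<And>g. g \<in> G \<Longrightarrow> p g = 0"
      "\<And>A. ((\<lambda>s. p (mat 1 + msc s A)) has_field_derivative (Q ** A ** P) $ fst y $ snd y) (at 0)"
      using vanishing_differential[OF PQ, of G "fst y" "snd y"] by blast
    obtain e where e: "\<And>x. e x \<in> fun_algebra mat_coords"
      "\<And>g. p (z ** g ** ?z) - p g = (\<Sum>x\<in>UNIV. e x g * (Q ** (z ** g ** ?z - g) ** P) $ fst x $ snd x)"
      "\<And>A. ((\<lambda>s. p (mat 1 + msc s A)) has_field_derivative
         (\<Sum>x\<in>UNIV. e x (mat 1) * (Q ** A ** P) $ fst x $ snd x)) (at 0)"
      using conjugation_difference[OF PQ(1) zz p(1)] by blast
    have "(\<Sum>x\<in>UNIV. e x g * Y g $ x) = 0" if "g \<in> G" for g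
    proof -
      have "z ** g ** ?z \<in> G" using subgroup_GLnD(2,4)[OF G] zG that by blast
      then show ?thesis using e(2)[of g] p(2) that by (simp add: Y_def)
    qed
    moreover have "e x (mat 1) = (if x = y then 1 else 0)" for x
    proof -
      \<comment> \<open>The values at the identity are read off by differentiating in the direction of an elementary matrix.\<close>
      define M :: "complex^'n^'n" where "M = (\<chi> k l. if (k, l) = x then 1 else 0)"
      have "Q ** (P ** M ** Q) ** P = (Q ** P) ** M ** (Q ** P)" by (simp only: matrix_mul_assoc)
      then have M: "Q ** (P ** M ** Q) ** P = M" by (simp add: PQ)
      have "(\<Sum>x'\<in>UNIV. e x' (mat 1) * M $ fst x' $ snd x') = M $ fst y $ snd y"
        using DERIV_unique[OF e(3)[of "P ** M ** Q"] p(3)[of "P ** M ** Q"]] unfolding M .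
      then show ?thesis by (simp add: M_def if_distrib if_distribR cong: if_cong) (auto split: if_splits)
    qed
    ultimately show ?thesis using e(1) by blast
  qed
  then obtain E :: "'n \<times> 'n \<Rightarrow> 'n \<times> 'n \<Rightarrow> complex^'n^'n \<Rightarrow> complex"
    where E: "\<And>y x. E y x \<in> fun_algebra mat_coords"
      "\<And>y g. g \<in> G \<Longrightarrow> (\<Sum>x\<in>UNIV. E y x g * Y g $ x) = 0"
      "\<And>y x. E y x (mat 1) = (if x = y then 1 else 0)"
    by metis
  define N :: "complex^'n^'n \<Rightarrow> complex^('n \<times> 'n)^('n \<times> 'n)" where "N g = (\<chi> y x. E y x g)" for g
  have "N (mat 1) = (\<chi> y x. if x = y then 1 else 0)" by (simp add: N_def E(3))
  then have N1: "N (mat 1) = mat 1" by (simp add: mat_def vec_eq_iff)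
  have near: "z ** g = g ** z" if *: "g \<in> G" "det (N g) \<noteq> 0" for g
  proof -
    have "N g *v Y g = 0" using E(2)[OF *(1)] by (simp add: N_def matrix_vector_mult_def vec_eq_iff)
    moreover obtain N' where "N' ** N g = mat 1"
      using *(2) unfolding invertible_det_nz[symmetric] invertible_def by blast
    ultimately have "Y g = 0" by (metis matrix_vector_mul_assoc matrix_vector_mul_lid matrix_vector_mult_0_right)
    then have "(Q ** (z ** g ** ?z - g) ** P) $ i $ j = (Q ** 0 ** P) $ i $ j" for i j
      by (simp add: Y_def vec_eq_iff)
    then have "z ** g ** ?z - g = 0" by (rule conjugated_eqI[OF PQ(1)])
    then have "z ** g ** ?z ** z = g ** z" by simp
    then show ?thesis
      using matrix_inv(1)[OF subgroup_GLnD(3)[OF T z]] by (simp add: matrix_mul_assoc[symmetric])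
  qed
  have "(\<lambda>g. det (N g)) \<in> fun_algebra mat_coords"
    by (rule fun_algebra_det) (simp add: N_def E(1))
  then show ?thesis
    using connected_group_commute[OF conn G _ _ near g, of "\<lambda>g. det (N g)"] by (simp add: N1)
qed

section \<open>Scalar multiplication on external tensor products\<close>

lemma on_class_eq:
  assumes "x \<in> C" "\<And>y. y \<in> C \<Longrightarrow> f y = f x"
  shows "on_class f C = f x"
proof -
  have "f ` C = {f x}" using assms by blast
  then show ?thesis by (simp add: on_class_def)
qed

text \<open>
  A map that is not constant on a class, or an empty class, gives a default value that depends on
  neither of them.
\<close>

lemma on_class_cases:
  obtains "on_class f C = (THE u. False)"
  | "C \<noteq> {}" "\<And>x. x \<in> C \<Longrightarrow> on_class f C = f x"
proof (cases "\<exists>u. f ` C = {u}")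
  case True
  then obtain u where u: "f ` C = {u}" by blast
  then have "on_class f C = u" by (simp add: on_class_def)
  moreover have "C \<noteq> {}" "\<And>x. x \<in> C \<Longrightarrow> f x = u" using u by auto
  ultimately show thesis using that(2) by simp
next
  case False
  then have "(\<lambda>u. f ` C = {u}) = (\<lambda>u. False)" by (intro ext) (use False in simp)
  then have "on_class f C = (THE u. False)" by (simp add: on_class_def the_elem_def)
  then show thesis by (rule that(1))
qed

text \<open>
  The quantification over \<open>F\<close> makes the property insensitive to the default values that scalar
  multiplication takes where it is not well defined.
\<close>

definition degenerate :: "('e, 'x) lbundle \<Rightarrow> bool" where
  "degenerate L \<longleftrightarrow> (\<forall>v\<in>pts (tot L). \<forall>F. finite F \<longrightarrow>
     (\<exists>c d. c \<noteq> d \<and> c \<notin> F \<and> d \<notin> F \<and> scl L c v = scl L d v))"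

text \<open>
  The vectors of \<open>E\<close> generate the fibres, each fibre being generated exactly once, and scalars multiply
  freely on them; so the points form a disjoint union of lines with origins kept apart.
\<close>

definition line_frame :: "('e, 'x) lbundle \<Rightarrow> 'e set \<Rightarrow> bool" where
  "line_frame L E \<longleftrightarrow> E \<subseteq> pts (tot L) \<and> bij_betw (\<lambda>(e, c). scl L c e) (E \<times> UNIV) (pts (tot L)) \<and>
     (\<forall>e\<in>E. \<forall>a c. scl L a (scl L c e) = scl L (a * c) e)"

lemma degenerateD:
  "degenerate L \<Longrightarrow> v \<in> pts (tot L) \<Longrightarrow> finite F \<Longrightarrow>
     \<exists>c d. c \<noteq> d \<and> c \<notin> F \<and> d \<notin> F \<and> scl L c v = scl L d v"
  unfolding degenerate_def by blast

lemma inj_not_degenerate: "v \<in> pts (tot L) \<Longrightarrow> inj (\<lambda>c. scl L c v) \<Longrightarrow> \<not> degenerate L"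
  using degenerateD[of L v "{}"] by (auto dest: injD)

lemma line_frameE:
  assumes "line_frame L E" "v \<in> pts (tot L)"
  obtains e c where "e \<in> E" "v = scl L c e"
proof -
  have "(\<lambda>(e, c). scl L c e) ` (E \<times> UNIV) = pts (tot L)"
    using assms(1) unfolding line_frame_def by (meson bij_betw_imp_surj_on)
  with assms(2) have "v \<in> (\<lambda>(e, c). scl L c e) ` (E \<times> UNIV)" by simp
  with that show thesis by auto
qed

lemma line_frame_pts: "line_frame L E \<Longrightarrow> e \<in> E \<Longrightarrow> scl L c e \<in> pts (tot L)"
  unfolding line_frame_def bij_betw_def by (elim conjE) (drule equalityD1, blast)

lemma line_frame_inj:
  assumes "line_frame L E" "e \<in> E" "e' \<in> E" "scl L c e = scl L c' e'"
  shows "e = e'" "c = c'"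
proof -
  have "inj_on (\<lambda>(e, c). scl L c e) (E \<times> UNIV)"
    using assms(1) unfolding line_frame_def bij_betw_def by blast
  from inj_onD[OF this, of "(e, c)" "(e', c')"] assms show "e = e'" "c = c'" by auto
qed

lemma line_frame_scl_scl:
  assumes "line_frame L E" "v \<in> pts (tot L)"
  shows "scl L a (scl L b v) = scl L (a * b) v"
proof -
  obtain e c where "e \<in> E" "v = scl L c e" using line_frameE[OF assms] .
  then show ?thesis using assms(1) unfolding line_frame_def by (simp add: mult.assoc)
qed

lemma line_frame_scl_one:
  assumes "line_frame L E" "v \<in> pts (tot L)"
  shows "scl L 1 v = v"
proof -
  obtain e c where "e \<in> E" "v = scl L c e" using line_frameE[OF assms] .
  then show ?thesis using assms(1) unfolding line_frame_def by simp
qed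

lemma pts_box: "pts (tot (box L M)) = box_class L M ` (pts (tot L) \<times> pts (tot M))"
  by (simp add: box_def)

lemma scl_box: "scl (box L M) c v = on_class (\<lambda>(v, w). box_class L M (scl L c v, w)) v"
  by (simp add: box_def)

lemma box_class_memI:
  "e \<in> pts (tot L) \<Longrightarrow> f \<in> pts (tot M) \<Longrightarrow> v = scl L a e \<Longrightarrow> w = scl M b f \<Longrightarrow> v' = scl L a' e
    \<Longrightarrow> w' = scl M b' f \<Longrightarrow> a * b = a' * b' \<Longrightarrow> (v', w') \<in> box_class L M (v, w)"
  unfolding box_class_def by blast

lemma box_class_memE:
  assumes "(v', w') \<in> box_class L M (v, w)"
  obtains e f a b a' b' where "e \<in> pts (tot L)" "f \<in> pts (tot M)" "v = scl L a e" "w = scl M b f"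
    "v' = scl L a' e" "w' = scl M b' f" "a * b = a' * b'"
  using assms unfolding box_class_def by blast

lemma box_class_refl: "box_class L M p \<noteq> {} \<Longrightarrow> p \<in> box_class L M p"
  by (cases p) (auto elim!: box_class_memE intro!: box_class_memI)

text \<open>
  Scalar multiplication may be computed on any representative once its result is known not to be the
  default value.
\<close>

lemma scl_box_cases:
  assumes "v = box_class L M (v0, w0)"
  obtains "scl (box L M) c v = (THE u. False)"
  | "(v0, w0) \<in> v" "\<And>v' w'. (v', w') \<in> v \<Longrightarrow> scl (box L M) c v = box_class L M (scl L c v', w')"
proof (cases rule: on_class_cases[of "\<lambda>(v, w). box_class L M (scl L c v, w)" v])
  case 1
  then show thesis by (intro that(1)) (simp add: scl_box)
next
  case 2
  then have "(v0, w0) \<in> v" using box_class_refl[of L M "(v0, w0)"] assms by simp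
  moreover have "scl (box L M) c v = box_class L M (scl L c v', w')" if "(v', w') \<in> v" for v' w'
    using 2(2)[OF that] by (simp add: scl_box)
  ultimately show thesis by (rule that(2))
qed

text \<open>
  If the default value occurs for two scalars outside \<open>F\<close>, these two give the same vector; otherwise it
  can be avoided by enlarging \<open>F\<close> by one scalar.
\<close>

lemma box_scaling_dichotomy:
  assumes v: "v = box_class L M (v0, w0)" and F: "finite F"
  obtains c d where "c \<noteq> d" "c \<notin> F" "d \<notin> F" "scl (box L M) c v = scl (box L M) d v"
  | F' where "finite F'" "F \<subseteq> F'" "(v0, w0) \<in> v"
    "\<And>c v' w'. c \<notin> F' \<Longrightarrow> (v', w') \<in> v \<Longrightarrow> scl (box L M) c v = box_class L M (scl L c v', w')"
proof (cases "\<exists>c d. c \<noteq> d \<and> c \<notin> F \<and> d \<notin> F \<and> scl (box L M) c v = (THE u. False)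
    \<and> scl (box L M) d v = (THE u. False)")
  case True
  then show thesis using that(1) by metis
next
  case False
  then obtain k where k: "\<And>c. c \<notin> F \<Longrightarrow> c \<noteq> k \<Longrightarrow> scl (box L M) c v \<noteq> (THE u. False)"
    by metis
  let ?F' = "insert k F"
  have all: "(v0, w0) \<in> v \<and> (\<forall>v' w'. (v', w') \<in> v \<longrightarrow> scl (box L M) c v = box_class L M (scl L c v', w'))"
    if "c \<notin> ?F'" for c
    by (rule scl_box_cases[OF v, of c]) (use k[of c] that in auto)
  obtain c where "c \<notin> ?F'" using F by (meson ex_new_if_finite finite_insert infinite_UNIV_char_0)
  with all F show thesis by (intro that(2)[of ?F']) auto
qed

text \<open>
  Scalars act on the first factor, so those that agree there agree on the product.
\<close>

lemma degenerate_box_left: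
  assumes "degenerate L"
  shows "degenerate (box L M)"
  unfolding degenerate_def
proof (intro ballI allI impI)
  fix v and F :: "complex set"
  assume "v \<in> pts (tot (box L M))" and F: "finite F"
  then obtain v0 w0 where v0: "v0 \<in> pts (tot L)" and v: "v = box_class L M (v0, w0)"
    by (auto simp: pts_box)
  show "\<exists>c d. c \<noteq> d \<and> c \<notin> F \<and> d \<notin> F \<and> scl (box L M) c v = scl (box L M) d v"
  proof (cases rule: box_scaling_dichotomy[OF v F])
    case (2 F')
    obtain c d where "c \<noteq> d" "c \<notin> F'" "d \<notin> F'" "scl L c v0 = scl L d v0"
      using degenerateD[OF assms v0 2(1)] by blast
    then show ?thesis using 2(2) 2(4)[of c v0 w0] 2(4)[of d v0 w0] 2(3) by (metis subsetD)
  qed blast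
qed

text \<open>
  Scalars can be moved from the second factor to the first: \<open>v \<otimes> b f = (b / b') v \<otimes> b' f\<close>.  If \<open>b\<^sub>1 f\<close> and
  \<open>b\<^sub>2 f\<close> coincide for distinct nonzero scalars, \<open>v \<otimes> b f\<close> therefore does not distinguish \<open>v\<close> from a
  proper multiple.
\<close>

lemma degenerate_box_right:
  assumes M: "degenerate M" and L: "line_frame L E"
  shows "degenerate (box L M)"
  unfolding degenerate_def
proof (intro ballI allI impI)
  fix v and F :: "complex set"
  assume "v \<in> pts (tot (box L M))" and F: "finite F"
  then obtain v0 w0 where v0: "v0 \<in> pts (tot L)" and v: "v = box_class L M (v0, w0)"
    by (auto simp: pts_box)
  show "\<exists>c d. c \<noteq> d \<and> c \<notin> F \<and> d \<notin> F \<and> scl (box L M) c v = scl (box L M) d v"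
  proof (cases rule: box_scaling_dichotomy[OF v F])
    case (2 F')
    obtain f b where f: "f \<in> pts (tot M)" and w0: "w0 = scl M b f"
      using 2(3) unfolding v by (elim box_class_memE)
    have v0': "v0 = scl L 1 v0" using line_frame_scl_one[OF L v0] by simp
    have mem: "(scl L s v0, scl M t f) \<in> v" if "b = s * t" for s t
      unfolding v by (rule box_class_memI[OF v0 f v0' w0 refl refl]) (use that in simp)
    have scale: "scl (box L M) c v = box_class L M (scl L (c * s) v0, scl M t f)"
      if "c \<notin> F'" "b = s * t" for c s t
      using 2(4)[OF that(1) mem[OF that(2)]] by (simp add: line_frame_scl_scl[OF L v0])
    show ?thesis
    proof (cases "b = 0")
      case True
      obtain c where c: "c \<notin> insert 0 F'"
        using 2(1) by (meson ex_new_if_finite finite_insert infinite_UNIV_char_0)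
      obtain d where d: "d \<notin> insert c (insert 0 F')"
        using 2(1) by (meson ex_new_if_finite finite_insert infinite_UNIV_char_0)
      have "scl (box L M) c v = scl (box L M) d v"
        using scale[of c "1 / c" 0] scale[of d "1 / d" 0] c d True by simp
      with c d 2(2) show ?thesis by (metis insertCI subsetD)
    next
      case False
      \<comment> \<open>Distinct nonzero scalars with \<open>b1 f = b2 f\<close>; then \<open>c\<close> and \<open>d = c * b2 / b1\<close> have the same effect on \<open>v\<close>.\<close>
    obtain b1 b2 where b: "b1 \<noteq> b2" "b1 \<noteq> 0" "b2 \<noteq> 0" "scl M b1 f = scl M b2 f"
        using degenerateD[OF M f, of "{0}"] by auto
      have "finite (insert 0 (F' \<union> (\<lambda>x. x * b1 / b2) ` F'))" using 2(1) by simp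
      then obtain c where c: "c \<noteq> 0" "c \<notin> F'" "c \<notin> (\<lambda>x. x * b1 / b2) ` F'"
        using ex_new_if_finite[OF infinite_UNIV_char_0, of "insert 0 (F' \<union> (\<lambda>x. x * b1 / b2) ` F')"] by auto
      define d where "d = c * b2 / b1"
      have "c = d * b1 / b2" using b by (simp add: d_def)
      then have d: "d \<notin> F'" using c(3) by blast
      have "d \<noteq> c" using b c(1) by (simp add: d_def field_simps)
      moreover have "scl (box L M) c v = scl (box L M) d v"
        using scale[OF c(2), of "b / b1" b1] scale[OF d, of "b / b2" b2] b
        by (simp add: d_def)
      ultimately show ?thesis using c(2) d 2(2) by (metis subsetD)
    qed
  qed blast
qed

text \<open>
  On genuine lines the relation between pairs is the expected one, so its classes are the pure tensors.
\<close>

lemma box_class_frame: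
  assumes L: "line_frame L E" and M: "line_frame M F" and e: "e \<in> E" and f: "f \<in> F"
  shows "box_class L M (scl L c e, scl M d f) = {(scl L c' e, scl M d' f) | c' d'. c' * d' = c * d}"
proof (intro equalityI subsetI)
  fix p assume "p \<in> box_class L M (scl L c e, scl M d f)"
  then obtain v' w' where p: "p = (v', w')" and "(v', w') \<in> box_class L M (scl L c e, scl M d f)"
    by (cases p) auto
  from this(2) obtain e1 f1 a b a' b' where 1: "e1 \<in> pts (tot L)" "f1 \<in> pts (tot M)"
      "scl L c e = scl L a e1" "scl M d f = scl M b f1" "v' = scl L a' e1" "w' = scl M b' f1" "a * b = a' * b'"
    by (elim box_class_memE)
  obtain e2 s where e2: "e2 \<in> E" "e1 = scl L s e2" using line_frameE[OF L 1(1)] .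
  obtain f2 t where f2: "f2 \<in> F" "f1 = scl M t f2" using line_frameE[OF M 1(2)] .
  have e2_pts: "e2 \<in> pts (tot L)" "f2 \<in> pts (tot M)" using L M e2 f2 unfolding line_frame_def by auto
  have "scl L c e = scl L (a * s) e2" using 1(3) e2 line_frame_scl_scl[OF L e2_pts(1)] by simp
  then have c: "e = e2" "c = a * s" using line_frame_inj[OF L e e2(1)] by auto
  have "scl M d f = scl M (b * t) f2" using 1(4) f2 line_frame_scl_scl[OF M e2_pts(2)] by simp
  then have d: "f = f2" "d = b * t" using line_frame_inj[OF M f f2(1)] by auto
  have "v' = scl L (a' * s) e" "w' = scl M (b' * t) f"
    using 1 e2 f2 c d line_frame_scl_scl[OF L e2_pts(1)] line_frame_scl_scl[OF M e2_pts(2)] by auto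
  moreover have "(a' * s) * (b' * t) = c * d"
    using 1(7) c d by (metis mult.assoc mult.commute)
  ultimately show "p \<in> {(scl L c' e, scl M d' f) | c' d'. c' * d' = c * d}" using p by blast
next
  fix p assume "p \<in> {(scl L c' e, scl M d' f) | c' d'. c' * d' = c * d}"
  then obtain c' d' where "p = (scl L c' e, scl M d' f)" "c' * d' = c * d" by blast
  moreover have "e \<in> pts (tot L)" "f \<in> pts (tot M)" using L M e f unfolding line_frame_def by auto
  ultimately show "p \<in> box_class L M (scl L c e, scl M d f)"
    by (auto intro!: box_class_memI)
qed

lemma scl_box_frame:
  assumes "line_frame L E" "line_frame M F" "e \<in> E" "f \<in> F"
  shows "scl (box L M) k (box_class L M (scl L c e, scl M d f)) = box_class L M (scl L (k * c) e, scl M d f)"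
proof -
  have e: "e \<in> pts (tot L)" using assms unfolding line_frame_def by auto
  have "on_class (\<lambda>(v, w). box_class L M (scl L k v, w)) (box_class L M (scl L c e, scl M d f))
      = (\<lambda>(v, w). box_class L M (scl L k v, w)) (scl L c e, scl M d f)"
  proof (rule on_class_eq)
    show "(scl L c e, scl M d f) \<in> box_class L M (scl L c e, scl M d f)"
      unfolding box_class_frame[OF assms] by blast
  next
    fix p assume "p \<in> box_class L M (scl L c e, scl M d f)"
    then obtain c' d' where "p = (scl L c' e, scl M d' f)" "c' * d' = c * d"
      unfolding box_class_frame[OF assms] by blast
    then show "(\<lambda>(v, w). box_class L M (scl L k v, w)) p
        = (\<lambda>(v, w). box_class L M (scl L k v, w)) (scl L c e, scl M d f)"
      using box_class_frame[OF assms] line_frame_scl_scl[OF assms(1) e] by (simp add: mult.assoc)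
  qed
  then show ?thesis using line_frame_scl_scl[OF assms(1) e] by (simp add: scl_box)
qed

lemma line_frame_box:
  assumes L: "line_frame L E" and M: "line_frame M F"
  shows "line_frame (box L M) (box_class L M ` (E \<times> F))"
proof -
  have EF: "E \<subseteq> pts (tot L)" "F \<subseteq> pts (tot M)" using L M unfolding line_frame_def by auto
  have scl: "scl (box L M) k (box_class L M (e, f)) = box_class L M (scl L k e, scl M 1 f)"
    if "e \<in> E" "f \<in> F" for e f k
    using scl_box_frame[OF L M that, of k 1 1] line_frame_scl_one[OF L, of e] line_frame_scl_one[OF M, of f] EF that
    by (simp add: subset_iff)
  have inj: "e = e' \<and> f = f' \<and> k = k'"
    if *: "e \<in> E" "f \<in> F" "e' \<in> E" "f' \<in> F"
      "box_class L M (scl L k e, scl M 1 f) = box_class L M (scl L k' e', scl M 1 f')" for e f e' f' k k'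
  proof -
    have "(scl L k e, scl M 1 f) \<in> box_class L M (scl L k' e', scl M 1 f')"
      unfolding *(5)[symmetric] unfolding box_class_frame[OF L M *(1,2)] by blast
    then obtain c' d' where "scl L k e = scl L c' e'" "scl M 1 f = scl M d' f'" "c' * d' = k'"
      unfolding box_class_frame[OF L M *(3,4)] by auto
    then show ?thesis
      using line_frame_inj[OF L *(1,3)] line_frame_inj[OF M *(2,4)] by (metis mult.right_neutral)
  qed
  show ?thesis
    unfolding line_frame_def
  proof (intro conjI ballI allI)
    show "box_class L M ` (E \<times> F) \<subseteq> pts (tot (box L M))" using EF by (auto simp: pts_box)
    show "bij_betw (\<lambda>(e, c). scl (box L M) c e) (box_class L M ` (E \<times> F) \<times> UNIV) (pts (tot (box L M)))"
      unfolding bij_betw_def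
    proof
      show "inj_on (\<lambda>(e, c). scl (box L M) c e) (box_class L M ` (E \<times> F) \<times> UNIV)"
      proof (rule inj_onI)
        fix p q :: "('a \<times> 'c) set \<times> complex" assume "p \<in> box_class L M ` (E \<times> F) \<times> UNIV" "q \<in> box_class L M ` (E \<times> F) \<times> UNIV"
        then obtain e f c e' f' c' where *: "e \<in> E" "f \<in> F" "p = (box_class L M (e, f), c)"
          "e' \<in> E" "f' \<in> F" "q = (box_class L M (e', f'), c')" by auto
        assume "(\<lambda>(e, c). scl (box L M) c e) p = (\<lambda>(e, c). scl (box L M) c e) q"
        then have "box_class L M (scl L c e, scl M 1 f) = box_class L M (scl L c' e', scl M 1 f')"
          using * scl by simp
        from inj[OF *(1,2,4,5) this] show "p = q" using * by simp
      qed
      show "(\<lambda>(e, c). scl (box L M) c e) ` (box_class L M ` (E \<times> F) \<times> UNIV) = pts (tot (box L M))"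
      proof (intro equalityI subsetI)
        fix v assume "v \<in> (\<lambda>(e, c). scl (box L M) c e) ` (box_class L M ` (E \<times> F) \<times> UNIV)"
        then obtain e f c where "e \<in> E" "f \<in> F" "v = box_class L M (scl L c e, scl M 1 f)"
          using scl by auto
        then show "v \<in> pts (tot (box L M))"
          using line_frame_pts[OF L] line_frame_pts[OF M] by (auto simp: pts_box)
      next
        fix v assume "v \<in> pts (tot (box L M))"
        then obtain v0 w0 where "v0 \<in> pts (tot L)" "w0 \<in> pts (tot M)" "v = box_class L M (v0, w0)"
          by (auto simp: pts_box)
        then obtain e f c d where ef: "e \<in> E" "f \<in> F" "v = box_class L M (scl L c e, scl M d f)"
          using line_frameE[OF L] line_frameE[OF M] by metis
        then have "v = box_class L M (scl L (c * d) e, scl M 1 f)"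
          using box_class_frame[OF L M ef(1,2), of c d] box_class_frame[OF L M ef(1,2), of "c * d" 1] by simp
        then have "v = scl (box L M) (c * d) (box_class L M (e, f))" using scl ef by simp
        then show "v \<in> (\<lambda>(e, c). scl (box L M) c e) ` (box_class L M ` (E \<times> F) \<times> UNIV)"
          using ef by force
      qed
    qed
    fix g a c assume "g \<in> box_class L M ` (E \<times> F)"
    then obtain e f where "e \<in> E" "f \<in> F" "g = box_class L M (e, f)" by auto
    then show "scl (box L M) a (scl (box L M) c g) = scl (box L M) (a * c) g"
      using scl scl_box_frame[OF L M, of e f a c 1] by simp
  qed
qed

text \<open>
  Bilinearity of the tensor product: \<open>r v \<otimes> s w = r s (v \<otimes> w)\<close> for every representative.
\<close>

lemma box_act_scalar:
  assumes L: "line_frame L E" and M: "line_frame M F"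
    and r: "\<And>v. v \<in> pts (tot L) \<Longrightarrow> a g v = scl L r v"
    and s: "\<And>w. w \<in> pts (tot M) \<Longrightarrow> b g w = scl M s w"
    and v: "v \<in> pts (tot (box L M))"
  shows "box_act L M a b g v = scl (box L M) (r * s) v"
proof -
  obtain v0 w0 where "v0 \<in> pts (tot L)" "w0 \<in> pts (tot M)" "v = box_class L M (v0, w0)"
    using v by (auto simp: pts_box)
  then obtain e f c d where ef: "e \<in> E" "f \<in> F" "v = box_class L M (scl L c e, scl M d f)"
    using line_frameE[OF L] line_frameE[OF M] by metis
  have ef_pts: "e \<in> pts (tot L)" "f \<in> pts (tot M)" using L M ef unfolding line_frame_def by auto
  note frame = box_class_frame[OF L M ef(1,2)]
  have val: "(\<lambda>(v, w). box_class L M (a g v, b g w)) (scl L c' e, scl M d' f)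
      = box_class L M (scl L (r * s * c) e, scl M d f)" if "c' * d' = c * d" for c' d'
  proof -
    have "r * c' * (s * d') = r * s * c * d" using that by (metis mult.assoc mult.left_commute)
    then have "box_class L M (scl L (r * c') e, scl M (s * d') f) = box_class L M (scl L (r * s * c) e, scl M d f)"
      unfolding frame by (simp only: mult.assoc)
    then show ?thesis
      using r[OF line_frame_pts[OF L ef(1)]] s[OF line_frame_pts[OF M ef(2)]]
        line_frame_scl_scl[OF L ef_pts(1)] line_frame_scl_scl[OF M ef_pts(2)] by simp
  qed
  have "box_act L M a b g v = (\<lambda>(v, w). box_class L M (a g v, b g w)) (scl L c e, scl M d f)"
    unfolding box_act_def
  proof (rule on_class_eq)
    show "(scl L c e, scl M d f) \<in> v" unfolding ef(3) frame by blast
    fix p assume "p \<in> v"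
    then obtain c' d' where "p = (scl L c' e, scl M d' f)" "c' * d' = c * d"
      unfolding ef(3) frame by blast
    then show "(\<lambda>(v, w). box_class L M (a g v, b g w)) p
        = (\<lambda>(v, w). box_class L M (a g v, b g w)) (scl L c e, scl M d f)"
      using val by (metis (no_types, lifting))
  qed
  also have "\<dots> = scl (box L M) (r * s) v"
    using val[of c d] scl_box_frame[OF L M ef(1,2), of "r * s" c d] ef(3) by simp
  finally show ?thesis .
qed

section \<open>Homogeneous line bundles\<close>

text \<open>
  The intersection of \<open>T\<close> and \<open>U\<close> is trivial, its elements being diagonalizable and unipotent.
\<close>

lemma extend_char_torus:
  assumes T: "subgroup T GLn" and D: "diagonalizes P Q T" and U: "connected_normal_unipotent B U"
    and t: "t \<in> T"
  shows "extend_char T U \<theta> t = \<theta> t"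
  unfolding extend_char_def
proof (rule the_equality)
  have "subgroup U (GLn\<lparr>carrier := B\<rparr>)"
    using U unfolding connected_normal_unipotent_def by (meson normal_imp_subgroup)
  then have "mat 1 \<in> U" using subgroup.one_closed by (fastforce simp: GLn_def)
  then show "\<exists>t'\<in>T. \<exists>u\<in>U. t = t' ** u \<and> \<theta> t = \<theta> t'"
    using t by (intro bexI[of _ t] bexI[of _ "mat 1"]) auto
next
  fix c assume "\<exists>t'\<in>T. \<exists>u\<in>U. t = t' ** u \<and> c = \<theta> t'"
  then obtain t' u where t': "t' \<in> T" "u \<in> U" "t = t' ** u" "c = \<theta> t'" by blast
  have "u = matrix_inv t' ** t"
    using t'(3) matrix_inv(1)[OF subgroup_GLnD(3)[OF T t'(1)]] by (simp add: matrix_mul_assoc)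
  then have "u \<in> T" using subgroup_GLnD(2,4)[OF T] t t'(1) by blast
  moreover have "unipotent u" using U t'(2) unfolding connected_normal_unipotent_def by blast
  ultimately have "u = mat 1" by (rule unipotent_diagonalizable_trivial[OF D])
  then show "c = \<theta> t" using t' by simp
qed

context
  fixes G B T U :: "(complex^'n^'n) set" and \<theta> :: "complex^'n^'n \<Rightarrow> complex"
  assumes G: "subgroup G GLn" and B: "subgroup B GLn" and BG: "B \<subseteq> G"
    and one: "extend_char T U \<theta> (mat 1) = 1"
begin

lemma hlb_class_def2:
  "hlb_class B T U \<theta> (g, z) = {(g ** matrix_inv b, inverse (extend_char T U \<theta> b) * z) | b. b \<in> B}"
  by (simp add: hlb_class_def)

lemma hlb_class_refl: "(g, z) \<in> hlb_class B T U \<theta> (g, z)"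
proof -
  have "matrix_inv (mat 1 :: complex^'n^'n) = mat 1" by (rule matrix_inv_unique) simp
  then show ?thesis unfolding hlb_class_def2
    using subgroup_GLnD(1)[OF B] one by (intro CollectI exI[of _ "mat 1"]) simp
qed

lemma pts_hlb: "pts (tot (hlb G B T U \<theta>)) = hlb_class B T U \<theta> ` (G \<times> UNIV)"
  by (simp add: hlb_def aff_line_def)

lemma scl_hlb: "scl (hlb G B T U \<theta>) c v = on_class (\<lambda>(g, z). hlb_class B T U \<theta> (g, c * z)) v"
  by (simp add: hlb_def)

lemma hlb_class_zero:
  assumes "b \<in> B"
  shows "hlb_class B T U \<theta> (g ** matrix_inv b, 0) = hlb_class B T U \<theta> (g, 0)"
proof -
  have "(\<lambda>b'. g ** matrix_inv b ** matrix_inv b') ` B = (\<lambda>b'. g ** matrix_inv b') ` B"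
  proof (intro equalityI subsetI)
    fix x assume "x \<in> (\<lambda>b'. g ** matrix_inv b ** matrix_inv b') ` B"
    then obtain b' where b': "b' \<in> B" "x = g ** matrix_inv b ** matrix_inv b'" by auto
    then have "x = g ** matrix_inv (b' ** b)"
      using subgroup_GLnD(3)[OF B] assms by (simp add: matrix_inv_mult matrix_mul_assoc)
    then show "x \<in> (\<lambda>b'. g ** matrix_inv b') ` B" using subgroup_GLnD(2)[OF B b'(1) assms] by blast
  next
    fix x assume "x \<in> (\<lambda>b'. g ** matrix_inv b') ` B"
    then obtain b' where b': "b' \<in> B" "x = g ** matrix_inv b'" by auto
    have binv: "invertible b" "invertible b'" using subgroup_GLnD(3)[OF B] assms b' by auto
    have "matrix_inv (b' ** matrix_inv b) = b ** matrix_inv b'"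
      using matrix_inv_mult[OF binv(2), of "matrix_inv b"] matrix_inv_inv[OF binv(1)]
        subgroup_GLnD(3)[OF B subgroup_GLnD(4)[OF B assms]] by simp
    then have "g ** matrix_inv b ** matrix_inv (b' ** matrix_inv b) = g ** (matrix_inv b ** b) ** matrix_inv b'"
      by (simp add: matrix_mul_assoc)
    then have "x = g ** matrix_inv b ** matrix_inv (b' ** matrix_inv b)"
      using b' matrix_inv(1)[OF binv(1)] by simp
    then show "x \<in> (\<lambda>b'. g ** matrix_inv b ** matrix_inv b') ` B"
      using subgroup_GLnD(2)[OF B b'(1) subgroup_GLnD(4)[OF B assms]] by blast
  qed
  then show ?thesis unfolding hlb_class_def2 by (auto simp: image_iff set_eq_iff)
qed

text \<open>
  If scalar multiplication by \<open>k \<noteq> 0\<close> is well defined on the class of \<open>(g, z)\<close> with \<open>z \<noteq> 0\<close>, comparing the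
  representatives reached by \<open>b\<^sub>1 b\<^sub>2\<close> and by \<open>b\<^sub>2\<close> followed by \<open>b\<^sub>1\<close> shows that the extended character is
  multiplicative at \<open>(b\<^sub>1, b\<^sub>2)\<close>.
\<close>

lemma degenerate_hlb:
  assumes b1: "b1 \<in> B" and b2: "b2 \<in> B"
    and "extend_char T U \<theta> (b1 ** b2) \<noteq> extend_char T U \<theta> b1 * extend_char T U \<theta> b2"
  shows "degenerate (hlb G B T U \<theta>)"
  unfolding degenerate_def
proof (intro ballI allI impI)
  fix v and F :: "complex set"
  assume "v \<in> pts (tot (hlb G B T U \<theta>))" and F: "finite F"
  then obtain g z where g: "g \<in> G" and v: "v = hlb_class B T U \<theta> (g, z)"
    by (auto simp: pts_hlb)
  have inv: "invertible g" "invertible b1" "invertible b2"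
    using subgroup_GLnD(3)[OF G] g b1 b2 BG by auto
  obtain c where c: "c \<notin> insert 0 F"
    using F by (meson ex_new_if_finite finite_insert infinite_UNIV_char_0)
  obtain d where d: "d \<notin> insert c (insert 0 F)"
    using F by (meson ex_new_if_finite finite_insert infinite_UNIV_char_0)
  have "scl (hlb G B T U \<theta>) c v = scl (hlb G B T U \<theta>) d v"
  proof (cases "z = 0")
    case True
    have "scl (hlb G B T U \<theta>) k v = hlb_class B T U \<theta> (g, 0)" for k
    proof -
      have "on_class (\<lambda>(g, z). hlb_class B T U \<theta> (g, k * z)) v = (\<lambda>(g, z). hlb_class B T U \<theta> (g, k * z)) (g, z)"
      proof (rule on_class_eq)
        show "(g, z) \<in> v" unfolding v by (rule hlb_class_refl)
        fix y assume "y \<in> v"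
        then obtain b where "b \<in> B" "y = (g ** matrix_inv b, 0)" unfolding v True hlb_class_def2 by auto
        then show "(\<lambda>(g, z). hlb_class B T U \<theta> (g, k * z)) y = (\<lambda>(g, z). hlb_class B T U \<theta> (g, k * z)) (g, z)"
          using True hlb_class_zero by simp
      qed
      then show ?thesis using True by (simp add: scl_hlb)
    qed
    then show ?thesis by simp
  next
    case False
    have "scl (hlb G B T U \<theta>) k v = (THE u. False)" if k: "k \<noteq> 0" for k
    proof (cases rule: on_class_cases[of "\<lambda>(g, z). hlb_class B T U \<theta> (g, k * z)" v])
      case 1
      then show ?thesis by (simp add: scl_hlb)
    next
      case 2
      let ?\<epsilon> = "extend_char T U \<theta>"
      have "(g ** matrix_inv b2, inverse (?\<epsilon> b2) * z) \<in> v" "(g, z) \<in> v"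
        unfolding v using hlb_class_refl b2 by (auto simp: hlb_class_def2)
      from 2(2)[OF this(1)] 2(2)[OF this(2)]
      have eq: "hlb_class B T U \<theta> (g ** matrix_inv b2, k * (inverse (?\<epsilon> b2) * z)) = hlb_class B T U \<theta> (g, k * z)"
        by simp
      have "(g ** matrix_inv b2 ** matrix_inv b1, inverse (?\<epsilon> b1) * (k * (inverse (?\<epsilon> b2) * z)))
          \<in> hlb_class B T U \<theta> (g, k * z)"
        unfolding eq[symmetric] unfolding hlb_class_def2 using b1 by blast
      then obtain b where b: "b \<in> B" "g ** matrix_inv b2 ** matrix_inv b1 = g ** matrix_inv b"
        "inverse (?\<epsilon> b1) * (k * (inverse (?\<epsilon> b2) * z)) = inverse (?\<epsilon> b) * (k * z)"
        unfolding hlb_class_def2 by auto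
      have invb: "invertible b" using subgroup_GLnD(3)[OF B b(1)] .
      have "matrix_inv (b1 ** b2) = matrix_inv b"
        using b(2) matrix_mul_left_cancel[OF inv(1)] inv by (simp add: matrix_inv_mult matrix_mul_assoc[symmetric])
      then have "b = b1 ** b2"
        using matrix_inv_inv[OF invb] matrix_inv_inv[OF invertible_mult[OF inv(2,3)]] by simp
      moreover have "inverse (?\<epsilon> b1) * inverse (?\<epsilon> b2) = inverse (?\<epsilon> b)"
        using b(3) False k by (simp add: field_simps)
      ultimately show ?thesis using assms(3) by (metis inverse_inverse_eq inverse_mult_distrib)
    qed
    with c d show ?thesis by simp
  qed
  with c d show "\<exists>c d. c \<noteq> d \<and> c \<notin> F \<and> d \<notin> F \<and> scl (hlb G B T U \<theta>) c v = scl (hlb G B T U \<theta>) d v"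
    by (metis insertCI)
qed

context
  assumes mult: "\<And>b b'. b \<in> B \<Longrightarrow> b' \<in> B \<Longrightarrow>
    extend_char T U \<theta> (b ** b') = extend_char T U \<theta> b * extend_char T U \<theta> b'"
begin

lemma extend_char_inv:
  assumes "b \<in> B"
  shows "extend_char T U \<theta> b * extend_char T U \<theta> (matrix_inv b) = 1"
  using mult[OF assms subgroup_GLnD(4)[OF B assms]] one matrix_inv(2)[OF subgroup_GLnD(3)[OF B assms]]
  by simp

lemma hlb_class_eq:
  assumes b: "b \<in> B"
  shows "hlb_class B T U \<theta> (g ** matrix_inv b, inverse (extend_char T U \<theta> b) * z) = hlb_class B T U \<theta> (g, z)"
proof -
  have sub: "hlb_class B T U \<theta> (g ** matrix_inv b, inverse (extend_char T U \<theta> b) * z) \<subseteq> hlb_class B T U \<theta> (g, z)"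
    if b: "b \<in> B" for b g z
  proof
    fix p assume "p \<in> hlb_class B T U \<theta> (g ** matrix_inv b, inverse (extend_char T U \<theta> b) * z)"
    then obtain b' where b': "b' \<in> B" "p = (g ** matrix_inv b ** matrix_inv b',
        inverse (extend_char T U \<theta> b') * (inverse (extend_char T U \<theta> b) * z))"
      unfolding hlb_class_def2 by auto
    then have "p = (g ** matrix_inv (b' ** b), inverse (extend_char T U \<theta> (b' ** b)) * z)"
      using subgroup_GLnD(3)[OF B] b mult[OF b'(1) b] by (simp add: matrix_inv_mult matrix_mul_assoc)
    then show "p \<in> hlb_class B T U \<theta> (g, z)"
      unfolding hlb_class_def2 using subgroup_GLnD(2)[OF B b'(1) b] by blast
  qed
  let ?b = "matrix_inv b"
  have inv: "invertible b" and bi: "?b \<in> B" using subgroup_GLnD(3,4)[OF B] b by auto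
  have "g ** ?b ** matrix_inv ?b = g"
    using matrix_inv_inv[OF inv] matrix_inv(1)[OF inv] by (simp add: matrix_mul_assoc[symmetric])
  moreover have "inverse (extend_char T U \<theta> ?b) * (inverse (extend_char T U \<theta> b) * z) = z"
  proof -
    have "inverse (extend_char T U \<theta> b * extend_char T U \<theta> ?b) = 1"
      using extend_char_inv[OF b] by simp
    then show ?thesis by (metis inverse_mult_distrib mult.assoc mult.commute mult.left_neutral)
  qed
  ultimately have "hlb_class B T U \<theta> (g, z) \<subseteq> hlb_class B T U \<theta> (g ** ?b, inverse (extend_char T U \<theta> b) * z)"
    using sub[OF bi, of "g ** ?b" "inverse (extend_char T U \<theta> b) * z"] by (simp only:)
  with sub[OF b, of g z] show ?thesis by (rule subset_antisym)
qed

lemma on_hlb_class: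
  assumes "\<And>b. b \<in> B \<Longrightarrow> f (g ** matrix_inv b, inverse (extend_char T U \<theta> b) * z) = f (g, z)"
  shows "on_class f (hlb_class B T U \<theta> (g, z)) = f (g, z)"
proof (rule on_class_eq[OF hlb_class_refl])
  fix y assume "y \<in> hlb_class B T U \<theta> (g, z)"
  then show "f y = f (g, z)" unfolding hlb_class_def2 using assms by auto
qed

lemma scl_hlb_class: "scl (hlb G B T U \<theta>) c (hlb_class B T U \<theta> (g, z)) = hlb_class B T U \<theta> (g, c * z)"
proof -
  have "hlb_class B T U \<theta> (g ** matrix_inv b, c * (inverse (extend_char T U \<theta> b) * z)) = hlb_class B T U \<theta> (g, c * z)"
    if "b \<in> B" for b
    using hlb_class_eq[OF that, of g "c * z"] by (simp only: mult.left_commute)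
  then show ?thesis unfolding scl_hlb by (subst on_hlb_class) auto
qed

lemma hlb_act_class: "hlb_act B T U \<theta> h (hlb_class B T U \<theta> (g, z)) = hlb_class B T U \<theta> (h ** g, z)"
  unfolding hlb_act_def
  by (subst on_hlb_class) (simp_all add: hlb_class_eq matrix_mul_assoc)

text \<open>
  A frame consists of the classes \<open>[g, 1]\<close>, with \<open>g\<close> running through representatives of the cosets of \<open>B\<close>.
\<close>

lemma line_frame_hlb:
  obtains E where "line_frame (hlb G B T U \<theta>) E"
proof -
  define r where "r X = (SOME g. g \<in> X)" for X :: "(complex^'n^'n) set"
  let ?K = "\<lambda>g. g <#\<^bsub>GLn\<^esub> B"
  have coset: "?K g = {g ** b | b. b \<in> B}" for g
    by (auto simp: l_coset_def GLn_def)
  have r: "\<exists>b\<in>B. r (?K g) = g ** b" for g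
  proof -
    have "g \<in> ?K g" unfolding coset using subgroup_GLnD(1)[OF B] by (metis (mono_tags, lifting) CollectI matrix_mul_rid)
    then have "r (?K g) \<in> ?K g" unfolding r_def by (rule someI)
    then show ?thesis unfolding coset by blast
  qed
  have same: "?K (g ** b) = ?K g" if b: "b \<in> B" for g b
  proof (intro equalityI subsetI)
    fix x assume "x \<in> ?K (g ** b)"
    then obtain b' where b': "b' \<in> B" "x = g ** b ** b'" unfolding coset by auto
    then have "x = g ** (b ** b')" by (simp add: matrix_mul_assoc)
    then show "x \<in> ?K g" unfolding coset using subgroup_GLnD(2)[OF B b b'(1)] by blast
  next
    fix x assume "x \<in> ?K g"
    then obtain b' where b': "b' \<in> B" "x = g ** b'" unfolding coset by auto
    have "g ** b ** (matrix_inv b ** b') = g ** (b ** matrix_inv b) ** b'" by (simp only: matrix_mul_assoc)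
    then have "x = g ** b ** (matrix_inv b ** b')"
      using matrix_inv(2)[OF subgroup_GLnD(3)[OF B b]] b' by simp
    then show "x \<in> ?K (g ** b)"
      unfolding coset using subgroup_GLnD(2)[OF B subgroup_GLnD(4)[OF B b] b'(1)] by blast
  qed
  let ?R = "(\<lambda>g. r (?K g)) ` G"
  let ?E = "(\<lambda>g. hlb_class B T U \<theta> (g, 1)) ` ?R"
  have RG: "?R \<subseteq> G"
  proof
    fix h assume "h \<in> ?R"
    then obtain g where "g \<in> G" "h = r (?K g)" by auto
    moreover obtain b where "b \<in> B" "r (?K g) = g ** b" using r by blast
    ultimately have "g \<in> G" "b \<in> B" "h = g ** b" by simp_all
    then show "h \<in> G" using BG subgroup_GLnD(2)[OF G] by blast
  qed
  have scl1: "scl (hlb G B T U \<theta>) c (hlb_class B T U \<theta> (g, 1)) = hlb_class B T U \<theta> (g, c)" for c g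
    by (simp add: scl_hlb_class)
  have inj: "g = g' \<and> c = c'" if *: "g \<in> ?R" "g' \<in> ?R" "hlb_class B T U \<theta> (g, c) = hlb_class B T U \<theta> (g', c')"
    for g g' c c'
  proof -
    have "(g, c) \<in> hlb_class B T U \<theta> (g', c')" using *(3) hlb_class_refl by metis
    then obtain b where b: "b \<in> B" "g = g' ** matrix_inv b" "c = inverse (extend_char T U \<theta> b) * c'"
      unfolding hlb_class_def2 by auto
    obtain h h' where h: "g = r (?K h)" "g' = r (?K h')" using * by auto
    have "?K g = ?K h" using r[of h] same[of _ h] h(1) by auto
    moreover have "?K g' = ?K h'" using r[of h'] same[of _ h'] h(2) by auto
    moreover have "?K g = ?K g'" using same[of "matrix_inv b" g'] subgroup_GLnD(4)[OF B b(1)] b(2) by simp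
    ultimately have gg: "g = g'" using h by simp
    have "g' \<in> G" using RG * by blast
    then have "mat 1 = matrix_inv b"
      using b(2) gg matrix_mul_left_cancel[of g' "mat 1" "matrix_inv b"] subgroup_GLnD(3)[OF G] by simp
    then have "b = matrix_inv (mat 1)" using matrix_inv_inv[OF subgroup_GLnD(3)[OF B b(1)]] by simp
    also have "\<dots> = mat 1" by (rule matrix_inv_unique) simp
    finally have "b = mat 1" .
    then show ?thesis using gg b(3) one by simp
  qed
  have "line_frame (hlb G B T U \<theta>) ?E"
    unfolding line_frame_def
  proof (intro conjI ballI allI)
    show "?E \<subseteq> pts (tot (hlb G B T U \<theta>))" using RG by (auto simp: pts_hlb)
    show "bij_betw (\<lambda>(e, c). scl (hlb G B T U \<theta>) c e) (?E \<times> UNIV) (pts (tot (hlb G B T U \<theta>)))"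
      unfolding bij_betw_def
    proof
      show "inj_on (\<lambda>(e, c). scl (hlb G B T U \<theta>) c e) (?E \<times> UNIV)"
      proof (rule inj_onI, clarify)
        fix c c' g g' assume "g \<in> G" "g' \<in> G" 
          "scl (hlb G B T U \<theta>) c (hlb_class B T U \<theta> (r (?K g), 1)) = scl (hlb G B T U \<theta>) c' (hlb_class B T U \<theta> (r (?K g'), 1))"
        then show "hlb_class B T U \<theta> (r (?K g), 1) = hlb_class B T U \<theta> (r (?K g'), 1) \<and> c = c'"
          unfolding scl1 using inj[of "r (?K g)" "r (?K g')" c c'] by auto
      qed
      show "(\<lambda>(e, c). scl (hlb G B T U \<theta>) c e) ` (?E \<times> UNIV) = pts (tot (hlb G B T U \<theta>))"
      proof (intro equalityI subsetI)
        fix v assume "v \<in> (\<lambda>(e, c). scl (hlb G B T U \<theta>) c e) ` (?E \<times> UNIV)"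
        then obtain h c where "h \<in> G" "v = hlb_class B T U \<theta> (r (?K h), c)" using scl1 by auto
        moreover from this(1) have "r (?K h) \<in> G" using RG by blast
        ultimately show "v \<in> pts (tot (hlb G B T U \<theta>))" by (auto simp: pts_hlb)
      next
        fix v assume "v \<in> pts (tot (hlb G B T U \<theta>))"
        then obtain g z where g: "g \<in> G" "v = hlb_class B T U \<theta> (g, z)" by (auto simp: pts_hlb)
        obtain b where b: "b \<in> B" "r (?K g) = g ** b" using r by blast
        have "v = hlb_class B T U \<theta> (g ** b, inverse (extend_char T U \<theta> (matrix_inv b)) * z)"
          using hlb_class_eq[OF subgroup_GLnD(4)[OF B b(1)], of g z] g(2)
            matrix_inv_inv[OF subgroup_GLnD(3)[OF B b(1)]] by simp
        then have "v = scl (hlb G B T U \<theta>) (inverse (extend_char T U \<theta> (matrix_inv b)) * z) (hlb_class B T U \<theta> (r (?K g), 1))"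
          using scl1 b(2) by simp
        then show "v \<in> (\<lambda>(e, c). scl (hlb G B T U \<theta>) c e) ` (?E \<times> UNIV)" using g(1) by force
      qed
    qed
    fix e a c assume "e \<in> ?E"
    then show "scl (hlb G B T U \<theta>) a (scl (hlb G B T U \<theta>) c e) = scl (hlb G B T U \<theta>) (a * c) e"
      by (auto simp: scl_hlb_class)
  qed
  then show thesis by (rule that)
qed

lemma hlb_act_central:
  assumes z: "z \<in> B" and central: "\<And>g. g \<in> G \<Longrightarrow> z ** g = g ** z"
    and v: "v \<in> pts (tot (hlb G B T U \<theta>))"
  shows "hlb_act B T U \<theta> z v = scl (hlb G B T U \<theta>) (inverse (extend_char T U \<theta> z)) v"
proof -
  obtain g w where g: "g \<in> G" "v = hlb_class B T U \<theta> (g, w)" using v by (auto simp: pts_hlb)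
  have inv: "invertible z" using subgroup_GLnD(3)[OF B z] .
  have "hlb_act B T U \<theta> z v = hlb_class B T U \<theta> (g ** z, w)"
    using g hlb_act_class central by simp
  also have "\<dots> = hlb_class B T U \<theta> (g ** z ** matrix_inv z, inverse (extend_char T U \<theta> z) * w)"
    using hlb_class_eq[OF z] by simp
  also have "g ** z ** matrix_inv z = g"
    using matrix_inv(2)[OF inv] by (simp add: matrix_mul_assoc[symmetric])
  finally show ?thesis using g(2) scl_hlb_class by simp
qed

end

end

section \<open>Descent\<close>

text \<open>
  The action on a pulled back bundle moves only the base point, so an element fixing \<open>x\<close> fixes the whole
  fibre over \<open>x\<close>; a local trivialization provides a vector in this fibre on which scalars act freely.
\<close>

lemma descent_trivial_on_stabilizer:
  assumes "descends_to G X act L act' Y \<pi> M" "x \<in> pts X" "\<pi> x \<in> pts Y" "g \<in> G" "act g x = x"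
  obtains v where "v \<in> pts (tot L)" "inj (\<lambda>c. scl L c v)" "act' g v = v"
proof -
  let ?P = "pullback_lb X \<pi> M"
  from assms(1) obtain \<Phi> where M: "line_bundle Y M" and iso: "isomorphism (tot ?P) (tot L) \<Phi>"
    and eq: "\<forall>v\<in>pts (tot ?P). prj L (\<Phi> v) = prj ?P v \<and> (\<forall>c. \<Phi> (scl ?P c v) = scl L c (\<Phi> v)) \<and>
      (\<forall>g\<in>G. \<Phi> ((\<lambda>(x, v). (act g x, v)) v) = act' g (\<Phi> v))"
    unfolding descends_to_def equivariant_lb_iso_def by blast
  have bij: "bij_betw \<Phi> (pts (tot ?P)) (pts (tot L))" by (rule isomorphism_bij[OF iso])
  have pts_P: "pts (tot ?P) = {(x, v). x \<in> pts X \<and> v \<in> pts (tot M) \<and> \<pi> x = prj M v}"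
    unfolding pullback_lb_def by auto
  have scl_M: "\<And>c v. v \<in> pts (tot M) \<Longrightarrow> scl M c v \<in> pts (tot M) \<and> prj M (scl M c v) = prj M v"
    using M unfolding line_bundle_def by blast
  from M assms(3) obtain U \<phi> where U: "openin (tp Y) U" "\<pi> x \<in> U"
    and iso\<phi>: "isomorphism (sub_fs (tot M) {v \<in> pts (tot M). prj M v \<in> U}) (prod_fs (sub_fs Y U) aff_line) \<phi>"
    and \<phi>: "\<forall>v\<in>pts (tot M). prj M v \<in> U \<longrightarrow> fst (\<phi> v) = prj M v \<and>
           (\<forall>c. \<phi> (scl M c v) = (prj M v, c * snd (\<phi> v)))"
    unfolding line_bundle_def by (elim conjE ballE[of _ _ "\<pi> x"]) auto
  have "(\<pi> x, 1) \<in> pts (prod_fs (sub_fs Y U) aff_line)"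
    using U assms(3) by (simp add: aff_line_def)
  then obtain u where u: "u \<in> pts (tot M)" "prj M u \<in> U" "\<phi> u = (\<pi> x, 1)"
    using bij_betw_imp_surj_on[OF isomorphism_bij[OF iso\<phi>]] by (force simp: image_iff)
  then have prj_u: "prj M u = \<pi> x" using \<phi> by force
  have inj_u: "inj (\<lambda>c. scl M c u)"
  proof (rule injI)
    fix c d assume "scl M c u = scl M d u"
    then have "\<phi> (scl M c u) = \<phi> (scl M d u)" by simp
    then show "c = d" using \<phi> u by auto
  qed
  have xu: "(x, scl M c u) \<in> pts (tot ?P)" for c
    using assms(2) u(1) scl_M[OF u(1)] prj_u by (simp add: pts_P)
  have xu0: "(x, u) \<in> pts (tot ?P)" using assms(2) u(1) prj_u by (simp add: pts_P)
  show thesis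
  proof
    show "\<Phi> (x, u) \<in> pts (tot L)" using bij xu0 by (meson bij_betwE)
    have scl_\<Phi>: "scl L c (\<Phi> (x, u)) = \<Phi> (x, scl M c u)" for c
    proof -
      have "\<Phi> (scl ?P c (x, u)) = scl L c (\<Phi> (x, u))" using eq xu0 by blast
      then show ?thesis by (simp add: pullback_lb_def)
    qed
    show "inj (\<lambda>c. scl L c (\<Phi> (x, u)))"
    proof (rule injI)
      fix c d assume "scl L c (\<Phi> (x, u)) = scl L d (\<Phi> (x, u))"
      then have "\<Phi> (x, scl M c u) = \<Phi> (x, scl M d u)" by (simp add: scl_\<Phi>)
      then have "scl M c u = scl M d u"
        using bij xu by (metis bij_betw_imp_inj_on inj_onD prod.inject)
      then show "c = d" using inj_u by (auto dest: injD)
    qed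
    have "\<Phi> ((\<lambda>(x, v). (act g x, v)) (x, u)) = act' g (\<Phi> (x, u))"
      using eq xu0 assms(4) by blast
    then show "act' g (\<Phi> (x, u)) = \<Phi> (x, u)" using assms(5) by simp
  qed
qed

lemma flag_act_central:
  fixes G B :: "(complex^'n^'n) set"
  assumes B: "subgroup B GLn" and z: "z \<in> B" and central: "\<And>g. g \<in> G \<Longrightarrow> z ** g = g ** z"
    and X: "X \<in> pts (flag_variety G B)"
  shows "flag_act z X = X"
proof -
  obtain g where g: "g \<in> G" "X = g <#\<^bsub>GLn\<^esub> B" using X by (auto simp: flag_variety_def)
  have coset: "h <#\<^bsub>GLn\<^esub> S = (\<lambda>b. h ** b) ` S" for h and S :: "(complex^'n^'n) set"
    by (auto simp: l_coset_def GLn_def)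
  have zB: "(\<lambda>b. z ** b) ` B = B"
  proof (intro equalityI subsetI)
    fix b assume b: "b \<in> B"
    have "b = z ** (matrix_inv z ** b)"
      using matrix_inv(2)[OF subgroup_GLnD(3)[OF B z]] by (simp add: matrix_mul_assoc)
    then show "b \<in> (\<lambda>b. z ** b) ` B"
      using subgroup_GLnD(2)[OF B subgroup_GLnD(4)[OF B z] b] by blast
  qed (use subgroup_GLnD(2)[OF B z] in auto)
  have "flag_act z X = (\<lambda>b. g ** b) ` ((\<lambda>b. z ** b) ` B)"
    unfolding flag_act_def g(2) coset image_image using central[OF g(1)] by (simp add: matrix_mul_assoc)
  then show ?thesis unfolding zB g(2) coset .
qed

lemma nondegenerate_extend_char_mult:
  assumes "subgroup G GLn" "subgroup B GLn" "B \<subseteq> G" "extend_char T U \<theta> (mat 1) = 1"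
    and "\<not> degenerate (hlb G B T U \<theta>)" "b \<in> B" "b' \<in> B"
  shows "extend_char T U \<theta> (b ** b') = extend_char T U \<theta> b * extend_char T U \<theta> b'"
  using degenerate_hlb[OF assms(1-4)] assms(5-7) by blast

text \<open>
  The vector \<open>v\<close> excludes degeneracy, first of the triple product and then of each factor; so all three
  factors are unions of lines on which \<open>z\<close> acts by scalars.
\<close>

lemma central_scalar_trivial:
  assumes G: "subgroup G GLn" and B: "subgroup B GLn" and BG: "B \<subseteq> G"
    and one: "extend_char T U l1 (mat 1) = 1" "extend_char T U l2 (mat 1) = 1" "extend_char T U l3 (mat 1) = 1"
    and z: "z \<in> B" and central: "\<And>g. g \<in> G \<Longrightarrow> z ** g = g ** z"
    and v: "v \<in> pts (tot (hlb3 G B T U l1 l2 l3))" and inj: "inj (\<lambda>c. scl (hlb3 G B T U l1 l2 l3) c v)"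
    and fixed: "hlb3_act G B T U l1 l2 l3 z v = v"
  shows "extend_char T U l1 z * extend_char T U l2 z * extend_char T U l3 z = 1"
proof -
  let ?L1 = "hlb G B T U l1" and ?L2 = "hlb G B T U l2" and ?L3 = "hlb G B T U l3"
  have nd: "\<not> degenerate (box ?L1 (box ?L2 ?L3))" using inj_not_degenerate[OF v inj] by (simp add: hlb3_def)
  have m1: "extend_char T U l1 (b ** b') = extend_char T U l1 b * extend_char T U l1 b'" if "b \<in> B" "b' \<in> B" for b b'
    by (rule nondegenerate_extend_char_mult[OF G B BG one(1) _ that]) (use nd degenerate_box_left in blast)
  obtain E1 where E1: "line_frame ?L1 E1" using line_frame_hlb[OF G B BG one(1) m1] .
  have nd2: "\<not> degenerate (box ?L2 ?L3)" using nd degenerate_box_right[OF _ E1] by blast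
  have m2: "extend_char T U l2 (b ** b') = extend_char T U l2 b * extend_char T U l2 b'" if "b \<in> B" "b' \<in> B" for b b'
    by (rule nondegenerate_extend_char_mult[OF G B BG one(2) _ that]) (use nd2 degenerate_box_left in blast)
  obtain E2 where E2: "line_frame ?L2 E2" using line_frame_hlb[OF G B BG one(2) m2] .
  have m3: "extend_char T U l3 (b ** b') = extend_char T U l3 b * extend_char T U l3 b'" if "b \<in> B" "b' \<in> B" for b b'
    by (rule nondegenerate_extend_char_mult[OF G B BG one(3) _ that]) (use nd2 degenerate_box_right[OF _ E2] in blast)
  obtain E3 where E3: "line_frame ?L3 E3" using line_frame_hlb[OF G B BG one(3) m3] .
  have act1: "hlb_act B T U l1 z w = scl ?L1 (inverse (extend_char T U l1 z)) w" if "w \<in> pts (tot ?L1)" for w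
    by (rule hlb_act_central[OF G B BG one(1) m1 z central that])
  have act2: "hlb_act B T U l2 z w = scl ?L2 (inverse (extend_char T U l2 z)) w" if "w \<in> pts (tot ?L2)" for w
    by (rule hlb_act_central[OF G B BG one(2) m2 z central that])
  have act3: "hlb_act B T U l3 z w = scl ?L3 (inverse (extend_char T U l3 z)) w" if "w \<in> pts (tot ?L3)" for w
    by (rule hlb_act_central[OF G B BG one(3) m3 z central that])
  note E23 = line_frame_box[OF E2 E3]
  have act23: "box_act ?L2 ?L3 (hlb_act B T U l2) (hlb_act B T U l3) z w = scl (box ?L2 ?L3)
      (inverse (extend_char T U l2 z) * inverse (extend_char T U l3 z)) w" if "w \<in> pts (tot (box ?L2 ?L3))" for w
    by (rule box_act_scalar[where a = "hlb_act B T U l2" and b = "hlb_act B T U l3" and g = z,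
          OF E2 E3 act2 act3 that])
  have "box_act ?L1 (box ?L2 ?L3) (hlb_act B T U l1) (box_act ?L2 ?L3 (hlb_act B T U l2) (hlb_act B T U l3)) z v
    = scl (box ?L1 (box ?L2 ?L3)) (inverse (extend_char T U l1 z) *
      (inverse (extend_char T U l2 z) * inverse (extend_char T U l3 z))) v"
    by (rule box_act_scalar[where a = "hlb_act B T U l1" and g = z
          and b = "box_act ?L2 ?L3 (hlb_act B T U l2) (hlb_act B T U l3)", OF E1 E23 act1 act23])
      (use v in \<open>simp_all add: hlb3_def\<close>)
  then have "hlb3_act G B T U l1 l2 l3 z v = scl (hlb3 G B T U l1 l2 l3) (inverse (extend_char T U l1 z) *
      (inverse (extend_char T U l2 z) * inverse (extend_char T U l3 z))) v"
    by (simp add: hlb3_act_def hlb3_def)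
  moreover have "scl (hlb3 G B T U l1 l2 l3) 1 v = v"
    using line_frame_scl_one[OF line_frame_box[OF E1 E23]] v by (simp add: hlb3_def)
  ultimately have "inverse (extend_char T U l1 z) * (inverse (extend_char T U l2 z) * inverse (extend_char T U l3 z)) = 1"
    using inj fixed by (metis injD)
  then have "inverse (extend_char T U l1 z * extend_char T U l2 z * extend_char T U l3 z) = 1"
    by (simp add: mult.assoc)
  then show ?thesis by (metis inverse_1 inverse_inverse_eq)
qed

theorem proposition14:
  fixes G B T U :: "(complex^'n^'n) set"
    and lam mu nu :: "complex^'n^'n \<Rightarrow> complex"
    and Y :: "'y fspace"
    and \<pi> :: "(complex^'n^'n) set \<times> (complex^'n^'n) set \<times> (complex^'n^'n) set \<Rightarrow> 'y"
  assumes "simple_group G"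
    and "borel_subgroup G B"
    and "maximal_torus G T" and "T \<subseteq> B"
    and "unipotent_radical B U"
    and "lam \<in> dominant_regular_characters G B T"
    and "mu \<in> dominant_regular_characters G B T"
    and "nu \<in> dominant_regular_characters G B T"
    and "flag3_ss G B T U lam mu nu \<noteq> {}"
    and "good_quotient G (sub_fs (flag3 G B) (flag3_ss G B T U lam mu nu)) flag3_act Y \<pi>"
    and "\<exists>M :: ('f, 'y) lbundle.
           descends_to G (sub_fs (flag3 G B) (flag3_ss G B T U lam mu nu)) flag3_act
             (restrict_lb (hlb3 G B T U lam mu nu) (flag3_ss G B T U lam mu nu))
             (hlb3_act G B T U lam mu nu) Y \<pi> M"
  shows "lam \<otimes>\<^bsub>char_group T\<^esub> mu \<otimes>\<^bsub>char_group T\<^esub> nu \<in> root_lattice G T"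
proof -
  let ?ss = "flag3_ss G B T U lam mu nu" and ?L = "hlb3 G B T U lam mu nu"
  have G: "subgroup G GLn" and conn: "connected_space (tp (alg G))"
    using assms(1) unfolding simple_group_def connected_group_def linear_algebraic_group_def by auto
  have B: "subgroup B GLn" and BG: "B \<subseteq> G"
    using assms(2) unfolding borel_subgroup_def connected_solvable_def connected_group_def linear_algebraic_group_def
    by auto
  have torus: "torus T" using assms(3) unfolding maximal_torus_def by blast
  then have T: "subgroup T GLn" unfolding torus_def linear_algebraic_group_def by blast
  have TG: "T \<subseteq> G" using assms(4) BG by blast
  have U: "connected_normal_unipotent B U" using assms(5) unfolding unipotent_radical_def by blast
  have chars: "lam \<in> characters T" "mu \<in> characters T" "nu \<in> characters T"
    using assms(6-8) unfolding dominant_regular_characters_def by auto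
  obtain P Q where D: "diagonalizes P Q T" using torus_diagonalizable[OF torus] .
  note ext = extend_char_torus[OF T D U]
  have one: "extend_char T U \<theta> (mat 1) = 1" if "\<theta> \<in> characters T" for \<theta>
  proof -
    have "\<theta> (mat 1) * \<theta> (mat 1) = \<theta> (mat 1)"
      using charactersD(4)[OF that subgroup_GLnD(1)[OF T] subgroup_GLnD(1)[OF T]] by simp
    then show ?thesis using charactersD(3)[OF that] ext subgroup_GLnD(1)[OF T] by simp
  qed
  obtain M :: "('f, 'y) lbundle" where M: "descends_to G (sub_fs (flag3 G B) ?ss) flag3_act
      (restrict_lb ?L ?ss) (hlb3_act G B T U lam mu nu) Y \<pi> M"
    using assms(11) by blast
  obtain x where x: "x \<in> ?ss" using assms(9) by blast
  then have x3: "x \<in> pts (flag3 G B)" unfolding flag3_ss_def semistable_locus_def by blast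
  have xX: "x \<in> pts (sub_fs (flag3 G B) ?ss)" using x x3 by simp
  have "\<pi> ` pts (sub_fs (flag3 G B) ?ss) = pts Y"
    using assms(10) unfolding good_quotient_def by (elim conjE)
  then have \<pi>x: "\<pi> x \<in> pts Y" using xX by (metis imageI)
  have "lam \<otimes>\<^bsub>char_group T\<^esub> mu \<otimes>\<^bsub>char_group T\<^esub> nu \<in> generate (char_group T) (roots G T)"
  proof (rule character_in_generated_lattice[OF torus])
    show "roots G T \<subseteq> characters T" by (auto simp: roots_def)
    show "lam \<otimes>\<^bsub>char_group T\<^esub> mu \<otimes>\<^bsub>char_group T\<^esub> nu \<in> characters T"
      using characters_mult[OF T characters_mult[OF T chars(1,2)] chars(3)] by (simp only: char_group_simps)
    fix z assume z: "z \<in> T" and roots: "\<And>\<alpha>. \<alpha> \<in> roots G T \<Longrightarrow> \<alpha> z = 1"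
    have zB: "z \<in> B" and zG: "z \<in> G" using z assms(4) TG by auto
    have "(Q ** z ** P) $ i $ i = (Q ** z ** P) $ j $ j" if "A \<in> Lie G" "(Q ** A ** P) $ i $ j \<noteq> 0" for A i j
      using G TG T D z roots that by (rule Lie_entry_weight)
    then have central: "z ** g = g ** z" if "g \<in> G" for g
      using that by (rule central_if_Lie_entries[OF conn G zG D z T])
    have "flag3_act z x = x"
      using x3 flag_act_central[OF B zB central] by (auto simp: flag3_act_def flag3_def)
    then obtain v where v: "v \<in> pts (tot (restrict_lb ?L ?ss))" "inj (\<lambda>c. scl (restrict_lb ?L ?ss) c v)"
      "hlb3_act G B T U lam mu nu z v = v"
      using descent_trivial_on_stabilizer[OF M xX \<pi>x zG] by blast
    then have "extend_char T U lam z * extend_char T U mu z * extend_char T U nu z = 1"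
      by (intro central_scalar_trivial[OF G B BG one[OF chars(1)] one[OF chars(2)] one[OF chars(3)] zB central])
        (auto simp: restrict_lb_def)
    then show "(lam \<otimes>\<^bsub>char_group T\<^esub> mu \<otimes>\<^bsub>char_group T\<^esub> nu) z = 1"
      using z by (simp add: ext)
  qed
  then show ?thesis by (simp add: root_lattice_def)
qed

end
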